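(* For every real number $\epsilon \in (0,1]$ there are constants $\zeta = \zeta(\epsilon)$ and $C = C(\epsilon)$ such that for every prime number $p$ there exist positive integers $q$ and $a$ with $0<a<q$, $\gcd(a,q)=1$, $q \le C p^{1+\epsilon}$ and $q \equiv 0 \pmod p$, such that all partial quotients $b_1,\dots,b_s$ in the regular continued fraction expansion $a/q = [0;b_1,\dots,b_s]$ satisfy $b_j \le \zeta$ for $1 \le j \le s$.
   Context: For coprime positive integers $0<a<q$, the regular continued fraction expansion is the unique representation $\frac{a}{q} = [0;b_1,\dots,b_s] = \cfrac{1}{b_1+\cfrac{1}{b_2+\cdots+\cfrac{1}{b_s}}}$ with positive integers $b_j$ and $b_s\ge 2$ (obtained by the Euclidean algorithm); the $b_j$ are the partial quotients. *)

theory Defs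
  imports Complex_Main "HOL-Computational_Algebra.Primes"
begin

text \<open>Partial quotients of the regular continued fraction of a/q (0 < a < q),
  computed by the Euclidean algorithm: a/q = 1/(b1 + (q mod a)/a) with b1 = q div a.\<close>
fun partial_quotients :: "nat \<Rightarrow> nat \<Rightarrow> nat list" where
  "partial_quotients a q = (if a = 0 then [] else (q div a) # partial_quotients (q mod a) a)"

end

theory Submission
  imports Defs "HOL-Analysis.Convex" "HOL-Real_Asymp.Real_Asymp" "HOL-Number_Theory.Cong"
begin

text \<open>A word of partial quotients corresponds to a product of the matrices with rows \<open>(b, 1)\<close>
  and \<open>(1, 0)\<close>, and the denominator of the fraction is the upper left entry. For a word in
  three parts this entry is \<open>y\<^sup>T g x\<close>, with vectors \<open>x\<close>, \<open>y\<close> of size about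
  \<open>p\<^bsup>1/2\<^esup>\<close> and a matrix \<open>g\<close> of size at most \<open>p\<^bsup>\<epsilon>\<^esup>\<close>. Words with digits bounded in
  terms of \<open>\<eta>\<close> still provide \<open>X\<^bsup>2 - \<eta>\<^esup>\<close> matrices of norm at most \<open>X\<close>, so there are many
  choices of \<open>x\<close>, \<open>y\<close>, \<open>g\<close>. That \<open>p\<close> divides \<open>y\<^sup>T g x\<close> for one of these choices follows
  from a spectral gap. The averaging operator over the matrices \<open>g\<close>, acting on functions of mean
  zero on the lines of the plane over the field with \<open>p\<close> elements, is raised to a power that
  depends only on \<open>\<epsilon>\<close>. Schur orthogonality bounds its correlations by the number of
  coincidences modulo \<open>p\<close> among products of the matrices, hence by the number of elements of the
  principal congruence subgroup of level \<open>p\<close> in a ball (as in the method of Sarnak and Xue). This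
  number is controlled because their trace is \<open>2\<close> modulo \<open>p\<^sup>2\<close>.\<close>

section \<open>Integer matrices of size two\<close>

text \<open>Three exponents fix the constants. A vanishing correlation sets \<open>card A\<close>,
  about \<open>\<rho> powr (2 - \<eta>)\<close>, against a bound of about \<open>\<rho>\<close> for
  the operator on functions of mean zero. In the power \<open>4 * n\<close> the gain is about
  \<open>\<rho> ^ (4 * n)\<close>, while Schur orthogonality costs p^2. So products of
  \<open>4 * n\<close> letters must reach a norm somewhat beyond p^2, and there the congruence
  subgroup must still have at most linearly many elements in terms of the radius. Its elements are
  counted as diagonal entries times traces times divisors of a number of size at most p^2.4, and a
  divisor bound with exponent 1/3 keeps this linear up to radius p^2.2. Hence
  \<open>\<beta> = 11 / (20 * real n)\<close>, that is, 4 n \<open>\<beta>\<close> = 2.2. The defect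
  \<open>\<eta>\<close> enters multiplied by \<open>n\<close>; the value
  \<open>1 / (50 * real n)\<close> keeps the total loss below the margin of 0.2. The set
  \<open>A\<close> has no structure of its own: coincidences are counted in the whole ball
  \<open>B\<close>, which is affordable because \<open>A\<close> is smaller only by a factor of
  about \<open>\<rho> powr \<eta>\<close>.\<close>

datatype mat2 = Mat2 (m11: int) (m12: int) (m21: int) (m22: int)

instantiation mat2 :: monoid_mult
begin

definition one_mat2 :: mat2 where "1 = Mat2 1 0 0 1"

definition times_mat2 :: "mat2 \<Rightarrow> mat2 \<Rightarrow> mat2" where
  "g * h = Mat2 (m11 g * m11 h + m12 g * m21 h) (m11 g * m12 h + m12 g * m22 h)
                (m21 g * m11 h + m22 g * m21 h) (m21 g * m12 h + m22 g * m22 h)"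

instance
  by standard (auto simp: one_mat2_def times_mat2_def algebra_simps)

end

lemma times_Mat2 [simp]:
  "Mat2 a b c d * Mat2 a' b' c' d' = Mat2 (a*a' + b*c') (a*b' + b*d') (c*a' + d*c') (c*b' + d*d')"
  by (simp add: times_mat2_def)

definition mdet :: "mat2 \<Rightarrow> int" where
  "mdet g = m11 g * m22 g - m12 g * m21 g"

definition adj :: "mat2 \<Rightarrow> mat2" where
  "adj g = Mat2 (m22 g) (- m12 g) (- m21 g) (m11 g)"

definition mnorm :: "mat2 \<Rightarrow> int" where
  "mnorm g = max (max \<bar>m11 g\<bar> \<bar>m12 g\<bar>) (max \<bar>m21 g\<bar> \<bar>m22 g\<bar>)"

definition act :: "mat2 \<Rightarrow> int \<times> int \<Rightarrow> int \<times> int" where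
  "act g v = (m11 g * fst v + m12 g * snd v, m21 g * fst v + m22 g * snd v)"

definition cross :: "int \<times> int \<Rightarrow> int \<times> int \<Rightarrow> int" where
  "cross u v = fst u * snd v - snd u * fst v"

definition vdot :: "int \<times> int \<Rightarrow> int \<times> int \<Rightarrow> int" where
  "vdot u v = fst u * fst v + snd u * snd v"

definition vnorm :: "int \<times> int \<Rightarrow> int" where
  "vnorm v = max \<bar>fst v\<bar> \<bar>snd v\<bar>"

lemma mdet_mult: "mdet (g * h) = mdet g * mdet h"
  by (simp add: mdet_def times_mat2_def algebra_simps)

lemma mdet_one [simp]: "mdet 1 = 1"
  by (simp add: mdet_def one_mat2_def)

lemma mdet_adj [simp]: "mdet (adj g) = mdet g"
  by (simp add: mdet_def adj_def algebra_simps)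

lemma adj_adj [simp]: "adj (adj g) = g"
  by (simp add: adj_def)

lemma adj_mult: "adj (g * h) = adj h * adj g"
  by (simp add: adj_def times_mat2_def algebra_simps)

lemma mult_adj: "mdet g = 1 \<Longrightarrow> g * adj g = 1"
  by (simp add: mdet_def adj_def times_mat2_def one_mat2_def algebra_simps)

lemma adj_mult_self: "mdet g = 1 \<Longrightarrow> adj g * g = 1"
  by (simp add: mdet_def adj_def times_mat2_def one_mat2_def algebra_simps)

lemma mnorm_adj [simp]: "mnorm (adj g) = mnorm g"
  by (simp add: mnorm_def adj_def max.commute max.left_commute max.assoc)

lemma act_mult: "act (g * h) v = act g (act h v)"
  by (simp add: act_def times_mat2_def algebra_simps)

lemma act_one [simp]: "act 1 v = v"
  by (simp add: act_def one_mat2_def)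

lemma abs_add_mult_le:
  fixes a b c d M N :: int
  assumes "\<bar>a\<bar> \<le> M" "\<bar>b\<bar> \<le> N" "\<bar>c\<bar> \<le> M" "\<bar>d\<bar> \<le> N"
  shows "\<bar>a * b + c * d\<bar> \<le> 2 * M * N"
proof -
  have "\<bar>a * b\<bar> \<le> M * N" "\<bar>c * d\<bar> \<le> M * N"
    unfolding abs_mult using assms by (auto intro!: mult_mono)
  then show ?thesis by linarith
qed

lemma abs_entry_le_mnorm:
  "\<bar>m11 g\<bar> \<le> mnorm g" "\<bar>m12 g\<bar> \<le> mnorm g" "\<bar>m21 g\<bar> \<le> mnorm g" "\<bar>m22 g\<bar> \<le> mnorm g"
  by (auto simp: mnorm_def le_max_iff_disj)

lemma mnorm_le_iff:
  "mnorm g \<le> X \<longleftrightarrow> \<bar>m11 g\<bar> \<le> X \<and> \<bar>m12 g\<bar> \<le> X \<and> \<bar>m21 g\<bar> \<le> X \<and> \<bar>m22 g\<bar> \<le> X"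
  by (auto simp: mnorm_def)

lemma mnorm_mult: "mnorm (g * h) \<le> 2 * mnorm g * mnorm h"
  unfolding mnorm_le_iff [of "g * h"]
  by (simp add: times_mat2_def abs_add_mult_le abs_entry_le_mnorm)

lemma mnorm_nonneg: "0 \<le> mnorm g"
  by (simp add: mnorm_def)

lemma mnorm_pos:
  assumes "mdet g = 1" shows "0 < mnorm g"
proof (rule ccontr)
  assume "\<not> 0 < mnorm g"
  then have "mnorm g \<le> 0" by simp
  then have "m11 g = 0" "m12 g = 0" by (auto simp: mnorm_le_iff)
  with assms show False by (simp add: mdet_def)
qed

lemma finite_mat_box: "finite {g. real_of_int (mnorm g) \<le> r}"
proof -
  let ?I = "{-\<lfloor>r\<rfloor>..\<lfloor>r\<rfloor>}"
  have "{g. real_of_int (mnorm g) \<le> r} \<subseteq>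
     (\<lambda>(a,b,c,d). Mat2 a b c d) ` (?I \<times> ?I \<times> ?I \<times> ?I)"
  proof
    fix g assume "g \<in> {g. real_of_int (mnorm g) \<le> r}"
    then have "mnorm g \<le> \<lfloor>r\<rfloor>" by (simp add: le_floor_iff)
    then show "g \<in> (\<lambda>(a,b,c,d). Mat2 a b c d) ` (?I \<times> ?I \<times> ?I \<times> ?I)"
      by (intro image_eqI [of _ _ "(m11 g, m12 g, m21 g, m22 g)"])
         (auto simp: mnorm_le_iff abs_le_iff)
  qed
  then show ?thesis by (rule finite_subset) auto
qed

lemma card_le_mult_fibres:
  assumes "finite S" "\<And>d. d \<in> f ` S \<Longrightarrow> card {x \<in> S. f x = d} \<le> k"
  shows "card S \<le> k * card (f ` S)"
proof -
  have "card S = (\<Sum>d\<in>f ` S. card {x \<in> S. f x = d})"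
    using sum.image_gen [OF assms(1), of "\<lambda>_. 1::nat" f] by simp
  also have "\<dots> \<le> (\<Sum>d\<in>f ` S. k)" using assms(2) by (intro sum_mono)
  finally show ?thesis by (simp add: mult.commute)
qed

section \<open>Archimedean counting of integer matrices and of words\<close>

section \<open>Counting matrices by the norm of a translate\<close>

lemma proportional_if_coprime:
  fixes a b x y :: int
  assumes "coprime a b" "a * y = b * x"
  shows "\<exists>t. x = t * a \<and> y = t * b"
proof -
  obtain s r where sr: "s * a + r * b = 1"
    using assms(1) bezout_int [of a b] by auto
  have "(s * x + r * y) * a = (s * a + r * b) * x" "(s * x + r * y) * b = (s * a + r * b) * y"
  proof -
    have "(s * x + r * y) * a = s * a * x + r * (a * y)" "(s * x + r * y) * b = s * (b * x) + r * b * y"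
      by (simp_all add: algebra_simps)
    then show "(s * x + r * y) * a = (s * a + r * b) * x" "(s * x + r * y) * b = (s * a + r * b) * y"
      unfolding assms(2) unfolding assms(2) [symmetric] by (simp_all add: algebra_simps assms(2))
  qed
  then have "x = (s * x + r * y) * a" "y = (s * x + r * y) * b" using sr by simp_all
  then show ?thesis by blast
qed

text \<open>Vectors with the same cross product with a primitive \<open>u\<close> differ by integer
  multiples \<open>t\<close> of \<open>u\<close>. If their norms are at most that of
  \<open>u\<close>, then \<open>\<bar>t\<bar> \<le> 2\<close>, which leaves five candidates.\<close>

lemma card_cross_fibre:
  assumes cop: "coprime (fst u) (snd u)"
    and S: "\<And>v. v \<in> S \<Longrightarrow> vnorm v \<le> vnorm u" "\<And>v. v \<in> S \<Longrightarrow> cross u v = d"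
  shows "card S \<le> 5"
proof (cases "S = {}")
  case False
  then obtain w where w: "w \<in> S" by auto
  have upos: "vnorm u > 0"
  proof (rule ccontr)
    assume "\<not> vnorm u > 0"
    then have "fst u = 0" "snd u = 0" by (auto simp: vnorm_def)
    with cop show False by simp
  qed
  have "S \<subseteq> (\<lambda>t. (fst w + t * fst u, snd w + t * snd u)) ` {-2..2}"
  proof
    fix v assume v: "v \<in> S"
    have "cross u v = cross u w" using S(2) v w by simp
    then have "fst u * (snd v - snd w) = snd u * (fst v - fst w)"
      by (simp add: cross_def algebra_simps)
    then obtain t where t: "fst v - fst w = t * fst u" "snd v - snd w = t * snd u"
      using proportional_if_coprime [OF cop] by blast
    have "\<bar>t\<bar> * vnorm u = max \<bar>t * fst u\<bar> \<bar>t * snd u\<bar>"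
      by (simp add: vnorm_def abs_mult max_mult_distrib_left)
    also have "\<dots> \<le> vnorm v + vnorm w"
      unfolding t [symmetric] vnorm_def by linarith
    also have "\<dots> \<le> 2 * vnorm u" using S(1) [OF v] S(1) [OF w] by linarith
    finally have "\<bar>t\<bar> \<le> 2" using upos by simp
    then show "v \<in> (\<lambda>t. (fst w + t * fst u, snd w + t * snd u)) ` {-2..2}"
      using t by (intro image_eqI [of _ _ t]) (auto simp: prod_eq_iff)
  qed
  then have "card S \<le> card {-2..2::int}"
    by (meson card_image_le card_mono finite_atLeastAtMost_int finite_imageI le_trans)
  then show ?thesis by simp
qed simp

lemma card_int_abs_le:
  fixes r :: real
  assumes "r \<ge> 0" "\<And>d. d \<in> D \<Longrightarrow> \<bar>real_of_int d\<bar> \<le> r"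
  shows "real (card D) \<le> 2 * r + 1"
proof -
  have "D \<subseteq> {-\<lfloor>r\<rfloor>..\<lfloor>r\<rfloor>}"
  proof
    fix d assume "d \<in> D"
    then have "real_of_int d \<le> r" "real_of_int (-d) \<le> r" using assms(2) by force+
    then have "d \<le> \<lfloor>r\<rfloor>" "-d \<le> \<lfloor>r\<rfloor>" by (simp_all only: le_floor_iff)
    then show "d \<in> {-\<lfloor>r\<rfloor>..\<lfloor>r\<rfloor>}" by auto
  qed
  then have "card D \<le> card {-\<lfloor>r\<rfloor>..\<lfloor>r\<rfloor>}" by (intro card_mono) auto
  moreover have "int (card {-\<lfloor>r\<rfloor>..\<lfloor>r\<rfloor>}) = 2 * \<lfloor>r\<rfloor> + 1" using assms(1) by simp
  ultimately have "int (card D) \<le> 2 * \<lfloor>r\<rfloor> + 1" by linarith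
  then show ?thesis using of_int_floor_le [of r] by linarith
qed

text \<open>By Cramer's rule, \<open>cross u v\<close> times \<open>c\<close> is a combination of
  \<open>u\<close> and \<open>v\<close>, turned by a right angle, whose coefficients are the two
  inner products. So vectors nearly orthogonal to \<open>c\<close> are nearly parallel.\<close>

lemma cross_bound:
  assumes "real_of_int (vnorm u) \<le> \<rho>" "real_of_int (vnorm v) \<le> \<rho>"
    "real_of_int \<bar>vdot u c\<bar> \<le> \<kappa>" "real_of_int \<bar>vdot v c\<bar> \<le> \<kappa>"
  shows "\<bar>real_of_int (cross u v)\<bar> * real_of_int (vnorm c) \<le> 2 * (\<kappa> * \<rho>)"
proof -
  have le: "\<bar>real_of_int (s * x - t * y)\<bar> \<le> 2 * (\<kappa> * \<rho>)"
    if "real_of_int \<bar>s\<bar> \<le> \<kappa>" "real_of_int \<bar>t\<bar> \<le> \<kappa>" "real_of_int \<bar>x\<bar> \<le> \<rho>" "real_of_int \<bar>y\<bar> \<le> \<rho>" for s t x y :: int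
  proof -
    have "\<bar>real_of_int s * real_of_int x\<bar> \<le> \<kappa> * \<rho>" "\<bar>real_of_int t * real_of_int y\<bar> \<le> \<kappa> * \<rho>"
      unfolding abs_mult using that by (auto intro!: mult_mono)
    then show ?thesis unfolding of_int_diff of_int_mult by linarith
  qed
  have uv: "real_of_int \<bar>fst u\<bar> \<le> \<rho>" "real_of_int \<bar>snd u\<bar> \<le> \<rho>"
    "real_of_int \<bar>fst v\<bar> \<le> \<rho>" "real_of_int \<bar>snd v\<bar> \<le> \<rho>"
    using assms(1,2) by (auto simp: vnorm_def)
  have "cross u v * fst c = vdot u c * snd v - vdot v c * snd u"
    "cross u v * snd c = vdot v c * fst u - vdot u c * fst v"
    by (simp_all add: cross_def vdot_def algebra_simps)
  then have "\<bar>real_of_int (cross u v * fst c)\<bar> \<le> 2 * (\<kappa> * \<rho>)"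
    "\<bar>real_of_int (cross u v * snd c)\<bar> \<le> 2 * (\<kappa> * \<rho>)"
    using le uv assms(3,4) by simp_all
  then show ?thesis
    by (auto simp: vnorm_def abs_mult max_def)
qed

text \<open>The main term is the order of the area of the strip. Primitivity is essential for thin
  strips, which could otherwise contain about \<open>\<rho>\<close> multiples of a single short
  vector.\<close>

lemma card_primitive_strip:
  assumes fin: "finite S" and c: "vnorm c > 0" and \<rho>: "\<rho> \<ge> 0" and \<kappa>: "\<kappa> \<ge> 0"
    and S: "\<And>v. v \<in> S \<Longrightarrow> coprime (fst v) (snd v)"
      "\<And>v. v \<in> S \<Longrightarrow> real_of_int (vnorm v) \<le> \<rho>"
      "\<And>v. v \<in> S \<Longrightarrow> real_of_int \<bar>vdot v c\<bar> \<le> \<kappa>"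
  shows "real (card S) \<le> 5 * (4 * \<kappa> * \<rho> / vnorm c + 1)"
proof (cases "S = {}")
  case True
  then show ?thesis using assms by simp
next
  case False
  \<comment> \<open>Relative to a vector of maximal norm, the other vectors are determined up to
    five choices by their cross product with it.\<close>
  have "\<exists>u\<in>S. \<forall>v\<in>S. vnorm v \<le> vnorm u"
  proof -
    have "Max (vnorm ` S) \<in> vnorm ` S" using fin False by simp
    then obtain u where "u \<in> S" "vnorm u = Max (vnorm ` S)" by force
    then show ?thesis using fin by (metis Max_ge finite_imageI imageI)
  qed
  then obtain u where u: "u \<in> S" "\<And>v. v \<in> S \<Longrightarrow> vnorm v \<le> vnorm u" by blast
  have "card {v \<in> S. cross u v = d} \<le> 5" for d
    by (rule card_cross_fibre [of u _ d]) (use u S(1) in auto)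
  then have 1: "card S \<le> 5 * card (cross u ` S)" by (intro card_le_mult_fibres fin)
  have "real (card (cross u ` S)) \<le> 2 * (2 * \<kappa> * \<rho> / vnorm c) + 1"
  proof (rule card_int_abs_le)
    fix d assume "d \<in> cross u ` S"
    then obtain v where v: "v \<in> S" "d = cross u v" by auto
    have "\<bar>real_of_int (cross u v)\<bar> * real_of_int (vnorm c) \<le> 2 * (\<kappa> * \<rho>)"
      using S u v by (intro cross_bound) auto
    then show "\<bar>real_of_int d\<bar> \<le> 2 * \<kappa> * \<rho> / vnorm c"
      using c v by (simp add: field_simps)
  qed (use c \<rho> \<kappa> in auto)
  with 1 show ?thesis by simp
qed

lemma coprime_rows:
  assumes "mdet g = 1"
  shows "coprime (m11 g) (m12 g)" "coprime (m21 g) (m22 g)"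
proof -
  have *: "coprime a b" if "a * d - b * c = (1::int)" for a b c d
  proof (rule coprimeI)
    fix e assume "e dvd a" "e dvd b"
    then have "e dvd a * d - b * c" by simp
    then show "e dvd 1" using that by simp
  qed
  show "coprime (m11 g) (m12 g)"
    using assms by (intro * [of _ "m22 g" _ "m21 g"]) (simp add: mdet_def)
  show "coprime (m21 g) (m22 g)"
    using assms by (intro * [of _ "- m12 g" _ "- m11 g"]) (simp add: mdet_def algebra_simps)
qed

text \<open>Let \<open>c\<close> be the longer column of \<open>\<gamma>\<close>. The inner products
  of the rows of \<open>g\<close> with \<open>c\<close> are entries of \<open>g * \<gamma>\<close>,
  so both rows lie in a strip. The longer row is counted there; the shorter one has cross product 1
  or -1 with it, hence at most five values. The constant is 50 = 2 * 5 * 5, with 2 for the choice of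
  the longer row.\<close>

lemma card_mnorm_mult_le:
  assumes fin: "finite G" and \<gamma>: "mdet \<gamma> = 1" and \<kappa>: "\<kappa> \<ge> 0" and \<rho>: "\<rho> \<ge> 0"
    and G: "\<And>g. g \<in> G \<Longrightarrow> mdet g = 1" "\<And>g. g \<in> G \<Longrightarrow> real_of_int (mnorm g) \<le> \<rho>"
      "\<And>g. g \<in> G \<Longrightarrow> real_of_int (mnorm (g * \<gamma>)) \<le> \<kappa>"
  shows "real (card G) \<le> 50 * (4 * \<kappa> * \<rho> / mnorm \<gamma> + 1)"
proof -
  obtain c where c: "c \<in> {(m11 \<gamma>, m21 \<gamma>), (m12 \<gamma>, m22 \<gamma>)}" "vnorm c = mnorm \<gamma>"
  proof (cases "vnorm (m12 \<gamma>, m22 \<gamma>) \<le> vnorm (m11 \<gamma>, m21 \<gamma>)")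
    case True
    then have "vnorm (m11 \<gamma>, m21 \<gamma>) = mnorm \<gamma>"
      by (intro antisym) (auto simp: vnorm_def mnorm_def le_max_iff_disj)
    then show ?thesis using that by blast
  next
    case False
    then have "vnorm (m12 \<gamma>, m22 \<gamma>) = mnorm \<gamma>"
      by (intro antisym) (auto simp: vnorm_def mnorm_def le_max_iff_disj)
    then show ?thesis using that by blast
  qed
  define row1 row2 where "row1 = (\<lambda>g. (m11 g, m12 g))" and "row2 = (\<lambda>g. (m21 g, m22 g))"
  have dot: "\<bar>vdot (row1 g) c\<bar> \<le> mnorm (g * \<gamma>)" "\<bar>vdot (row2 g) c\<bar> \<le> mnorm (g * \<gamma>)" for g
    using c(1) abs_entry_le_mnorm [of "g * \<gamma>"]
    by (auto simp: vdot_def row1_def row2_def times_mat2_def)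
  have vn: "vnorm (row1 g) \<le> mnorm g" "vnorm (row2 g) \<le> mnorm g" for g
    by (auto simp: vnorm_def mnorm_def row1_def row2_def)
  have eqI: "g = h" if "row1 g = row1 h" "row2 g = row2 h" for g h
    using that by (simp add: row1_def row2_def mat2.expand)
  have half: "real (card H) \<le> 25 * (4 * \<kappa> * \<rho> / mnorm \<gamma> + 1)"
    if HG: "H \<subseteq> G" and rs: "r = row1 \<and> s = row2 \<or> r = row2 \<and> s = row1"
      and le: "\<And>g. g \<in> H \<Longrightarrow> vnorm (s g) \<le> vnorm (r g)" for H r s
  proof -
    have finH: "finite H" using HG fin finite_subset by auto
    have cop: "coprime (fst (r g)) (snd (r g))" if "g \<in> H" for g
      using rs coprime_rows [of g] G(1) HG that by (auto simp: row1_def row2_def)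
    have "card {g \<in> H. r g = u} \<le> 5" if u: "u \<in> r ` H" for u
    proof -
      have "inj_on s {g \<in> H. r g = u}"
        using rs eqI by (auto simp: inj_on_def)
      moreover have "card (s ` {g \<in> H. r g = u}) \<le> 5"
      proof (rule card_cross_fibre)
        show "coprime (fst u) (snd u)" using u cop by auto
        show "vnorm v \<le> vnorm u" if "v \<in> s ` {g \<in> H. r g = u}" for v
          using that le by auto
        show "cross u v = (if r = row1 then 1 else -1)" if "v \<in> s ` {g \<in> H. r g = u}" for v
        proof -
          obtain g where g: "g \<in> H" "r g = u" "v = s g" using \<open>v \<in> _\<close> by auto
          have "mdet g = 1" using g G HG by auto
          then have "cross (row1 g) (row2 g) = 1" "cross (row2 g) (row1 g) = -1"
            by (simp_all add: cross_def row1_def row2_def mdet_def mult.commute)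
          moreover have "row1 \<noteq> row2"
            by (auto simp: row1_def row2_def fun_eq_iff intro!: exI [of _ "Mat2 0 0 1 0"])
          ultimately show ?thesis using rs g by auto
        qed
      qed
      ultimately show ?thesis by (simp add: card_image)
    qed
    then have "card H \<le> 5 * card (r ` H)" by (intro card_le_mult_fibres finH)
    moreover have "real (card (r ` H)) \<le> 5 * (4 * \<kappa> * \<rho> / vnorm c + 1)"
    proof (rule card_primitive_strip)
      show "0 < vnorm c" using c \<gamma> mnorm_pos by simp
      fix v assume "v \<in> r ` H"
      then obtain g where g: "g \<in> G" "g \<in> H" "v = r g" using HG by auto
      show "coprime (fst v) (snd v)" using cop g by auto
      have "vnorm v \<le> mnorm g" using rs g vn by auto
      then show "real_of_int (vnorm v) \<le> \<rho>" using G(2) [OF g(1)] by linarith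
      have "\<bar>vdot v c\<bar> \<le> mnorm (g * \<gamma>)" using rs g dot by auto
      then show "real_of_int \<bar>vdot v c\<bar> \<le> \<kappa>" using G(3) [OF g(1)] by linarith
    qed (use finH \<rho> \<kappa> in auto)
    ultimately show ?thesis using c(2) by simp
  qed
  let ?G1 = "{g \<in> G. vnorm (row2 g) \<le> vnorm (row1 g)}"
  let ?G2 = "{g \<in> G. vnorm (row1 g) \<le> vnorm (row2 g)}"
  have "G \<subseteq> ?G1 \<union> ?G2" by auto
  then have "card G \<le> card (?G1 \<union> ?G2)" using fin by (intro card_mono) auto
  also have "\<dots> \<le> card ?G1 + card ?G2" by (rule card_Un_le)
  finally have "real (card G) \<le> real (card ?G1) + real (card ?G2)" by linarith
  moreover have "real (card ?G1) \<le> 25 * (4 * \<kappa> * \<rho> / mnorm \<gamma> + 1)"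
    by (rule half [of _ row1 row2]) auto
  moreover have "real (card ?G2) \<le> 25 * (4 * \<kappa> * \<rho> / mnorm \<gamma> + 1)"
    by (rule half [of _ row2 row1]) auto
  ultimately show ?thesis by linarith
qed

section \<open>Sums of reciprocal norms\<close>

text \<open>Each of the \<open>L + 1\<close> dyadic shells contributes at most \<open>2 * c\<close>,
  where 2 is the ratio of its radii. The closed shells overlap, which does no harm to an upper
  bound.\<close>

lemma sum_inverse_dyadic:
  fixes f :: "'a \<Rightarrow> real"
  assumes fin: "finite A" and m: "0 < m" and c: "0 \<le> c"
    and f: "\<And>x. x \<in> A \<Longrightarrow> m \<le> f x" "\<And>x. x \<in> A \<Longrightarrow> f x \<le> m * 2 ^ L"
    and cnt: "\<And>\<kappa>. m \<le> \<kappa> \<Longrightarrow> \<kappa> \<le> m * 2 ^ Suc L \<Longrightarrow> real (card {x \<in> A. f x \<le> \<kappa>}) \<le> c * \<kappa>"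
  shows "(\<Sum>x\<in>A. 1 / f x) \<le> 2 * c * (real L + 1)"
proof -
  let ?S = "\<lambda>i. {x \<in> A. m * 2 ^ i \<le> f x \<and> f x \<le> m * 2 ^ Suc i}"
  have cover: "A \<subseteq> (\<Union>i\<in>{..L}. ?S i)"
  proof
    fix x assume x: "x \<in> A"
    define i where "i = (GREATEST i. m * 2 ^ i \<le> f x \<and> i \<le> L)"
    have ex: "m * 2 ^ 0 \<le> f x \<and> 0 \<le> L" using f x by simp
    have i: "m * 2 ^ i \<le> f x \<and> i \<le> L"
      unfolding i_def by (rule GreatestI_nat [where P="\<lambda>i. m * 2 ^ i \<le> f x \<and> i \<le> L", OF ex, of L]) auto
    have "f x \<le> m * 2 ^ Suc i"
    proof (cases "i = L")
      case True
      have "m * 2 ^ L \<le> m * 2 ^ Suc L" using m by simp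
      then show ?thesis unfolding True using f(2) [OF x] by (rule order_trans [rotated])
    next
      case False
      show ?thesis
      proof (rule ccontr)
        assume "\<not> f x \<le> m * 2 ^ Suc i"
        then have "m * 2 ^ Suc i \<le> f x \<and> Suc i \<le> L" using i False by auto
        then have "Suc i \<le> i"
          unfolding i_def by (rule Greatest_le_nat [of _ _ L]) auto
        then show False by simp
      qed
    qed
    then show "x \<in> (\<Union>i\<in>{..L}. ?S i)" using i x by auto
  qed
  have pos: "f x > 0" if "x \<in> A" for x using f(1) [OF that] m by linarith
  have "(\<Sum>x\<in>A. 1 / f x) \<le> (\<Sum>x\<in>(\<Union>i\<in>{..L}. ?S i). 1 / f x)"
    using fin pos by (intro sum_mono2 cover) (auto simp: less_imp_le)
  also have "\<dots> \<le> (\<Sum>i\<in>{..L}. \<Sum>x\<in>?S i. 1 / f x)"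
  proof -
    have "(\<Sum>x\<in>(\<Union>i\<in>J. ?S i). 1 / f x) \<le> (\<Sum>i\<in>J. \<Sum>x\<in>?S i. 1 / f x)" if "finite J" for J
      using that
    proof (induction J)
      case (insert j J)
      have "(\<Sum>x\<in>(\<Union>i\<in>insert j J. ?S i). 1 / f x) \<le> (\<Sum>x\<in>?S j. 1 / f x) + (\<Sum>x\<in>(\<Union>i\<in>J. ?S i). 1 / f x)"
        using fin pos insert.hyps
        by (subst UN_insert, subst sum_Un) (auto simp: less_imp_le intro!: sum_nonneg)
      then show ?case using insert by simp
    qed simp
    then show ?thesis by simp
  qed
  also have "\<dots> \<le> (\<Sum>i\<in>{..L}. 2 * c)"
  proof (intro sum_mono)
    fix i assume i: "i \<in> {..L}"
    have p: "0 < m * 2 ^ i" using m by simp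
    have "(\<Sum>x\<in>?S i. 1 / f x) \<le> (\<Sum>x\<in>?S i. 1 / (m * 2 ^ i))"
      using p by (intro sum_mono divide_left_mono) (auto intro!: mult_pos_pos pos)
    also have "\<dots> = real (card (?S i)) / (m * 2 ^ i)" by simp
    also have "\<dots> \<le> (c * (m * 2 ^ Suc i)) / (m * 2 ^ i)"
    proof (rule divide_right_mono)
      have "card (?S i) \<le> card {x \<in> A. f x \<le> m * 2 ^ Suc i}"
        using fin by (intro card_mono) auto
      moreover have "real (card {x \<in> A. f x \<le> m * 2 ^ Suc i}) \<le> c * (m * 2 ^ Suc i)"
      proof (rule cnt)
        show "m \<le> m * 2 ^ Suc i" using m one_le_power [of "2::real" "Suc i"] mult_left_mono [of 1 "2 ^ Suc i" m] by (simp del: power_Suc)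
        show "m * 2 ^ Suc i \<le> m * 2 ^ Suc L" using m i by (intro mult_left_mono power_increasing) auto
      qed
      ultimately show "real (card (?S i)) \<le> c * (m * 2 ^ Suc i)" by linarith
    qed (use p in simp)
    also have "\<dots> = 2 * c" using m by simp
    finally show "(\<Sum>x\<in>?S i. 1 / f x) \<le> 2 * c" .
  qed
  also have "\<dots> = 2 * c * (real L + 1)" by (simp add: algebra_simps)
  finally show ?thesis .
qed

text \<open>The function 1 / \<open>mnorm\<close> serves as an approximate spherical function:
  summing over a ball of about \<open>\<rho>\<^sup>2\<close> elements multiplies it by only
  \<open>\<rho>\<close> and a logarithm. This square root saving is the archimedean input of the
  whole argument.\<close>

lemma sum_inverse_mnorm_mult:
  assumes fin: "finite G" and \<gamma>: "mdet \<gamma> = 1" and \<rho>: "\<rho> \<ge> 1" and L: "4 * \<rho>\<^sup>2 \<le> 2 ^ L"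
    and G: "\<And>g. g \<in> G \<Longrightarrow> mdet g = 1" "\<And>g. g \<in> G \<Longrightarrow> real_of_int (mnorm g) \<le> \<rho>"
  shows "(\<Sum>g\<in>G. 1 / real_of_int (mnorm (g * \<gamma>))) \<le> 600 * \<rho> * (real L + 1) / mnorm \<gamma>"
proof -
  define N where "N = real_of_int (mnorm \<gamma>)"
  have N: "N > 0" using mnorm_pos [OF \<gamma>] by (simp add: N_def)
  have "(\<Sum>g\<in>G. 1 / real_of_int (mnorm (g * \<gamma>))) \<le> 2 * (300 * \<rho> / N) * (real L + 1)"
  \<comment> \<open>Both \<open>g\<close> and its inverse have norm at most \<open>\<rho>\<close>,
    so \<open>mnorm (g * \<gamma>)\<close> lies between \<open>N / (2 * \<rho>)\<close> and
    \<open>2 * \<rho> * N\<close>, a range of ratio \<open>4 * \<rho>\<^sup>2\<close>.\<close>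
  proof (rule sum_inverse_dyadic [where m = "N / (2 * \<rho>)"])
    fix g assume g: "g \<in> G"
    have "N = real_of_int (mnorm (adj g * (g * \<gamma>)))"
      using G(1) [OF g] by (simp add: N_def mult.assoc [symmetric] adj_mult_self)
    also have "\<dots> \<le> real_of_int (2 * mnorm g * mnorm (g * \<gamma>))"
      using mnorm_mult [of "adj g" "g * \<gamma>"] by (simp del: of_int_mult)
    also have "\<dots> \<le> 2 * \<rho> * mnorm (g * \<gamma>)"
      using G(2) [OF g] mnorm_nonneg by (simp add: mult_right_mono)
    finally show "N / (2 * \<rho>) \<le> real_of_int (mnorm (g * \<gamma>))"
      using \<rho> by (simp add: field_simps)
    have "real_of_int (mnorm (g * \<gamma>)) \<le> real_of_int (2 * mnorm g * mnorm \<gamma>)"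
      using mnorm_mult [of g \<gamma>] by (simp del: of_int_mult)
    also have "\<dots> \<le> 2 * \<rho> * N"
      using G(2) [OF g] mnorm_nonneg by (simp add: N_def mult_right_mono)
    also have "\<dots> = N / (2 * \<rho>) * (4 * \<rho>\<^sup>2)" using \<rho> by (simp add: power2_eq_square field_simps)
    also have "\<dots> \<le> N / (2 * \<rho>) * 2 ^ L" using N \<rho> L by (intro mult_left_mono) auto
    finally show "real_of_int (mnorm (g * \<gamma>)) \<le> N / (2 * \<rho>) * 2 ^ L" .
  next
    fix \<kappa> assume \<kappa>: "N / (2 * \<rho>) \<le> \<kappa>"
    have \<kappa>0: "\<kappa> \<ge> 0" using \<kappa> N \<rho> by (smt (verit) divide_pos_pos)
    have "real (card {g \<in> G. real_of_int (mnorm (g * \<gamma>)) \<le> \<kappa>}) \<le> 50 * (4 * \<kappa> * \<rho> / mnorm \<gamma> + 1)"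
      using fin \<gamma> \<kappa>0 \<rho> G by (intro card_mnorm_mult_le) auto
    \<comment> \<open>The summand 1 is at most \<open>2 * \<kappa> * \<rho> / N\<close> by the lower
      limit for \<open>\<kappa>\<close>, and 50 * (4 + 2) = 300.\<close>
    also have "\<dots> \<le> 300 * \<rho> / N * \<kappa>"
      using \<kappa> N \<rho> by (simp add: N_def [symmetric] field_simps)
    finally show "real (card {g \<in> G. real_of_int (mnorm (g * \<gamma>)) \<le> \<kappa>}) \<le> 300 * \<rho> / N * \<kappa>" .
  qed (use fin N \<rho> in auto)
  then show ?thesis by (simp add: N_def)
qed

section \<open>Words in a ball of matrices\<close>

definition mcong :: "int \<Rightarrow> mat2 \<Rightarrow> mat2 \<Rightarrow> bool" where
  "mcong p g h \<longleftrightarrow> [m11 g = m11 h] (mod p) \<and> [m12 g = m12 h] (mod p)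
     \<and> [m21 g = m21 h] (mod p) \<and> [m22 g = m22 h] (mod p)"

lemma mcong_mult:
  "mcong p g g' \<Longrightarrow> mcong p h h' \<Longrightarrow> mcong p (g * h) (g' * h')"
  unfolding mcong_def times_mat2_def by (auto intro!: cong_add cong_mult)

lemma mcong_refl [simp]: "mcong p g g"
  by (simp add: mcong_def)

definition principal_ball :: "int \<Rightarrow> real \<Rightarrow> mat2 set" where
  "principal_ball p X = {g. mdet g = 1 \<and> mcong p g 1 \<and> real_of_int (mnorm g) \<le> X}"

lemma finite_principal_ball: "finite (principal_ball p X)"
  by (rule finite_subset [OF _ finite_mat_box [of X]]) (auto simp: principal_ball_def)

definition lists_of :: "nat \<Rightarrow> 'a set \<Rightarrow> 'a list set" where
  "lists_of n A = {xs. set xs \<subseteq> A \<and> length xs = n}"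

lemma finite_lists_of: "finite A \<Longrightarrow> finite (lists_of n A)"
  unfolding lists_of_def by (rule finite_lists_length_eq)

lemma card_lists_of: "finite A \<Longrightarrow> card (lists_of n A) = card A ^ n"
  unfolding lists_of_def by (rule card_lists_length_eq)

lemma lists_of_0 [simp]: "lists_of 0 A = {[]}"
  by (auto simp: lists_of_def)

lemma lists_of_Suc: "lists_of (Suc n) A = (\<lambda>(x, xs). x # xs) ` (A \<times> lists_of n A)"
  by (auto simp: lists_of_def length_Suc_conv image_iff)

text \<open>A pair \<open>(g, h)\<close> stands for \<open>adj g * h\<close>, a summand of the
  operator \<open>S\<close> below. Keeping the two factors as separate letters makes every letter an
  element of the ball.\<close>

fun letters :: "(mat2 \<times> mat2) list \<Rightarrow> mat2 list" where
  "letters [] = []"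
| "letters ((g, h) # ws) = adj g # h # letters ws"

definition pword :: "(mat2 \<times> mat2) list \<Rightarrow> mat2" where
  "pword ws = prod_list (letters ws)"

lemma length_letters [simp]: "length (letters ws) = 2 * length ws"
  by (induction ws rule: letters.induct) auto

lemma adj_inject [simp]: "adj g = adj h \<longleftrightarrow> g = h"
  by (metis adj_adj)

lemma letters_inject: "letters ws = letters ws' \<Longrightarrow> ws = ws'"
proof (induction ws arbitrary: ws' rule: letters.induct)
  case 1
  then show ?case by (cases ws' rule: letters.cases) auto
next
  case (2 g h ws)
  then show ?case by (cases ws' rule: letters.cases) auto
qed

lemma adj_one [simp]: "adj 1 = 1"
  by (simp add: adj_def one_mat2_def)

lemma adj_prod_list: "adj (prod_list gs) = prod_list (map adj (rev gs))"
  by (induction gs) (auto simp: adj_mult)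

lemma mdet_prod_list: "(\<And>g. g \<in> set gs \<Longrightarrow> mdet g = 1) \<Longrightarrow> mdet (prod_list gs) = 1"
  by (induction gs) (auto simp: mdet_mult)

lemma mnorm_prod_list_le:
  fixes r :: real
  assumes "0 \<le> r" "\<And>g. g \<in> set gs \<Longrightarrow> real_of_int (mnorm g) \<le> r"
  shows "real_of_int (mnorm (prod_list gs)) \<le> (2 * r) ^ length gs"
  using assms(2)
proof (induction gs)
  case Nil
  then show ?case by (simp add: mnorm_def one_mat2_def)
next
  case (Cons g hs)
  have "real_of_int (mnorm (prod_list (g # hs))) \<le> real_of_int (2 * mnorm g * mnorm (prod_list hs))"
    using mnorm_mult [of g "prod_list hs"] by (simp del: of_int_mult)
  also have "\<dots> = 2 * real_of_int (mnorm g) * real_of_int (mnorm (prod_list hs))" by simp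
  also have "\<dots> \<le> 2 * r * (2 * r) ^ length hs"
    using Cons mnorm_nonneg assms(1) by (intro mult_mono) auto
  finally show ?case by simp
qed

text \<open>\<open>L\<close> counts dyadic scales. It is a parameter of its own so that a single
  value can later serve both this ball and the much larger ball of the congruence subgroup.\<close>

locale mat_ball =
  fixes \<rho> :: real and L :: nat
  assumes rho: "1 \<le> \<rho>" and L: "4 * \<rho>\<^sup>2 \<le> 2 ^ L"
begin

definition B :: "mat2 set" where
  "B = {g. mdet g = 1 \<and> real_of_int (mnorm g) \<le> \<rho>}"

definition K :: real where
  "K = 600 * \<rho> * (real L + 1)"

lemma K_nonneg: "0 \<le> K"
  using rho by (simp add: K_def)

lemma finite_B: "finite B"
  by (rule finite_subset [OF _ finite_mat_box [of \<rho>]]) (auto simp: B_def)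

lemma adj_in_B: "g \<in> B \<Longrightarrow> adj g \<in> B"
  by (simp add: B_def)

lemma adj_image_B: "adj ` B = B"
  using adj_in_B by (auto simp: image_iff intro!: bexI [of _ "adj _"])

lemma mnorm_word:
  assumes "gs \<in> lists_of m B"
  shows "real_of_int (mnorm (prod_list gs)) \<le> (2 * \<rho>) ^ m"
  using assms rho mnorm_prod_list_le [of \<rho> gs] by (auto simp: lists_of_def B_def)

text \<open>Splitting off the first letter \<open>g\<close> leaves the product
  \<open>adj g * \<gamma>\<close>, and the sum over \<open>g\<close> of the reciprocal norms costs
  one factor \<open>K\<close>. So the bound 1 / \<open>mnorm\<close> reproduces itself with each
  letter.\<close>

lemma card_words_with_product:
  assumes "mdet \<gamma> = 1"
  shows "real (card {gs \<in> lists_of m B. prod_list gs = \<gamma>}) \<le> K ^ m / mnorm \<gamma>"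
  using assms
proof (induction m arbitrary: \<gamma>)
  case 0
  have "real (card {gs \<in> {[]}. prod_list gs = \<gamma>}) \<le> 1 / mnorm \<gamma>"
  proof (cases "\<gamma> = 1")
    case True
    then have "{gs \<in> {[]}. prod_list gs = \<gamma>} = {[]}" by auto
    then show ?thesis using True by (simp add: mnorm_def one_mat2_def)
  next
    case False
    then have "{gs \<in> {[]}. prod_list gs = \<gamma>} = {}" by auto
    then have "card {gs \<in> {[]}. prod_list gs = \<gamma>} = 0" by (simp only: card.empty)
    then show ?thesis using mnorm_nonneg [of \<gamma>] by (simp only: of_nat_0) simp
  qed
  then show ?case by simp
next
  case (Suc m)
  have "{gs \<in> lists_of (Suc m) B. prod_list gs = \<gamma>}
      \<subseteq> (\<Union>g\<in>B. (#) g ` {gs \<in> lists_of m B. prod_list gs = adj g * \<gamma>})" (is "?L \<subseteq> ?R")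
  proof
    fix gs assume "gs \<in> ?L"
    then obtain g hs where g: "gs = g # hs" "g \<in> B" "hs \<in> lists_of m B" "g * prod_list hs = \<gamma>"
      by (auto simp: lists_of_Suc)
    then have "prod_list hs = adj g * \<gamma>"
      using adj_mult_self [of g] by (auto simp: B_def mult.assoc [symmetric])
    then show "gs \<in> ?R" using g by auto
  qed
  then have "card ?L \<le> card ?R"
    by (intro card_mono finite_UN_I finite_B finite_imageI) (auto simp: finite_lists_of finite_B)
  also have "\<dots> \<le> (\<Sum>g\<in>B. card ((#) g ` {gs \<in> lists_of m B. prod_list gs = adj g * \<gamma>}))"
    by (rule card_UN_le [OF finite_B])
  also have "\<dots> = (\<Sum>g\<in>B. card {gs \<in> lists_of m B. prod_list gs = adj g * \<gamma>})"
    by (intro sum.cong refl card_image) auto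
  finally have "real (card ?L) \<le> (\<Sum>g\<in>B. real (card {gs \<in> lists_of m B. prod_list gs = adj g * \<gamma>}))"
    by (simp flip: of_nat_sum)
  also have "\<dots> \<le> (\<Sum>g\<in>B. K ^ m / mnorm (adj g * \<gamma>))"
    using Suc.prems by (intro sum_mono Suc.IH) (auto simp: mdet_mult B_def)
  also have "\<dots> = (\<Sum>g\<in>adj ` B. K ^ m / mnorm (g * \<gamma>))"
    by (subst sum.reindex) (auto simp: inj_on_def)
  also have "\<dots> = K ^ m * (\<Sum>g\<in>B. 1 / mnorm (g * \<gamma>))"
    by (simp add: adj_image_B sum_distrib_left)
  also have "\<dots> \<le> K ^ m * (600 * \<rho> * (real L + 1) / mnorm \<gamma>)"
    using Suc.prems rho L finite_B K_nonneg
    by (intro mult_left_mono sum_inverse_mnorm_mult) (auto simp: B_def)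
  also have "\<dots> = K ^ Suc m / mnorm \<gamma>" by (simp add: K_def)
  finally show ?case .
qed

lemma card_words_cong_one:
  "real (card {gs \<in> lists_of m B. mcong p (prod_list gs) 1})
     \<le> K ^ m * (\<Sum>\<gamma>\<in>principal_ball p ((2 * \<rho>) ^ m). 1 / mnorm \<gamma>)"
proof -
  let ?P = "principal_ball p ((2 * \<rho>) ^ m)"
  have "{gs \<in> lists_of m B. mcong p (prod_list gs) 1}
      \<subseteq> (\<Union>\<gamma>\<in>?P. {gs \<in> lists_of m B. prod_list gs = \<gamma>})" (is "?L \<subseteq> ?R")
  proof
    fix gs assume gs: "gs \<in> ?L"
    then have "mdet (prod_list gs) = 1"
      by (intro mdet_prod_list) (auto simp: lists_of_def B_def)
    then show "gs \<in> ?R" using gs mnorm_word [of gs m] by (auto simp: principal_ball_def)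
  qed
  then have "card ?L \<le> card ?R"
    by (intro card_mono finite_UN_I finite_principal_ball) (auto simp: finite_lists_of finite_B)
  also have "\<dots> \<le> (\<Sum>\<gamma>\<in>?P. card {gs \<in> lists_of m B. prod_list gs = \<gamma>})"
    by (rule card_UN_le [OF finite_principal_ball])
  finally have "real (card ?L) \<le> (\<Sum>\<gamma>\<in>?P. real (card {gs \<in> lists_of m B. prod_list gs = \<gamma>}))"
    by (simp flip: of_nat_sum)
  also have "\<dots> \<le> (\<Sum>\<gamma>\<in>?P. K ^ m / mnorm \<gamma>)"
    by (intro sum_mono card_words_with_product) (auto simp: principal_ball_def)
  finally show ?thesis by (simp add: sum_distrib_left)
qed

text \<open>A coincidence becomes a word of length \<open>4 * n\<close> congruent to 1 by appending
  the inverse of the second product letter by letter. Here \<open>A\<close> is enlarged to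
  \<open>B\<close>, so that only the size of \<open>A\<close> matters later.\<close>

lemma card_pword_collisions:
  assumes A: "A \<subseteq> B"
  shows "real (card {(ws, ws') \<in> lists_of n (A \<times> A) \<times> lists_of n (A \<times> A). mcong p (pword ws) (pword ws')})
     \<le> K ^ (4 * n) * (\<Sum>\<gamma>\<in>principal_ball p ((2 * \<rho>) ^ (4 * n)). 1 / mnorm \<gamma>)"
    (is "real (card ?C) \<le> _")
proof -
  define \<phi> where "\<phi> = (\<lambda>(ws, ws'). letters ws @ map adj (rev (letters ws')))"
  have set_letters: "set (letters ws) \<subseteq> B" if "set ws \<subseteq> A \<times> A" for ws
    using that by (induction ws rule: letters.induct) (use A adj_in_B in auto)
  have "inj_on \<phi> ?C"
  proof (rule inj_onI)
    fix x y assume xy: "x \<in> ?C" "y \<in> ?C" "\<phi> x = \<phi> y"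
    obtain ws ws' vs vs' where *: "x = (ws, ws')" "y = (vs, vs')" by (metis surj_pair)
    have "length (letters ws) = length (letters vs)" using xy * by (auto simp: lists_of_def)
    then have "letters ws = letters vs" "map adj (rev (letters ws')) = map adj (rev (letters vs'))"
      using xy(3) by (auto simp: \<phi>_def *)
    moreover then have "letters ws' = letters vs'"
      by (subst (asm) inj_map_eq_map) (auto simp: inj_on_def)
    ultimately show "x = y" using * letters_inject by blast
  qed
  moreover have "\<phi> ` ?C \<subseteq> {gs \<in> lists_of (4 * n) B. mcong p (prod_list gs) 1}"
  proof
    fix gs assume "gs \<in> \<phi> ` ?C"
    then obtain ws ws' where w: "gs = \<phi> (ws, ws')" "set ws \<subseteq> A \<times> A" "set ws' \<subseteq> A \<times> A"
      "length ws = n" "length ws' = n" "mcong p (pword ws) (pword ws')"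
      by (auto simp: lists_of_def)
    have "mdet (pword ws') = 1"
      unfolding pword_def using set_letters [OF w(3)] by (intro mdet_prod_list) (auto simp: B_def)
    then have "mcong p (pword ws * adj (pword ws')) 1"
      using mcong_mult [OF w(6) mcong_refl [of p "adj (pword ws')"]] by (simp add: mult_adj)
    then have "mcong p (prod_list gs) 1"
      by (simp add: w(1) \<phi>_def adj_prod_list pword_def)
    moreover have "gs \<in> lists_of (4 * n) B"
      using w set_letters [OF w(2)] set_letters [OF w(3)] adj_in_B
      by (auto simp: lists_of_def \<phi>_def)
    ultimately show "gs \<in> {gs \<in> lists_of (4 * n) B. mcong p (prod_list gs) 1}" by simp
  qed
  moreover have "finite {gs \<in> lists_of (4 * n) B. mcong p (prod_list gs) 1}"
    by (simp add: finite_lists_of finite_B)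
  ultimately have "card ?C \<le> card {gs \<in> lists_of (4 * n) B. mcong p (prod_list gs) 1}"
    by (rule card_inj_on_le)
  then show ?thesis using card_words_cong_one [of "4 * n" p] by linarith
qed

end

section \<open>Arithmetic counting in the principal congruence subgroup\<close>

section \<open>A divisor bound\<close>

lemma finite_divisors: "n > 0 \<Longrightarrow> finite {d::nat. d dvd n}"
  by simp

lemma card_divisors_prime_power_mult:
  fixes q m :: nat
  assumes "prime q" "m > 0"
  shows "card {d. d dvd q ^ e * m} \<le> (e + 1) * card {d. d dvd m}"
proof -
  have "{d. d dvd q ^ e * m} \<subseteq> (\<lambda>(i, d). q ^ i * d) ` ({..e} \<times> {d. d dvd m})"
  proof
    fix d assume "d \<in> {d. d dvd q ^ e * m}"
    then obtain b c where bc: "d = b * c" "b dvd q ^ e" "c dvd m"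
      using division_decomp [of d "q ^ e" m] by auto
    then obtain i where "i \<le> e" "b = q ^ i"
      using divides_primepow_nat [OF assms(1)] by blast
    then show "d \<in> (\<lambda>(i, d). q ^ i * d) ` ({..e} \<times> {d. d dvd m})"
      using bc by force
  qed
  then have "card {d. d dvd q ^ e * m} \<le> card ({..e} \<times> {d. d dvd m})"
    using assms(2) by (intro surj_card_le) auto
  then show ?thesis by (simp add: card_cartesian_product)
qed

text \<open>The value 8 is sharp, attained at \<open>e = 3\<close>. From 4 on the left side grows at
  each step by a factor of at most (5/4)^3 < 2.\<close>

lemma cube_le_eight_two_power: "((e::nat) + 1) ^ 3 \<le> 8 * 2 ^ e"
proof (cases "e < 4")
  case True
  then consider "e = 0" | "e = 1" | "e = 2" | "e = 3" by linarith
  then show ?thesis by cases (auto simp: power3_eq_cube)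
next
  case False
  then have "4 \<le> e" by simp
  then show ?thesis
  proof (induction e rule: dec_induct)
    case (step e)
    have "(4 * (Suc e + 1)) ^ 3 \<le> (5 * (e + 1)) ^ 3"
      using step.hyps by (intro power_mono) auto
    then have "64 * (Suc e + 1) ^ 3 \<le> 125 * (e + 1) ^ 3"
      unfolding power_mult_distrib by simp
    then have "(Suc e + 1) ^ 3 \<le> 2 * (e + 1) ^ 3" by linarith
    then show ?case using step.IH unfolding power_Suc by linarith
  qed simp
qed

lemma cube_le_eight_power: "((e::nat) + 1) ^ 3 \<le> 8 ^ e"
proof (induction e)
  case (Suc e)
  have "(e + 2) ^ 3 \<le> (2 * (e + 1)) ^ 3" by (intro power_mono) auto
  also have "\<dots> = 8 * (e + 1) ^ 3" unfolding power_mult_distrib by simp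
  also have "\<dots> \<le> 8 * 8 ^ e" using Suc by simp
  finally show ?case by simp
qed simp

text \<open>For a prime \<open>q \<ge> 8\<close> the factor \<open>(e + 1)\<^sup>3\<close> contributed by \<open>q\<^sup>e\<close> is at most \<open>q\<^sup>e\<close>;
  each smaller prime costs at most one additional factor 8.\<close>

lemma card_divisors_cubed_aux:
  "0 < n \<Longrightarrow> card {d::nat. d dvd n} ^ 3 \<le> 8 ^ card {q \<in> {..<8}. prime q \<and> q dvd n} * n"
proof (induction n rule: less_induct)
  case (less n)
  let ?S = "\<lambda>n. {q \<in> {..<8}. prime q \<and> q dvd (n::nat)}"
  show ?case
  proof (cases "n = 1")
    case True
    then show ?thesis by simp
  next
    case False
    then obtain q where q: "prime q" "q dvd n" using prime_factor_nat by blast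
    then obtain m where m: "n = q ^ multiplicity q n * m" "\<not> q dvd m"
      using multiplicity_decompose' [of n q] less.prems by (metis neq0_conv not_prime_unit)
    define e where "e = multiplicity q n"
    have e: "n = q ^ e * m" using m e_def by simp
    have e1: "e \<ge> 1" using q less.prems unfolding e_def
      by (metis One_nat_def Suc_leI multiplicity_gt_zero_iff neq0_conv not_prime_unit)
    have m0: "m > 0" using m(2) by (rule contrapos_np) simp
    have q2: "2 \<le> q" using q(1) prime_ge_2_nat by blast
    have "2 \<le> q ^ e" using q2 e1 power_increasing [of 1 e q] by auto
    then have "2 * m \<le> n" unfolding e by (rule mult_le_mono1)
    then have mn: "m < n" using m0 by linarith
    have IH: "card {d. d dvd m} ^ 3 \<le> 8 ^ card (?S m) * m" by (rule less.IH [OF mn m0])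
    have sub: "?S m \<subseteq> ?S n" using e by auto
    have key: "(e + 1) ^ 3 * 8 ^ card (?S m) \<le> 8 ^ card (?S n) * q ^ e"
    proof (cases "q < 8")
      case True
      have "insert q (?S m) \<subseteq> ?S n" using sub q True by auto
      then have "card (insert q (?S m)) \<le> card (?S n)" by (intro card_mono) auto
      then have c: "Suc (card (?S m)) \<le> card (?S n)" using m(2) by simp
      have "(e + 1) ^ 3 * 8 ^ card (?S m) \<le> (8 * q ^ e) * 8 ^ card (?S m)"
        using cube_le_eight_two_power [of e] power_mono [OF q2, of e] by (intro mult_right_mono) auto
      also have "\<dots> = 8 ^ Suc (card (?S m)) * q ^ e" by simp
      also have "\<dots> \<le> 8 ^ card (?S n) * q ^ e" using c by (intro mult_right_mono power_increasing) auto
      finally show ?thesis .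
    next
      case False
      have c: "card (?S m) \<le> card (?S n)" using sub by (intro card_mono) auto
      have "(e + 1) ^ 3 \<le> q ^ e"
        using cube_le_eight_power [of e] power_mono [of 8 q e] False by auto
      then have "(e + 1) ^ 3 * 8 ^ card (?S m) \<le> q ^ e * 8 ^ card (?S n)"
        using c by (intro mult_mono power_increasing) auto
      then show ?thesis by (simp add: mult.commute)
    qed
    have "card {d. d dvd n} ^ 3 \<le> ((e + 1) * card {d. d dvd m}) ^ 3"
      using card_divisors_prime_power_mult [OF q(1) m0, of e] e by (intro power_mono) auto
    also have "\<dots> = (e + 1) ^ 3 * card {d. d dvd m} ^ 3" by (simp only: power_mult_distrib)
    also have "\<dots> \<le> (e + 1) ^ 3 * (8 ^ card (?S m) * m)" using IH by (intro mult_left_mono) auto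
    also have "\<dots> \<le> 8 ^ card (?S n) * q ^ e * m"
      using mult_le_mono1 [OF key, of m] by (simp only: mult.assoc)
    also have "\<dots> = 8 ^ card (?S n) * n" using e by simp
    finally show ?thesis .
  qed
qed

text \<open>An exponent 1/2 in place of 1/3 would keep the later count linear only up to radius p^2,
  just short of what is needed. The second 8 in \<open>8 ^ 8\<close> is a crude bound for the number
  of primes below 8.\<close>

lemma card_divisors_cubed:
  assumes "0 < n"
  shows "card {d::nat. d dvd n} ^ 3 \<le> 8 ^ 8 * n"
proof -
  have "card {q \<in> {..<8::nat}. prime q \<and> q dvd n} \<le> card {..<8::nat}" by (intro card_mono) auto
  then have "(8::nat) ^ card {q \<in> {..<8::nat}. prime q \<and> q dvd n} \<le> 8 ^ 8" by (intro power_increasing) auto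
  then show ?thesis using card_divisors_cubed_aux [OF assms] by (meson le_trans mult_le_mono1)
qed

lemma card_int_divisors:
  assumes "n \<noteq> 0"
  shows "card {d::int. d dvd n} \<le> 2 * card {d::nat. d dvd nat \<bar>n\<bar>}"
proof -
  let ?D = "{d::nat. d dvd nat \<bar>n\<bar>}"
  have fin: "finite ?D" using assms by (intro finite_divisors) simp
  have "{d::int. d dvd n} \<subseteq> int ` ?D \<union> (\<lambda>d. - int d) ` ?D"
  proof
    fix d assume "d \<in> {d::int. d dvd n}"
    then have "nat \<bar>d\<bar> \<in> ?D" by (simp add: nat_dvd_iff)
    moreover have "d = int (nat \<bar>d\<bar>) \<or> d = - int (nat \<bar>d\<bar>)" by auto
    ultimately show "d \<in> int ` ?D \<union> (\<lambda>d. - int d) ` ?D" by blast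
  qed
  then have "card {d::int. d dvd n} \<le> card (int ` ?D \<union> (\<lambda>d. - int d) ` ?D)"
    using fin by (intro card_mono) auto
  also have "\<dots> \<le> card (int ` ?D) + card ((\<lambda>d. - int d) ` ?D)" by (rule card_Un_le)
  also have "\<dots> \<le> card ?D + card ?D" using fin by (intro add_mono card_image_le)
  finally show ?thesis by simp
qed

section \<open>Counting in the principal congruence subgroup\<close>

lemma cong_imp_eq_add_mult:
  fixes a r m :: int
  assumes "[a = r] (mod m)"
  obtains k where "a = r + m * k"
proof -
  have "m dvd a - r" using assms by (simp add: cong_iff_dvd_diff)
  then obtain k where "a - r = m * k" by (rule dvdE)
  then show ?thesis using that [of k] by simp
qed

lemma card_cong_interval:
  fixes m r :: int and X :: real
  assumes m: "m > 0" and X: "X \<ge> 0"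
  shows "finite {a. \<bar>real_of_int a\<bar> \<le> X \<and> [a = r] (mod m)}"
    and "real (card {a. \<bar>real_of_int a\<bar> \<le> X \<and> [a = r] (mod m)}) \<le> 2 * X / m + 1"
proof -
  let ?A = "{a. \<bar>real_of_int a\<bar> \<le> X \<and> [a = r] (mod m)}"
  define lo hi where "lo = \<lceil>(- X - r) / m\<rceil>" and "hi = \<lfloor>(X - r) / m\<rfloor>"
  have sub: "?A \<subseteq> (\<lambda>k. r + m * k) ` {lo..hi}"
  proof
    fix a assume a: "a \<in> ?A"
    then obtain k where k: "a = r + m * k"
      using cong_imp_eq_add_mult by blast
    have "- X \<le> real_of_int r + real_of_int m * real_of_int k" "real_of_int r + real_of_int m * real_of_int k \<le> X"
      using a k by (auto simp: abs_le_iff)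
    then have "lo \<le> k" "k \<le> hi"
      using m by (auto simp: lo_def hi_def ceiling_le_iff le_floor_iff field_simps)
    then show "a \<in> (\<lambda>k. r + m * k) ` {lo..hi}" using k by auto
  qed
  then show fin: "finite ?A" by (rule finite_subset) auto
  have "card ?A \<le> card {lo..hi}" by (rule surj_card_le [OF _ sub]) auto
  then have c: "real (card ?A) \<le> real (nat (hi - lo + 1))" by simp
  have "real_of_int hi \<le> (X - r) / m" "(- X - r) / m \<le> real_of_int lo"
    unfolding hi_def lo_def by auto
  then have "real_of_int hi - real_of_int lo \<le> (X - r) / m - (- X - r) / m" by linarith
  also have "\<dots> = 2 * X / m" using m by (simp add: field_simps)
  finally have d: "real_of_int (hi - lo + 1) \<le> 2 * X / m + 1" by simp
  have "0 \<le> 2 * X / m + 1" using m X by simp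
  then have "real (nat (hi - lo + 1)) \<le> 2 * X / m + 1"
    using d by (cases "hi - lo + 1 \<ge> 0") auto
  then show "real (card ?A) \<le> 2 * X / m + 1" using c by linarith
qed

text \<open>Writing the matrix as 1 + p M, the determinant is 1 + p tr M + p^2 det M. Determinant 1
  makes p tr M, the excess of the trace over 2, a multiple of p^2.\<close>

lemma trace_cong_two:
  assumes "mdet g = 1" "mcong p g 1"
  shows "[m11 g + m22 g = 2] (mod p\<^sup>2)"
proof -
  obtain a b c d where *: "m11 g = 1 + p * a" "m12 g = p * b" "m21 g = p * c" "m22 g = 1 + p * d"
  proof -
    have "[m11 g = 1] (mod p)" "[m12 g = 0] (mod p)" "[m21 g = 0] (mod p)" "[m22 g = 1] (mod p)"
      using assms(2) by (simp_all add: mcong_def one_mat2_def)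
    then show ?thesis
      using that by (elim cong_imp_eq_add_mult) (simp only: add_0)
  qed
  have "m11 g + m22 g - 2 = p\<^sup>2 * (b * c - a * d)"
    using assms(1) unfolding mdet_def * by (simp add: algebra_simps power2_eq_square)
  then show ?thesis by (metis cong_iff_dvd_diff dvd_triv_left)
qed

lemma card_principal_ball_small:
  fixes X :: real
  assumes "X < p - 1"
  shows "principal_ball p X \<subseteq> {1}"
proof
  fix g assume g: "g \<in> principal_ball p X"
  have small: "x = 0" if "p dvd x" "\<bar>real_of_int x\<bar> < p" for x :: int
    using that dvd_imp_le_int [of x p] by (cases "x = 0") auto
  have n: "\<bar>real_of_int (m11 g)\<bar> \<le> X" "\<bar>real_of_int (m12 g)\<bar> \<le> X" "\<bar>real_of_int (m21 g)\<bar> \<le> X" "\<bar>real_of_int (m22 g)\<bar> \<le> X"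
    using g abs_entry_le_mnorm [of g] unfolding principal_ball_def by (auto simp flip: of_int_abs intro: order_trans [rotated])
  have d: "p dvd m11 g - 1" "p dvd m12 g" "p dvd m21 g" "p dvd m22 g - 1"
    using g by (auto simp: principal_ball_def mcong_def one_mat2_def cong_iff_dvd_diff)
  have "m11 g - 1 = 0" using n assms by (intro small d) auto
  moreover have "m12 g = 0" using n assms by (intro small d) auto
  moreover have "m21 g = 0" using n assms by (intro small d) auto
  moreover have "m22 g - 1 = 0" using n assms by (intro small d) auto
  ultimately show "g \<in> {1}" by (simp add: one_mat2_def mat2.expand)
qed

text \<open>The trace of an element of the principal congruence subgroup is congruent to 2 modulo
  \<open>p\<^sup>2\<close>. Given the diagonal, the off-diagonal entries have a prescribed product.\<close>

lemma card_principal_ball: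
  fixes p :: nat and X :: real
  assumes p: "p \<ge> 3" and X1: "1 \<le> X" and X2: "X \<le> real p powr 2.2"
  shows "real (card (principal_ball (int p) X)) \<le> 11000 * X"
proof (cases "X < real_of_int (int p) - 1")
  case True
  have "card (principal_ball (int p) X) \<le> card {1::mat2}"
    using card_principal_ball_small [OF True] by (intro card_mono) auto
  then show ?thesis using X1 by simp
next
  case False
  let ?P = "principal_ball (int p) X"
  define f where "f = (\<lambda>g. (m11 g, m11 g + m22 g))"
  define P0 where "P0 = {g \<in> ?P. m12 g * m21 g = 0}"
  define P1 where "P1 = {g \<in> ?P. m12 g * m21 g \<noteq> 0}"
  have finP: "finite P0" "finite P1" unfolding P0_def P1_def using finite_principal_ball by auto
  \<comment> \<open>Beyond the trivial range of \<open>X\<close>, this absorbs the rounding term 1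
    in the interval counts modulo p.\<close>
  have pX: "real p \<le> 2 * X" using False X1 by auto
  have p0: "real p > 0" using p by simp
  have entries: "\<bar>real_of_int (m11 g)\<bar> \<le> X" "\<bar>real_of_int (m12 g)\<bar> \<le> X" "\<bar>real_of_int (m21 g)\<bar> \<le> X" "\<bar>real_of_int (m22 g)\<bar> \<le> X"
    if "g \<in> ?P" for g
    using that abs_entry_le_mnorm [of g] unfolding principal_ball_def by (auto simp flip: of_int_abs intro: order_trans [rotated])
  have congs: "[m11 g = 1] (mod int p)" "[m12 g = 0] (mod int p)" "[m21 g = 0] (mod int p)" "[m22 g = 1] (mod int p)"
    if "g \<in> ?P" for g
    using that by (auto simp: principal_ball_def mcong_def one_mat2_def)
  let ?I = "\<lambda>X r m. {a. \<bar>real_of_int a\<bar> \<le> X \<and> [a = r] (mod m)}"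
  have I: "finite (?I X r (int p))" "real (card (?I X r (int p))) \<le> 4 * X / p" for r
  proof -
    show "finite (?I X r (int p))" using p X1 by (intro card_cong_interval) auto
    have "real (card (?I X r (int p))) \<le> 2 * X / p + 1"
      using card_cong_interval(2) [of "int p" X r] p X1 by simp
    also have "\<dots> \<le> 4 * X / p" using pX p0 by (simp add: field_simps)
    finally show "real (card (?I X r (int p))) \<le> 4 * X / p" .
  qed
  \<comment> \<open>If an off-diagonal entry vanishes, the diagonal entries are both 1 or both -1,
    and -1 is not 1 modulo p. Only unipotent triangular matrices remain.\<close>
  have "real (card P0) \<le> 8 * X / p"
  proof -
    have "P0 \<subseteq> (\<lambda>b. Mat2 1 b 0 1) ` ?I X 0 (int p) \<union> (\<lambda>c. Mat2 1 0 c 1) ` ?I X 0 (int p)"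
    proof
      fix g assume g: "g \<in> P0"
      then have gP: "g \<in> ?P" and z: "m12 g = 0 \<or> m21 g = 0" by (auto simp: P0_def)
      have "m11 g * m22 g = 1" using g by (auto simp: P0_def principal_ball_def mdet_def)
      then have "(m11 g = 1 \<and> m22 g = 1) \<or> (m11 g = -1 \<and> m22 g = -1)"
        using zmult_eq_1_iff by blast
      moreover have "m11 g \<noteq> -1"
      proof
        assume "m11 g = -1"
        then have "int p dvd -1 - 1" using congs(1) [OF gP] by (simp add: cong_iff_dvd_diff)
        then have "int p dvd 2" by simp
        then show False using p by (auto dest: zdvd_imp_le)
      qed
      ultimately have "m11 g = 1" "m22 g = 1" by auto
      then have "g = Mat2 1 (m12 g) 0 1 \<or> g = Mat2 1 0 (m21 g) 1"
        using z by (auto simp: mat2.expand)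
      then show "g \<in> (\<lambda>b. Mat2 1 b 0 1) ` ?I X 0 (int p) \<union> (\<lambda>c. Mat2 1 0 c 1) ` ?I X 0 (int p)"
        using entries [OF gP] congs [OF gP] by blast
    qed
    then have "card P0 \<le> card ((\<lambda>b. Mat2 1 b 0 1) ` ?I X 0 (int p) \<union> (\<lambda>c. Mat2 1 0 c 1) ` ?I X 0 (int p))"
      using I by (intro card_mono) auto
    also have "\<dots> \<le> card ((\<lambda>b. Mat2 1 b 0 1) ` ?I X 0 (int p)) + card ((\<lambda>c. Mat2 1 0 c 1) ` ?I X 0 (int p))"
      by (rule card_Un_le)
    also have "\<dots> \<le> card (?I X 0 (int p)) + card (?I X 0 (int p))"
      using I by (intro add_mono card_image_le)
    finally have "real (card P0) \<le> 2 * real (card (?I X 0 (int p)))" by simp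
    then show ?thesis using I(2) [of 0] by simp
  qed
  moreover have "real (card P1) \<le> 512 * real p powr 0.8 * (4 * X / p * (4 * X / p\<^sup>2 + 1))"
  proof -
    define k where "k = nat \<lfloor>512 * real p powr 0.8\<rfloor>"
    have "card {g \<in> P1. f g = z} \<le> k" if z: "z \<in> f ` P1" for z
    proof -
      let ?F = "{g \<in> P1. f g = z}"
      obtain g0 where g0: "g0 \<in> P1" "f g0 = z" using z by auto
      \<comment> \<open>Both off-diagonal entries are multiples of p. Dividing them by p first
        brings the number whose divisors are counted down from \<open>X\<^sup>2\<close> to
        \<open>X\<^sup>2\<close> / p^2, at most p^2.4.\<close>
      define n where "n = (m12 g0 div int p) * (m21 g0 div int p)"
      have div: "m12 g = int p * (m12 g div int p)" "m21 g = int p * (m21 g div int p)" if "g \<in> ?P" for g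
        using congs(2,3) [OF that] by (auto simp: cong_0_iff)
      have prodeq: "m12 g * m21 g = (int p)\<^sup>2 * ((m12 g div int p) * (m21 g div int p))" if "g \<in> ?P" for g
        using div [OF that] by (metis (no_types) mult.assoc mult.left_commute power2_eq_square)
      have n: "n = (m12 g div int p) * (m21 g div int p)" if g: "g \<in> ?F" for g
      proof -
        have P: "g \<in> ?P" "g0 \<in> ?P" using g g0 by (auto simp: P1_def)
        have "m11 g = m11 g0" "m22 g = m22 g0" using g g0 by (auto simp: f_def)
        moreover have "mdet g = 1" "mdet g0 = 1" using P by (auto simp: principal_ball_def)
        ultimately have "m12 g * m21 g = m12 g0 * m21 g0" unfolding mdet_def by (metis add_diff_cancel_left' diff_diff_eq2 diff_add_cancel)
        then show ?thesis unfolding n_def using prodeq P p by simp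
      qed
      have n0: "n \<noteq> 0" using g0 prodeq [of g0] by (auto simp: P1_def n_def)
      have "inj_on (\<lambda>g. m12 g div int p) ?F"
      proof (rule inj_onI)
        fix g h assume gh: "g \<in> ?F" "h \<in> ?F" "m12 g div int p = m12 h div int p"
        have P: "g \<in> ?P" "h \<in> ?P" using gh by (auto simp: P1_def)
        have "m21 g div int p = m21 h div int p" using n [OF gh(1)] n [OF gh(2)] n0 gh(3) by auto
        then have "m12 g = m12 h" "m21 g = m21 h" using div [OF P(1)] div [OF P(2)] gh(3) by metis+
        moreover have "m11 g = m11 h" "m22 g = m22 h" using gh by (auto simp: f_def)
        ultimately show "g = h" by (simp add: mat2.expand)
      qed
      moreover have "(\<lambda>g. m12 g div int p) ` ?F \<subseteq> {d. d dvd n}" using n by auto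
      moreover have "finite {d::int. d dvd n}" using n0 by simp
      ultimately have "card ?F \<le> card {d. d dvd n}" by (rule card_inj_on_le)
      also have "\<dots> \<le> 2 * card {d. d dvd nat \<bar>n\<bar>}" by (rule card_int_divisors [OF n0])
      finally have F: "card ?F \<le> 2 * card {d. d dvd nat \<bar>n\<bar>}" .
      have nX: "real p ^ 2 * real (nat \<bar>n\<bar>) \<le> X\<^sup>2"
      proof -
        have gP: "g0 \<in> ?P" using g0 by (auto simp: P1_def)
        have "\<bar>real_of_int (m12 g0)\<bar> * \<bar>real_of_int (m21 g0)\<bar> \<le> X * X"
          using entries [OF gP] X1 by (intro mult_mono) auto
        moreover have "\<bar>real_of_int (m12 g0)\<bar> * \<bar>real_of_int (m21 g0)\<bar> = \<bar>real_of_int (m12 g0 * m21 g0)\<bar>"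
          by (simp add: abs_mult)
        also have "\<dots> = real p ^ 2 * real (nat \<bar>n\<bar>)"
          unfolding prodeq [OF gP] n_def by (simp add: abs_mult)
        ultimately show ?thesis by (simp add: power2_eq_square)
      qed
      \<comment> \<open>The cube root of \<open>8 ^ 8\<close> p^2.4 is 256 p^0.8. Allowing both
        signs of the divisor doubles 256 to 512.\<close>
      have "real (card {d. d dvd nat \<bar>n\<bar>} ^ 3) \<le> real (8 ^ 8 * nat \<bar>n\<bar>)"
        using card_divisors_cubed [of "nat \<bar>n\<bar>"] n0 unfolding of_nat_le_iff by simp
      then have "real (card {d. d dvd nat \<bar>n\<bar>}) ^ 3 \<le> 8 ^ 8 * real (nat \<bar>n\<bar>)" by simp
      also have "\<dots> \<le> 8 ^ 8 * (X\<^sup>2 / real p ^ 2)" using nX p0 by (simp add: field_simps)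
      also have "\<dots> \<le> 8 ^ 8 * ((real p powr 2.2)\<^sup>2 / real p ^ 2)"
        using X1 X2 by (intro mult_left_mono divide_right_mono power_mono) auto
      also have "(real p powr 2.2)\<^sup>2 / real p ^ 2 = real p powr 2.4"
      proof -
        have "(real p powr 2.2)\<^sup>2 = real p powr 4.4"
          by (simp add: power2_eq_square powr_add [symmetric])
        moreover have "real p ^ 2 = real p powr 2" using p0 by simp
        ultimately show ?thesis by (simp only: powr_diff [symmetric]) simp
      qed
      also have "8 ^ 8 * real p powr 2.4 = (256 * real p powr 0.8) ^ 3"
        using p0 by (simp add: power_mult_distrib powr_power)
      finally have "real (card {d. d dvd nat \<bar>n\<bar>}) \<le> 256 * real p powr 0.8"
        by (rule power_le_imp_le_base [where n = 2, unfolded numeral_2_eq_2 numeral_3_eq_3 [symmetric]]) simp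
      then have "real (card ?F) \<le> 512 * real p powr 0.8" using F by linarith
      then show "card ?F \<le> k" unfolding k_def by (simp add: le_nat_floor)
    qed
    then have c: "card P1 \<le> k * card (f ` P1)" by (intro card_le_mult_fibres finP)
    have sub: "f ` P1 \<subseteq> ?I X 1 (int p) \<times> ?I (2 * X) 2 (int p ^ 2)"
    proof
      fix z assume "z \<in> f ` P1"
      then obtain g where g: "g \<in> ?P" "z = f g" by (auto simp: P1_def)
      have "[m11 g + m22 g = 2] (mod (int p)\<^sup>2)"
        using g(1) by (intro trace_cong_two) (auto simp: principal_ball_def)
      moreover have "\<bar>real_of_int (m11 g + m22 g)\<bar> \<le> 2 * X" using entries [OF g(1)] by simp
      ultimately show "z \<in> ?I X 1 (int p) \<times> ?I (2 * X) 2 (int p ^ 2)"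
        using g entries [OF g(1)] congs [OF g(1)] by (simp add: f_def)
    qed
    have I2: "finite (?I (2 * X) 2 (int p ^ 2))" "real (card (?I (2 * X) 2 (int p ^ 2))) \<le> 4 * X / p\<^sup>2 + 1"
      using card_cong_interval [of "int p ^ 2" "2 * X" 2] p X1 by auto
    have "card (f ` P1) \<le> card (?I X 1 (int p) \<times> ?I (2 * X) 2 (int p ^ 2))"
      by (rule card_mono [OF finite_cartesian_product [OF I(1) I2(1)] sub])
    then have "real (card (f ` P1)) \<le> real (card (?I X 1 (int p))) * real (card (?I (2 * X) 2 (int p ^ 2)))"
      by (simp only: card_cartesian_product of_nat_mult [symmetric] of_nat_le_iff)
    also have "\<dots> \<le> 4 * X / p * (4 * X / p\<^sup>2 + 1)"
      using I(2) [of 1] I2(2) X1 by (intro mult_mono) auto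
    finally have f: "real (card (f ` P1)) \<le> 4 * X / p * (4 * X / p\<^sup>2 + 1)" .
    have "real k \<le> 512 * real p powr 0.8" unfolding k_def by (simp add: of_nat_floor)
    then have "real k * real (card (f ` P1)) \<le> 512 * real p powr 0.8 * (4 * X / p * (4 * X / p\<^sup>2 + 1))"
      using f by (intro mult_mono) auto
    moreover have "real (card P1) \<le> real (k * card (f ` P1))" using c by (rule of_nat_mono)
    ultimately show ?thesis unfolding of_nat_mult by (rule order_trans [rotated])
  qed
  \<comment> \<open>For X = p^(2+d) the divisor factor is about p^((2+2d)/3) and the trace factor
    about p^d. The 1/p of the diagonal factor compensates them exactly when d = 0.2, which is the
    origin of the exponent 2.2.\<close>
  moreover have "512 * real p powr 0.8 * (4 * X / p * (4 * X / p\<^sup>2 + 1)) \<le> 512 * 20 * X"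
  proof -
    have "X / p\<^sup>2 \<le> real p powr 2.2 / p powr 2" using X2 p0 by (simp add: divide_right_mono)
    also have "\<dots> = real p powr 0.2" by (simp only: powr_diff [symmetric]) simp
    finally have "4 * X / p\<^sup>2 + 1 \<le> 5 * real p powr 0.2"
      using ge_one_powr_ge_zero [of "real p" "0.2"] p by simp
    then have "512 * real p powr 0.8 * (4 * X / p * (4 * X / p\<^sup>2 + 1)) \<le> 512 * real p powr 0.8 * (4 * X / p * (5 * real p powr 0.2))"
      using X1 p by (intro mult_left_mono) auto
    also have "\<dots> = 512 * 20 * X * ((real p powr 0.8 * real p powr 0.2) / p)" by simp
    also have "real p powr 0.8 * real p powr 0.2 = p" using p by (simp flip: powr_add)
    finally show ?thesis using p0 by simp
  qed
  moreover have "card ?P \<le> card P0 + card P1"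
  proof -
    have "?P = P0 \<union> P1" by (auto simp: P0_def P1_def)
    then show ?thesis by (metis card_Un_le)
  qed
  moreover have "8 * X / p \<le> 8 * X" using p X1 by (simp add: field_simps)
  ultimately have "real (card ?P) \<le> 8 * X + 512 * 20 * X" by linarith
  then show ?thesis using X1 by linarith
qed

lemma sum_principal_ball:
  fixes p :: nat and X :: real
  assumes p: "p \<ge> 3" and X1: "1 \<le> X" and X2: "X \<le> real p powr 2.2" and L: "X \<le> 2 ^ L"
  shows "(\<Sum>\<gamma>\<in>principal_ball (int p) X. 1 / real_of_int (mnorm \<gamma>)) \<le> 22000 * (real L + 1)"
proof -
  let ?P = "principal_ball (int p) X"
  have "(\<Sum>\<gamma>\<in>?P. 1 / real_of_int (mnorm \<gamma>)) \<le> 2 * 11000 * (real L + 1)"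
  proof (rule sum_inverse_dyadic [where m = 1])
    fix \<gamma> assume "\<gamma> \<in> ?P"
    then have "mdet \<gamma> = 1" "real_of_int (mnorm \<gamma>) \<le> X" by (auto simp: principal_ball_def)
    then show "1 \<le> real_of_int (mnorm \<gamma>)" "real_of_int (mnorm \<gamma>) \<le> 1 * 2 ^ L"
      using mnorm_pos [of \<gamma>] L by linarith+
  next
    fix \<kappa> :: real assume \<kappa>: "1 \<le> \<kappa>"
    have "{x \<in> ?P. real_of_int (mnorm x) \<le> \<kappa>} = principal_ball (int p) (min \<kappa> X)"
      by (auto simp: principal_ball_def)
    then have "real (card {x \<in> ?P. real_of_int (mnorm x) \<le> \<kappa>}) \<le> 11000 * min \<kappa> X"
      using card_principal_ball [of p "min \<kappa> X"] p X1 X2 \<kappa> by simp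
    then show "real (card {x \<in> ?P. real_of_int (mnorm x) \<le> \<kappa>}) \<le> 11000 * \<kappa>" by linarith
  qed (auto simp: finite_principal_ball)
  then show ?thesis by simp
qed

section \<open>Harmonic analysis over the field with p elements\<close>

section \<open>Functions on the plane modulo a prime\<close>

locale prime_modulus =
  fixes p :: nat
  assumes prime_p: "prime p" and p3: "p \<ge> 3"
begin

abbreviation P :: int where "P \<equiv> int p"

lemma prime_P: "prime P"
  using prime_p by simp

definition box :: "(int \<times> int) set" where
  "box = {0..<P} \<times> {0..<P}"

definition red :: "int \<times> int \<Rightarrow> int \<times> int" where
  "red v = (fst v mod P, snd v mod P)"

definition mred :: "mat2 \<Rightarrow> mat2" where
  "mred g = Mat2 (m11 g mod P) (m12 g mod P) (m21 g mod P) (m22 g mod P)"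

definition vcong :: "int \<times> int \<Rightarrow> int \<times> int \<Rightarrow> bool" where
  "vcong u v \<longleftrightarrow> [fst u = fst v] (mod P) \<and> [snd u = snd v] (mod P)"

definition smul :: "int \<Rightarrow> int \<times> int \<Rightarrow> int \<times> int" where
  "smul c v = (c * fst v, c * snd v)"

text \<open>Functions on the plane over the residue field are encoded as periodic functions on
  integer pairs, so that integer matrices act without reduction; sums run over the representatives
  in \<open>box\<close>.\<close>

definition periodic :: "(int \<times> int \<Rightarrow> real) \<Rightarrow> bool" where
  "periodic F \<longleftrightarrow> (\<forall>u v. vcong u v \<longrightarrow> F u = F v)"

definition ip :: "(int \<times> int \<Rightarrow> real) \<Rightarrow> (int \<times> int \<Rightarrow> real) \<Rightarrow> real" where
  "ip F G = (\<Sum>v\<in>box. F v * G v)"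

lemma P_pos: "P > 0"
  using p3 by simp

lemma finite_box [simp]: "finite box"
  by (simp add: box_def)

lemma card_box: "card box = p\<^sup>2"
  by (simp add: box_def power2_eq_square)

lemma sum_box: "sum f box = (\<Sum>a\<in>{0..<P}. \<Sum>b\<in>{0..<P}. f (a, b))"
  by (simp add: box_def sum.cartesian_product)

lemma red_in_box [simp]: "red v \<in> box"
  using P_pos by (simp add: red_def box_def)

lemma vcong_refl [simp]: "vcong v v"
  by (simp add: vcong_def)

lemma vcong_sym: "vcong u v \<Longrightarrow> vcong v u"
  by (simp add: vcong_def cong_sym)

lemma vcong_trans: "vcong u v \<Longrightarrow> vcong v w \<Longrightarrow> vcong u w"
  unfolding vcong_def by (blast intro: cong_trans)

lemma vcong_red [simp]: "vcong (red v) v"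
  by (simp add: vcong_def red_def)

lemma vcong_iff_red: "vcong u v \<longleftrightarrow> red u = red v"
  by (simp add: vcong_def red_def cong_def)

lemma red_box: "v \<in> box \<Longrightarrow> red v = v"
  by (auto simp: red_def box_def)

lemma vcong_box_eq: "u \<in> box \<Longrightarrow> v \<in> box \<Longrightarrow> vcong u v \<Longrightarrow> u = v"
  by (metis vcong_iff_red red_box)

lemma vcong_act: "mcong P g h \<Longrightarrow> vcong u v \<Longrightarrow> vcong (act g u) (act h v)"
  unfolding vcong_def mcong_def act_def by (auto intro!: cong_add cong_mult)

lemma act_smul: "act g (smul c v) = smul c (act g v)"
  by (simp add: act_def smul_def algebra_simps)

lemma mcong_mred [simp]: "mcong P (mred g) g"
  by (simp add: mcong_def mred_def)

lemma mcong_iff_mred: "mcong P g h \<longleftrightarrow> mred g = mred h"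
  by (simp add: mcong_def mred_def cong_def)

lemma periodicD: "periodic F \<Longrightarrow> vcong u v \<Longrightarrow> F u = F v"
  unfolding periodic_def by blast

lemma periodic_act: "periodic F \<Longrightarrow> periodic (\<lambda>v. F (act g v))"
  unfolding periodic_def using vcong_act [OF mcong_refl] by blast

lemma ip_commute: "ip F G = ip G F"
  by (simp add: ip_def mult.commute)

lemma ip_self_nonneg: "0 \<le> ip F F"
  by (auto simp: ip_def intro!: sum_nonneg)

lemma ip_Cauchy_Schwarz: "(ip F G)\<^sup>2 \<le> ip F F * ip G G"
  unfolding ip_def using Cauchy_Schwarz_ineq_sum [of F G box] by (simp add: power2_eq_square)

lemma ip_act_adjoint:
  assumes "mdet g = 1" "periodic F" "periodic G"
  shows "ip (\<lambda>v. F (act g v)) G = ip F (\<lambda>v. G (act (adj g) v))"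
  unfolding ip_def
proof (rule sum.reindex_bij_witness [where i = "\<lambda>v. red (act (adj g) v)" and j = "\<lambda>v. red (act g v)"])
  fix v assume v: "v \<in> box"
  have "vcong (act (adj g) (red (act g v))) (act (adj g) (act g v))"
    by (intro vcong_act) auto
  then have 1: "vcong (act (adj g) (red (act g v))) v"
    using assms(1) by (simp add: act_mult [symmetric] adj_mult_self)
  then show "red (act (adj g) (red (act g v))) = v"
    using v by (metis vcong_iff_red red_box)
  have "vcong (act g (red (act (adj g) v))) (act g (act (adj g) v))"
    by (intro vcong_act) auto
  then have "vcong (act g (red (act (adj g) v))) v"
    using assms(1) by (simp add: act_mult [symmetric] mult_adj)
  then show "red (act g (red (act (adj g) v))) = v"
    using v by (metis vcong_iff_red red_box)
  show "F (red (act g v)) * G (act (adj g) (red (act g v))) = F (act g v) * G v"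
    using periodicD [OF assms(2) vcong_red] periodicD [OF assms(3) 1] by simp
qed auto

section \<open>Schur orthogonality\<close>

text \<open>All p^4 matrices of residues, singular ones included: for this set the images of two
  independent vectors are exactly equidistributed.\<close>

definition mats :: "mat2 set" where
  "mats = (\<lambda>(r, s). Mat2 (fst r) (snd r) (fst s) (snd s)) ` (box \<times> box)"

lemma finite_mats [simp]: "finite mats"
  by (simp add: mats_def)

lemma mred_in_mats: "mred g \<in> mats"
proof -
  have "((m11 g mod P, m12 g mod P), (m21 g mod P, m22 g mod P)) \<in> box \<times> box"
    using P_pos by (simp add: box_def)
  then show ?thesis unfolding mats_def mred_def by (rule rev_image_eqI) simp
qed

lemma mred_mats: "g \<in> mats \<Longrightarrow> mred g = g"
  by (auto simp: mats_def mred_def box_def)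

lemma bij_betw_vdot_pair:
  assumes "\<not> P dvd cross x y"
  shows "bij_betw (\<lambda>r. (vdot r x mod P, vdot r y mod P)) box box"
proof -
  let ?f = "\<lambda>r. (vdot r x mod P, vdot r y mod P)"
  have "inj_on ?f box"
  proof (rule inj_onI)
    fix r s assume rs: "r \<in> box" "s \<in> box" "?f r = ?f s"
    have d: "P dvd vdot r x - vdot s x" "P dvd vdot r y - vdot s y"
      using rs(3) by (simp_all add: mod_eq_dvd_iff)
    have "(vdot r x - vdot s x) * snd y - (vdot r y - vdot s y) * snd x = (fst r - fst s) * cross x y"
      "(vdot r y - vdot s y) * fst x - (vdot r x - vdot s x) * fst y = (snd r - snd s) * cross x y"
      by (simp_all add: vdot_def cross_def algebra_simps)
    then have "P dvd (fst r - fst s) * cross x y" "P dvd (snd r - snd s) * cross x y"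
      using d by (metis dvd_diff dvd_mult2)+
    then have "P dvd fst r - fst s" "P dvd snd r - snd s"
      using assms prime_P prime_dvd_mult_iff by blast+
    then have "vcong r s" by (simp add: vcong_def cong_iff_dvd_diff)
    then show "r = s" using rs vcong_box_eq by blast
  qed
  moreover have "?f ` box \<subseteq> box" using P_pos by (auto simp: box_def)
  ultimately show ?thesis
    by (simp add: bij_betw_def endo_inj_surj)
qed

text \<open>For independent \<open>x\<close> and \<open>y\<close> each row of \<open>g\<close> is
  determined by its two inner products with them, so the pair of images takes every value exactly
  once. The rest regroups four coordinates from rows to columns.\<close>

lemma sum_mats_pair:
  fixes \<Phi> :: "int \<times> int \<Rightarrow> int \<times> int \<Rightarrow> real"
  assumes "\<not> P dvd cross x y"
  shows "(\<Sum>g\<in>mats. \<Phi> (red (act g x)) (red (act g y))) = (\<Sum>u\<in>box. \<Sum>v\<in>box. \<Phi> u v)"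
proof -
  let ?f = "\<lambda>r. (vdot r x mod P, vdot r y mod P)"
  have "(\<Sum>g\<in>mats. \<Phi> (red (act g x)) (red (act g y)))
      = (\<Sum>(r, s)\<in>box \<times> box. \<Phi> (fst (?f r), fst (?f s)) (snd (?f r), snd (?f s)))"
    unfolding mats_def
    by (subst sum.reindex) (auto simp: inj_on_def act_def red_def vdot_def mult.commute intro!: sum.cong)
  also have "\<dots> = (\<Sum>r\<in>box. \<Sum>s\<in>box. \<Phi> (fst (?f r), fst (?f s)) (snd (?f r), snd (?f s)))"
    by (rule sum.cartesian_product [symmetric])
  also have "\<dots> = (\<Sum>r\<in>box. \<Sum>z\<in>box. \<Phi> (fst (?f r), fst z) (snd (?f r), snd z))"
    by (intro sum.cong refl sum.reindex_bij_betw [OF bij_betw_vdot_pair [OF assms], where g = "\<lambda>z. \<Phi> (fst (?f r), fst z) (snd (?f r), snd z)" for r])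
  also have "\<dots> = (\<Sum>w\<in>box. \<Sum>z\<in>box. \<Phi> (fst w, fst z) (snd w, snd z))"
    by (rule sum.reindex_bij_betw [OF bij_betw_vdot_pair [OF assms], where g = "\<lambda>w. \<Sum>z\<in>box. \<Phi> (fst w, fst z) (snd w, snd z)"])
  also have "\<dots> = (\<Sum>a\<in>{0..<P}. \<Sum>b\<in>{0..<P}. \<Sum>c\<in>{0..<P}. \<Sum>d\<in>{0..<P}. \<Phi> (a, c) (b, d))"
    by (simp add: sum_box)
  also have "\<dots> = (\<Sum>a\<in>{0..<P}. \<Sum>c\<in>{0..<P}. \<Sum>b\<in>{0..<P}. \<Sum>d\<in>{0..<P}. \<Phi> (a, c) (b, d))"
    by (intro sum.cong refl sum.swap)
  also have "\<dots> = (\<Sum>u\<in>box. \<Sum>v\<in>box. \<Phi> u v)"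
    by (simp add: sum_box)
  finally show ?thesis .
qed

text \<open>These are the functions on the projective line, extended by 0 to the origin.\<close>

definition isotropic :: "(int \<times> int \<Rightarrow> real) \<Rightarrow> bool" where
  "isotropic F \<longleftrightarrow> periodic F \<and> F (0, 0) = 0 \<and> (\<forall>c v. \<not> P dvd c \<longrightarrow> F (smul c v) = F v)"

lemma obtain_inverse:
  assumes "\<not> P dvd a"
  obtains b where "[a * b = 1] (mod P)"
proof -
  have "coprime a P" using assms prime_P by (metis coprime_commute prime_imp_coprime)
  then show ?thesis using that cong_solve_coprime_int by blast
qed

lemma smul_of_cross_zero:
  assumes x: "\<not> vcong x (0, 0)" and d: "P dvd cross x y"
  obtains c where "c \<in> {0..<P}" "vcong y (smul c x)"
proof -
  have "P dvd fst x * snd y - snd x * fst y" using d by (simp add: cross_def)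
  then have xy: "[fst x * snd y = snd x * fst y] (mod P)" by (simp add: cong_iff_dvd_diff)
  have *: "\<exists>c. [b1 = c * a1] (mod P) \<and> [b2 = c * a2] (mod P)"
    if a1: "\<not> P dvd a1" and e: "[a1 * b2 = a2 * b1] (mod P)" for a1 a2 b1 b2
  proof -
    obtain i where i: "[a1 * i = 1] (mod P)" using obtain_inverse [OF a1] .
    have "[a1 * i * b1 = 1 * b1] (mod P)" "[a1 * i * b2 = 1 * b2] (mod P)"
      using cong_mult [OF i cong_refl] by blast+
    moreover have "[(a1 * b2) * i = (a2 * b1) * i] (mod P)" using cong_mult [OF e cong_refl] .
    ultimately have "[b1 = (b1 * i) * a1] (mod P)" "[b2 = (b1 * i) * a2] (mod P)"
      by (auto simp: ac_simps cong_def)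
    then show ?thesis by blast
  qed
  have "\<exists>c. vcong y (smul c x)"
  proof (cases "P dvd fst x")
    case False
    then show ?thesis using * [OF False xy] by (simp add: vcong_def smul_def)
  next
    case True
    then have "\<not> P dvd snd x" using x by (auto simp: vcong_def cong_0_iff)
    then show ?thesis using * [OF _ cong_sym [OF xy]] by (auto simp: vcong_def smul_def)
  qed
  then obtain c where c: "vcong y (smul c x)" by blast
  have "vcong (smul c x) (smul (c mod P) x)"
    unfolding vcong_def smul_def by (auto intro!: cong_mult)
  then have "vcong y (smul (c mod P) x)" using c vcong_trans by blast
  then show ?thesis using that [of "c mod P"] P_pos by simp
qed

text \<open>Expanding the square gives a sum over pairs of vectors. Independent pairs contribute a
  multiple of the squared sum of \<open>F\<close>, which is 0. A nonzero \<open>x\<close> has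
  \<open>p - 1\<close> nonzero multiples, on which \<open>F\<close> agrees, and each gives p^2 times
  \<open>ip F F\<close>.\<close>

lemma sum_mats_correlation:
  assumes F: "isotropic F" and mean: "(\<Sum>v\<in>box. F v) = 0"
  shows "(\<Sum>g\<in>mats. (ip (\<lambda>v. F (act g v)) F)\<^sup>2) \<le> real (p - 1) * (real p)\<^sup>2 * (ip F F)\<^sup>2"
proof -
  have per: "periodic F" and F0: "F (0, 0) = 0" and Fc: "\<And>c v. \<not> P dvd c \<Longrightarrow> F (smul c v) = F v"
    using F by (auto simp: isotropic_def)
  let ?N = "ip F F"
  have fr: "F (red v) = F v" for v by (rule periodicD [OF per]) simp
  define W where "W = (\<lambda>x y. \<Sum>g\<in>mats. F (act g x) * F (act g y))"
  have W0: "W x y = 0" if "\<not> P dvd cross x y" for x y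
  proof -
    have "W x y = (\<Sum>g\<in>mats. F (red (act g x)) * F (red (act g y)))" by (simp add: W_def fr)
    also have "\<dots> = (\<Sum>u\<in>box. \<Sum>v\<in>box. F u * F v)" by (rule sum_mats_pair [OF that])
    also have "\<dots> = 0" by (simp add: sum_distrib_left [symmetric] mean)
    finally show ?thesis .
  qed
  have W1: "W x x = (real p)\<^sup>2 * ?N" if x: "\<not> vcong x (0, 0)" for x
  proof -
    have "\<exists>y. \<not> P dvd cross x y"
    proof (cases "P dvd fst x")
      case True
      then have "\<not> P dvd cross x (-1, 0)" using x by (auto simp: cross_def vcong_def cong_0_iff)
      then show ?thesis by blast
    next
      case False
      then have "\<not> P dvd cross x (0, 1)" by (auto simp: cross_def)
      then show ?thesis by blast
    qed
    then obtain y where y: "\<not> P dvd cross x y" ..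
    have "W x x = (\<Sum>g\<in>mats. (\<lambda>u v. F u * F u) (red (act g x)) (red (act g y)))" by (simp add: W_def fr)
    also have "\<dots> = (\<Sum>u\<in>box. \<Sum>v\<in>box. F u * F u)" by (rule sum_mats_pair [OF y])
    also have "\<dots> = (real p)\<^sup>2 * ?N" by (simp add: ip_def card_box sum_distrib_left)
    finally show ?thesis .
  qed
  have inner: "(\<Sum>y\<in>box. F x * F y * W x y) \<le> (F x)\<^sup>2 * (real (p - 1) * (real p)\<^sup>2 * ?N)" if xb: "x \<in> box" for x
  proof (cases "vcong x (0, 0)")
    case True
    then have "F x = 0" using periodicD [OF per True] F0 by simp
    then show ?thesis by simp
  next
    case False
    let ?Y = "(\<lambda>c. red (smul c x)) ` {1..<P}"
    have Yb: "?Y \<subseteq> box" by auto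
    have out: "F x * F y * W x y = 0" if y: "y \<in> box" "y \<notin> ?Y" for y
    proof (cases "P dvd cross x y")
      case True
      obtain c where c: "c \<in> {0..<P}" "vcong y (smul c x)"
        using smul_of_cross_zero [OF False True] .
      have "y = red (smul c x)" using c(2) y(1) by (metis vcong_iff_red red_box)
      then have "c \<notin> {1..<P}" using y(2) by auto
      then have "c = 0" using c(1) by auto
      then have "F y = 0" using periodicD [OF per c(2)] F0 by (simp add: smul_def)
      then show ?thesis by simp
    qed (simp add: W0)
    have inn: "F x * F y * W x y = (F x)\<^sup>2 * ((real p)\<^sup>2 * ?N)" if y: "y \<in> ?Y" for y
    proof -
      obtain c where c: "c \<in> {1..<P}" "y = red (smul c x)" using y by auto
      have nd: "\<not> P dvd c" using c(1) by (auto dest: zdvd_imp_le)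
      have Fy: "F y = F x" using c(2) Fc [OF nd] fr by simp
      have "F (act g y) = F (act g x)" for g
      proof -
        have "vcong (act g y) (act g (smul c x))" unfolding c(2) by (intro vcong_act) auto
        then have "F (act g y) = F (smul c (act g x))" using periodicD [OF per] act_smul by metis
        then show ?thesis using Fc [OF nd] by simp
      qed
      then have "W x y = W x x" by (simp add: W_def)
      then show ?thesis using W1 [OF False] Fy by (simp add: power2_eq_square)
    qed
    have "(\<Sum>y\<in>box. F x * F y * W x y) = (\<Sum>y\<in>?Y. F x * F y * W x y)"
      using Yb out by (intro sum.mono_neutral_right) auto
    also have "\<dots> = real (card ?Y) * ((F x)\<^sup>2 * ((real p)\<^sup>2 * ?N))" using inn by simp
    also have "\<dots> \<le> real (p - 1) * ((F x)\<^sup>2 * ((real p)\<^sup>2 * ?N))"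
    proof (rule mult_right_mono)
      have "card ?Y \<le> card {1..<P}" by (rule card_image_le) simp
      also have "\<dots> = p - 1" by simp
      finally show "real (card ?Y) \<le> real (p - 1)" by simp
      show "0 \<le> (F x)\<^sup>2 * ((real p)\<^sup>2 * ?N)" by (intro mult_nonneg_nonneg ip_self_nonneg) auto
    qed
    finally show ?thesis by (simp add: ac_simps)
  qed
  have "(\<Sum>g\<in>mats. (ip (\<lambda>v. F (act g v)) F)\<^sup>2)
      = (\<Sum>g\<in>mats. \<Sum>x\<in>box. \<Sum>y\<in>box. F x * F y * (F (act g x) * F (act g y)))"
    by (simp add: ip_def power2_eq_square sum_product ac_simps)
  also have "\<dots> = (\<Sum>x\<in>box. \<Sum>y\<in>box. \<Sum>g\<in>mats. F x * F y * (F (act g x) * F (act g y)))"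
    by (subst sum.swap, intro sum.cong refl, rule sum.swap)
  also have "\<dots> = (\<Sum>x\<in>box. \<Sum>y\<in>box. F x * F y * W x y)"
    by (simp add: W_def sum_distrib_left)
  also have "\<dots> \<le> (\<Sum>x\<in>box. (F x)\<^sup>2 * (real (p - 1) * (real p)\<^sup>2 * ?N))"
    by (intro sum_mono inner)
  also have "\<dots> = real (p - 1) * (real p)\<^sup>2 * ?N\<^sup>2"
    by (simp add: sum_distrib_right [symmetric] ip_def power2_eq_square)
  finally show ?thesis .
qed

definition sl :: "mat2 set" where
  "sl = {g \<in> mats. [mdet g = 1] (mod P)}"

lemma finite_sl [simp]: "finite sl"
  by (simp add: sl_def)

lemma mdet_mcong: "mcong P g h \<Longrightarrow> [mdet g = mdet h] (mod P)"
  unfolding mcong_def mdet_def by (auto intro!: cong_diff cong_mult)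

lemma mred_in_sl: "mdet g = 1 \<Longrightarrow> mred g \<in> sl"
  using mred_in_mats mdet_mcong [OF mcong_mred, of g] by (simp add: sl_def)

text \<open>Scalar multiples do not change the correlations, and the multiples of the determinant 1
  matrices by \<open>1, \<dots>, (p - 1) / 2\<close> are pairwise incongruent because the determinant
  recovers the square of the scalar.\<close>

lemma sum_sl_correlation:
  assumes F: "isotropic F" and mean: "(\<Sum>v\<in>box. F v) = 0"
  shows "(\<Sum>g\<in>sl. (ip (\<lambda>v. F (act g v)) F)\<^sup>2) \<le> 2 * (real p)\<^sup>2 * (ip F F)\<^sup>2"
proof -
  define cor where "cor = (\<lambda>g. (ip (\<lambda>v. F (act g v)) F)\<^sup>2)"
  define m where "m = (p - 1) div 2"
  define sc where "sc = (\<lambda>c g. Mat2 (c * m11 g) (c * m12 g) (c * m21 g) (c * m22 g))"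
  define \<phi> where "\<phi> = (\<lambda>(c, g). mred (sc c g))"
  have "odd p" using prime_p p3 prime_odd_nat [of p] by auto
  then have m: "2 * m = p - 1" using p3 unfolding m_def by (auto elim: oddE)
  have per: "periodic F" and Fc: "\<And>c v. \<not> P dvd c \<Longrightarrow> F (smul c v) = F v"
    using F by (auto simp: isotropic_def)
  have range: "\<not> P dvd c" if "c \<in> {1..int m}" for c
    using that m p3 by (auto dest: zdvd_imp_le)
  have cor: "cor (\<phi> (c, g)) = cor g" if "c \<in> {1..int m}" for c g
  proof -
    have "F (act (mred (sc c g)) v) = F (act g v)" for v
    proof -
      have "vcong (act (mred (sc c g)) v) (act (sc c g) v)" by (intro vcong_act) auto
      then have "F (act (mred (sc c g)) v) = F (act (sc c g) v)" by (rule periodicD [OF per])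
      also have "act (sc c g) v = smul c (act g v)" by (simp add: sc_def act_def smul_def algebra_simps)
      finally show ?thesis using Fc [OF range [OF that]] by simp
    qed
    then show ?thesis by (simp add: cor_def \<phi>_def)
  qed
  have inj: "inj_on \<phi> ({1..int m} \<times> sl)"
  proof (rule inj_onI)
    fix x y assume x: "x \<in> {1..int m} \<times> sl" and y: "y \<in> {1..int m} \<times> sl" and e: "\<phi> x = \<phi> y"
    obtain c g d h where xy: "x = (c, g)" "y = (d, h)" by (metis surj_pair)
    have cd: "c \<in> {1..int m}" "d \<in> {1..int m}" "g \<in> sl" "h \<in> sl" using x y xy by auto
    have mc: "mcong P (sc c g) (sc d h)" using e xy by (simp add: \<phi>_def mcong_iff_mred)
    have det: "mdet (sc c g) = c\<^sup>2 * mdet g" for c g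
      by (simp add: sc_def mdet_def power2_eq_square algebra_simps)
    have "[c\<^sup>2 * mdet g = d\<^sup>2 * mdet h] (mod P)" using mdet_mcong [OF mc] by (simp add: det)
    moreover have "[c\<^sup>2 * mdet g = c\<^sup>2 * 1] (mod P)" "[d\<^sup>2 * mdet h = d\<^sup>2 * 1] (mod P)"
      using cd by (intro cong_mult cong_refl; simp add: sl_def)+
    ultimately have "[c\<^sup>2 = d\<^sup>2] (mod P)" by (simp add: cong_def)
    then have "P dvd c\<^sup>2 - d\<^sup>2" by (simp add: cong_iff_dvd_diff)
    then have "P dvd (c - d) * (c + d)" by (simp add: power2_eq_square algebra_simps)
    then have "P dvd c - d \<or> P dvd c + d" using prime_P prime_dvd_mult_iff by blast
    moreover have "\<not> P dvd c + d" using cd m p3 by (auto dest!: zdvd_imp_le)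
    ultimately have "P dvd c - d" by blast
    then have cd': "c = d" using cd m p3 dvd_imp_le_int [of "c - d" P] by (cases "c = d") auto
    have cancel: "[a = b] (mod P)" if "[c * a = c * b] (mod P)" for a b
    proof -
      have "P dvd c * (a - b)" using that by (simp add: cong_iff_dvd_diff right_diff_distrib)
      then show ?thesis using range [OF cd(1)] prime_P by (simp add: prime_dvd_mult_iff cong_iff_dvd_diff)
    qed
    have "mcong P g h" using mc cancel unfolding mcong_def sc_def cd' [symmetric] by simp
    then have "g = h" using cd by (metis (no_types, lifting) mcong_iff_mred mred_mats mem_Collect_eq sl_def)
    then show "x = y" using cd' xy by simp
  qed
  have "real m * (\<Sum>g\<in>sl. cor g) = (\<Sum>c\<in>{1..int m}. \<Sum>g\<in>sl. cor g)" by simp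
  also have "\<dots> = (\<Sum>(c, g)\<in>{1..int m} \<times> sl. cor g)" by (rule sum.cartesian_product)
  also have "\<dots> = (\<Sum>x\<in>{1..int m} \<times> sl. cor (\<phi> x))" using cor by (intro sum.cong) auto
  also have "\<dots> = (\<Sum>g\<in>\<phi> ` ({1..int m} \<times> sl). cor g)" by (simp add: sum.reindex [OF inj])
  also have "\<dots> \<le> (\<Sum>g\<in>mats. cor g)"
    using mred_in_mats by (intro sum_mono2) (auto simp: \<phi>_def cor_def)
  also have "\<dots> \<le> real (p - 1) * (real p)\<^sup>2 * (ip F F)\<^sup>2"
    unfolding cor_def by (rule sum_mats_correlation [OF F mean])
  \<comment> \<open>Cancelling \<open>m\<close> leaves 2 p^2. Since \<open>sl\<close> has about p^3
    elements, a squared correlation is on average smaller than the trivial bound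
    \<open>(ip F F)\<^sup>2\<close> by a factor of order p; this is the gain from the large
    dimension of nontrivial representations.\<close>
  also have "\<dots> = real m * (2 * (real p)\<^sup>2 * (ip F F)\<^sup>2)" unfolding m [symmetric] by simp
  finally have le: "real m * (\<Sum>g\<in>sl. cor g) \<le> real m * (2 * (real p)\<^sup>2 * (ip F F)\<^sup>2)" .
  have "real m > 0" using m p3 by simp
  then show ?thesis using le unfolding cor_def by (rule mult_left_le_imp_le [rotated])
qed

end

section \<open>The averaging operator\<close>

locale averaging = mat_ball \<rho> L + prime_modulus p
  for \<rho> :: real and L :: nat and p :: nat +
  fixes A :: "mat2 set"
  assumes A_sub: "A \<subseteq> B"
begin

lemma finite_A: "finite A"
  using A_sub finite_B finite_subset by blast

lemma mdet_A: "g \<in> A \<Longrightarrow> mdet g = 1"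
  using A_sub by (auto simp: B_def)

definition T :: "(int \<times> int \<Rightarrow> real) \<Rightarrow> int \<times> int \<Rightarrow> real" where
  "T F v = (\<Sum>g\<in>A. F (act (adj g) v))"

text \<open>This is \<open>T\<close> followed by its adjoint. It is self-adjoint and positive
  although \<open>A\<close> need not be closed under inverses.\<close>

definition S :: "(int \<times> int \<Rightarrow> real) \<Rightarrow> int \<times> int \<Rightarrow> real" where
  "S F v = (\<Sum>(g, h)\<in>A \<times> A. F (act (adj g * h) v))"

lemma periodic_S: "periodic F \<Longrightarrow> periodic (S F)"
  unfolding S_def periodic_def [of "\<lambda>v. \<Sum>(g, h)\<in>A \<times> A. F (act (adj g * h) v)"]
  by (intro allI impI sum.cong refl) (auto intro!: periodicD [of F] vcong_act)

lemma periodic_S_funpow: "periodic F \<Longrightarrow> periodic ((S ^^ k) F)"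
  by (induction k) (auto intro: periodic_S)

lemma ip_sum_left: "ip (\<lambda>v. \<Sum>i\<in>I. f i v) G = (\<Sum>i\<in>I. ip (f i) G)"
  unfolding ip_def sum_distrib_right by (rule sum.swap)

lemma ip_sum_right: "ip G (\<lambda>v. \<Sum>i\<in>I. f i v) = (\<Sum>i\<in>I. ip G (f i))"
  using ip_sum_left [of f I G] by (simp add: ip_commute)

lemma S_eq: "S F = (\<lambda>v. \<Sum>z\<in>A \<times> A. F (act (adj (fst z) * snd z) v))"
  by (simp add: S_def case_prod_unfold fun_eq_iff)

lemma ip_T_T:
  assumes "periodic F"
  shows "ip (T F) (T F) = ip (S F) F"
proof -
  have "ip (T F) (T F) = (\<Sum>h\<in>A. \<Sum>g\<in>A. ip (\<lambda>v. F (act (adj h) v)) (\<lambda>v. F (act (adj g) v)))"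
    unfolding T_def ip_sum_left ip_sum_right ..
  also have "\<dots> = (\<Sum>h\<in>A. \<Sum>g\<in>A. ip F (\<lambda>v. F (act (adj g * h) v)))"
  proof (intro sum.cong refl)
    fix h g assume "h \<in> A" "g \<in> A"
    then have "ip (\<lambda>v. F (act (adj h) v)) (\<lambda>v. F (act (adj g) v)) = ip F (\<lambda>v. F (act (adj g) (act (adj (adj h)) v)))"
      using assms mdet_A by (intro ip_act_adjoint periodic_act) auto
    then show "ip (\<lambda>v. F (act (adj h) v)) (\<lambda>v. F (act (adj g) v)) = ip F (\<lambda>v. F (act (adj g * h) v))"
      by (simp add: act_mult)
  qed
  also have "\<dots> = (\<Sum>z\<in>A \<times> A. ip (\<lambda>v. F (act (adj (fst z) * snd z) v)) F)"
    by (subst sum.swap) (simp add: sum.cartesian_product case_prod_unfold ip_commute)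
  also have "\<dots> = ip (S F) F" unfolding S_eq ip_sum_left ..
  finally show ?thesis .
qed

lemma S_selfadjoint:
  assumes "periodic F" "periodic G"
  shows "ip (S F) G = ip F (S G)"
proof -
  have "ip (S F) G = (\<Sum>z\<in>A \<times> A. ip (\<lambda>v. F (act (adj (fst z) * snd z) v)) G)"
    unfolding S_eq ip_sum_left ..
  also have "\<dots> = (\<Sum>z\<in>A \<times> A. ip F (\<lambda>v. G (act (adj (adj (fst z) * snd z)) v)))"
    using assms mdet_A by (intro sum.cong refl ip_act_adjoint) (auto simp: mdet_mult)
  also have "\<dots> = (\<Sum>z\<in>A \<times> A. ip F (\<lambda>v. G (act (adj (fst z) * snd z) v)))"
    by (rule sum.reindex_bij_witness [of _ prod.swap prod.swap]) (auto simp: adj_mult)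
  also have "\<dots> = ip F (S G)" unfolding S_eq ip_sum_right ..
  finally show ?thesis .
qed

lemma S_funpow_selfadjoint:
  assumes "periodic F" "periodic G"
  shows "ip ((S ^^ k) F) G = ip F ((S ^^ k) G)"
  using assms
proof (induction k arbitrary: G)
  case (Suc k)
  have "ip ((S ^^ Suc k) F) G = ip ((S ^^ k) F) (S G)"
    using S_selfadjoint [OF periodic_S_funpow [OF Suc.prems(1)] Suc.prems(2)] by simp
  also have "\<dots> = ip F ((S ^^ Suc k) G)"
    using Suc.IH [OF Suc.prems(1) periodic_S [OF Suc.prems(2)]] by (simp add: funpow_swap1)
  finally show ?case .
qed simp

text \<open>Self-adjointness and Cauchy-Schwarz bound the square of \<open>ip ((S ^^ k) F) F\<close>
  by \<open>ip ((S ^^ (2 * k)) F) F * ip F F\<close>. Iterating this replaces a diagonalisation of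
  \<open>S\<close> and explains the restriction to powers of two.\<close>

lemma ip_S_power_le:
  assumes "periodic F"
  shows "(ip (S F) F) ^ (2 ^ j) \<le> (ip F F) ^ (2 ^ j - 1) * ip ((S ^^ (2 ^ j)) F) F"
proof (induction j)
  case (Suc j)
  let ?N = "ip F F" and ?b = "\<lambda>k. ip ((S ^^ k) F) F"
  have b1: "0 \<le> ip (S F) F" using ip_T_T [OF assms] ip_self_nonneg by metis
  have sq: "(?b k)\<^sup>2 \<le> ?b (2 * k) * ?N" for k
  proof -
    have "(?b k)\<^sup>2 \<le> ip ((S ^^ k) F) ((S ^^ k) F) * ?N" by (rule ip_Cauchy_Schwarz)
    also have "ip ((S ^^ k) F) ((S ^^ k) F) = ip F ((S ^^ k) ((S ^^ k) F))"
      using assms by (intro S_funpow_selfadjoint periodic_S_funpow)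
    also have "\<dots> = ?b (2 * k)" by (simp add: ip_commute mult_2 funpow_add)
    finally show ?thesis .
  qed
  have e: "(2::nat) ^ Suc j - 1 = 2 * (2 ^ j - 1) + 1"
  proof -
    have "(1::nat) \<le> 2 ^ j" by simp
    then show ?thesis unfolding power_Suc by linarith
  qed
  have "(ip (S F) F) ^ (2 ^ Suc j) = ((ip (S F) F) ^ (2 ^ j))\<^sup>2"
    by (simp add: power_mult [symmetric] mult.commute)
  also have "\<dots> \<le> (?N ^ (2 ^ j - 1) * ?b (2 ^ j))\<^sup>2"
    using Suc b1 by (intro power_mono) auto
  also have "\<dots> = ?N ^ (2 * (2 ^ j - 1)) * (?b (2 ^ j))\<^sup>2"
    by (simp add: power_mult_distrib power_mult [symmetric] mult.commute)
  also have "\<dots> \<le> ?N ^ (2 * (2 ^ j - 1)) * (?b (2 * 2 ^ j) * ?N)"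
    using sq ip_self_nonneg by (intro mult_left_mono) auto
  also have "\<dots> = ?N ^ (2 ^ Suc j - 1) * ?b (2 ^ Suc j)"
    unfolding e by simp
  finally show ?case .
qed simp

lemma S_funpow_eq:
  "(S ^^ n) F v = (\<Sum>ws\<in>lists_of n (A \<times> A). F (act (pword ws) v))"
proof (induction n arbitrary: F)
  case 0
  then show ?case by (simp add: pword_def)
next
  case (Suc n)
  have "(S ^^ Suc n) F v = (\<Sum>ws\<in>lists_of n (A \<times> A). S F (act (pword ws) v))"
    by (simp only: funpow_Suc_right o_apply Suc.IH)
  also have "\<dots> = (\<Sum>ws\<in>lists_of n (A \<times> A). \<Sum>z\<in>A \<times> A. F (act (pword (z # ws)) v))"
    unfolding S_def
    by (intro sum.cong refl) (auto simp: pword_def act_mult mult.assoc)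
  also have "\<dots> = (\<Sum>(z, ws)\<in>(A \<times> A) \<times> lists_of n (A \<times> A). F (act (pword (z # ws)) v))"
    by (subst sum.swap) (simp add: sum.cartesian_product)
  also have "\<dots> = (\<Sum>ws\<in>lists_of (Suc n) (A \<times> A). F (act (pword ws) v))"
    unfolding lists_of_Suc
    by (subst sum.reindex) (auto simp: inj_on_def case_prod_unfold intro!: sum.cong)
  finally show ?case .
qed

definition E :: "nat \<Rightarrow> real" where
  "E n = (\<Sum>\<gamma>\<in>principal_ball P ((2 * \<rho>) ^ (4 * n)). 1 / mnorm \<gamma>)"

text \<open>Words are grouped by their reduction in \<open>sl\<close>. Cauchy-Schwarz then separates
  the multiplicities, whose squares add up to the number of coincidences, from the correlations,
  which Schur orthogonality controls.\<close>

lemma ip_S_funpow_bound: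
  assumes F: "isotropic F" and mean: "(\<Sum>v\<in>box. F v) = 0"
  shows "(ip ((S ^^ n) F) F)\<^sup>2 \<le> K ^ (4 * n) * E n * (2 * (real p)\<^sup>2 * (ip F F)\<^sup>2)"
proof -
  have per: "periodic F" using F by (simp add: isotropic_def)
  let ?W = "lists_of n (A \<times> A)"
  let ?f = "\<lambda>ws. mred (pword ws)"
  define c where "c = (\<lambda>g. ip (\<lambda>v. F (act g v)) F)"
  define m where "m = (\<lambda>g. real (card {ws \<in> ?W. ?f ws = g}))"
  have finW: "finite ?W" by (simp add: finite_lists_of finite_A)
  have fin_sl: "?f ws \<in> sl" if "ws \<in> ?W" for ws
  proof (rule mred_in_sl)
    have "set (letters ws) \<subseteq> B" if "set ws \<subseteq> A \<times> A" for ws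
      using that by (induction ws rule: letters.induct) (use A_sub adj_in_B in auto)
    then show "mdet (pword ws) = 1"
      unfolding pword_def using that by (intro mdet_prod_list) (auto simp: lists_of_def B_def)
  qed
  have grp: "(\<Sum>ws\<in>?W. q (?f ws)) = (\<Sum>g\<in>sl. m g * q g)" for q :: "mat2 \<Rightarrow> real"
  proof -
    have "(\<Sum>ws\<in>?W. q (?f ws)) = (\<Sum>g\<in>sl. \<Sum>ws\<in>{ws \<in> ?W. ?f ws = g}. q (?f ws))"
      using finW fin_sl by (intro sum.group [symmetric]) auto
    also have "\<dots> = (\<Sum>g\<in>sl. m g * q g)" by (intro sum.cong refl) (simp add: m_def)
    finally show ?thesis .
  qed
  have "ip ((S ^^ n) F) F = (\<Sum>ws\<in>?W. c (pword ws))"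
  proof -
    have "(S ^^ n) F = (\<lambda>v. \<Sum>ws\<in>?W. F (act (pword ws) v))" using S_funpow_eq by (intro ext)
    then show ?thesis by (simp only: ip_sum_left c_def)
  qed
  also have "\<dots> = (\<Sum>ws\<in>?W. c (?f ws))"
  proof (intro sum.cong refl)
    fix ws
    have "F (act (pword ws) v) = F (act (?f ws) v)" for v
      by (intro periodicD [OF per] vcong_sym [OF vcong_act]) auto
    then show "c (pword ws) = c (?f ws)" by (simp add: c_def)
  qed
  also have "\<dots> = (\<Sum>g\<in>sl. m g * c g)" by (rule grp)
  finally have "(ip ((S ^^ n) F) F)\<^sup>2 = (\<Sum>g\<in>sl. m g * c g)\<^sup>2" by simp
  also have "\<dots> \<le> (\<Sum>g\<in>sl. (m g)\<^sup>2) * (\<Sum>g\<in>sl. (c g)\<^sup>2)"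
    by (rule Cauchy_Schwarz_ineq_sum)
  also have "\<dots> \<le> (K ^ (4 * n) * E n) * (2 * (real p)\<^sup>2 * (ip F F)\<^sup>2)"
  proof (rule mult_mono)
    show "(\<Sum>g\<in>sl. (c g)\<^sup>2) \<le> 2 * (real p)\<^sup>2 * (ip F F)\<^sup>2"
      unfolding c_def by (rule sum_sl_correlation [OF F mean])
    have "(\<Sum>g\<in>sl. (m g)\<^sup>2) = (\<Sum>g\<in>sl. m g * m g)" by (simp add: power2_eq_square)
    also have "\<dots> = (\<Sum>ws\<in>?W. m (?f ws))" by (rule grp [symmetric])
    also have "\<dots> = real (\<Sum>ws\<in>?W. card {ws' \<in> ?W. ?f ws' = ?f ws})" by (simp add: m_def)
    also have "(\<Sum>ws\<in>?W. card {ws' \<in> ?W. ?f ws' = ?f ws}) = card (SIGMA ws:?W. {ws' \<in> ?W. ?f ws' = ?f ws})"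
      using finW by (subst card_SigmaI) auto
    also have "(SIGMA ws:?W. {ws' \<in> ?W. ?f ws' = ?f ws})
        = {(ws, ws') \<in> ?W \<times> ?W. mcong P (pword ws) (pword ws')}"
      by (auto simp: mcong_iff_mred)
    also have "real (card \<dots>) \<le> K ^ (4 * n) * E n"
      unfolding E_def by (rule card_pword_collisions [OF A_sub])
    finally show m: "(\<Sum>g\<in>sl. (m g)\<^sup>2) \<le> K ^ (4 * n) * E n" .
    show "0 \<le> K ^ (4 * n) * E n"
      using m by (rule order_trans [rotated]) (simp add: sum_nonneg)
  qed (simp add: sum_nonneg)
  finally show ?thesis .
qed

text \<open>The exponent is a product: 2 for passing from \<open>T\<close> to \<open>S\<close>,
  \<open>n\<close> for the power of \<open>S\<close>, and 2 because the bound for that power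
  concerns a square.\<close>

lemma ip_T_bound:
  assumes F: "isotropic F" and mean: "(\<Sum>v\<in>box. F v) = 0" and n: "n = 2 ^ j"
  shows "(ip G (T F)) ^ (4 * n) \<le> (ip G G * ip F F) ^ (2 * n) * (K ^ (4 * n) * E n * (2 * (real p)\<^sup>2))"
proof -
  have per: "periodic F" using F by (simp add: isotropic_def)
  let ?N = "ip F F" and ?b = "ip ((S ^^ n) F) F"
  have n1: "n \<ge> 1" using n by simp
  have TT: "0 \<le> ip (T F) (T F)" by (rule ip_self_nonneg)
  have "(ip (T F) (T F)) ^ (2 * n) = ((ip (T F) (T F)) ^ n)\<^sup>2" by (simp add: power_mult [symmetric] mult.commute)
  also have "\<dots> \<le> (?N ^ (n - 1) * ?b)\<^sup>2"
    using ip_S_power_le [OF per, of j] TT unfolding ip_T_T [OF per] n by (intro power_mono) auto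
  also have "\<dots> = ?N ^ (2 * (n - 1)) * ?b\<^sup>2"
    by (simp add: power_mult_distrib power_mult [symmetric] mult.commute)
  also have "\<dots> \<le> ?N ^ (2 * (n - 1)) * (K ^ (4 * n) * E n * (2 * (real p)\<^sup>2 * ?N\<^sup>2))"
    using ip_S_funpow_bound [OF F mean] ip_self_nonneg by (intro mult_left_mono) auto
  also have "\<dots> = ?N ^ (2 * (n - 1) + 2) * (K ^ (4 * n) * E n * (2 * (real p)\<^sup>2))"
    by (simp only: power_add ac_simps)
  also have "2 * (n - 1) + 2 = 2 * n" using n1 by simp
  finally have T: "(ip (T F) (T F)) ^ (2 * n) \<le> ?N ^ (2 * n) * (K ^ (4 * n) * E n * (2 * (real p)\<^sup>2))" .
  have "(ip G (T F)) ^ (4 * n) = ((ip G (T F))\<^sup>2) ^ (2 * n)" by (simp add: power_mult [symmetric])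
  also have "\<dots> \<le> (ip G G * ip (T F) (T F)) ^ (2 * n)"
    by (intro power_mono ip_Cauchy_Schwarz) auto
  also have "\<dots> = ip G G ^ (2 * n) * (ip (T F) (T F)) ^ (2 * n)" by (rule power_mult_distrib)
  also have "\<dots> \<le> ip G G ^ (2 * n) * (?N ^ (2 * n) * (K ^ (4 * n) * E n * (2 * (real p)\<^sup>2)))"
    using T ip_self_nonneg by (intro mult_left_mono) auto
  finally show ?thesis by (simp only: power_mult_distrib mult.assoc)
qed

end

section \<open>Continued fractions and the supply of words with bounded digits\<close>

section \<open>Continuants\<close>

definition wmat :: "nat list \<Rightarrow> mat2" where
  "wmat w = prod_list (map (\<lambda>b. Mat2 (int b) 1 1 0) w)"

text \<open>Denominator first, numerator second, of [0; w]; together they form the first column of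
  \<open>wmat w\<close>. The empty word stands for 0/1.\<close>

fun cont :: "nat list \<Rightarrow> nat \<times> nat" where
  "cont [] = (1, 0)"
| "cont (b # w) = (b * fst (cont w) + snd (cont w), fst (cont w))"

lemma wmat_Nil [simp]: "wmat [] = 1"
  by (simp add: wmat_def)

lemma wmat_Cons: "wmat (b # w) = Mat2 (int b) 1 1 0 * wmat w"
  by (simp add: wmat_def)

lemma wmat_append: "wmat (u @ v) = wmat u * wmat v"
  by (simp add: wmat_def)

lemma wmat_concat: "wmat (concat ws) = prod_list (map wmat ws)"
  by (induction ws) (auto simp: wmat_append)

lemma mdet_wmat: "mdet (wmat w) = (-1) ^ length w"
proof (induction w)
  case (Cons b w)
  have "mdet (Mat2 (int b) 1 1 0) = -1" by (simp add: mdet_def)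
  then show ?case using Cons by (simp add: wmat_Cons mdet_mult)
qed simp

text \<open>The factors are symmetric matrices, so reversing the word transposes the
  product.\<close>

lemma wmat_rev:
  "wmat (rev w) = Mat2 (m11 (wmat w)) (m21 (wmat w)) (m12 (wmat w)) (m22 (wmat w))"
  by (induction w) (simp_all add: wmat_append wmat_Cons one_mat2_def times_mat2_def algebra_simps)

lemma cont_wmat: "m11 (wmat w) = int (fst (cont w))" "m21 (wmat w) = int (snd (cont w))"
  by (induction w) (auto simp: wmat_Cons one_mat2_def times_mat2_def)

lemma wmat_entries:
  assumes "w \<noteq> []" "\<And>b. b \<in> set w \<Longrightarrow> 1 \<le> b"
  shows "0 \<le> m12 (wmat w) \<and> m12 (wmat w) \<le> m11 (wmat w) \<and> 0 \<le> m22 (wmat w)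
    \<and> m22 (wmat w) \<le> m21 (wmat w) \<and> m21 (wmat w) \<le> m11 (wmat w)"
  using assms
proof (induction w rule: list_nonempty_induct)
  case (single b)
  then show ?case by (simp add: wmat_def one_mat2_def)
next
  case (cons b w)
  have IH: "0 \<le> m12 (wmat w)" "m12 (wmat w) \<le> m11 (wmat w)" "0 \<le> m22 (wmat w)"
    "m22 (wmat w) \<le> m21 (wmat w)" "m21 (wmat w) \<le> m11 (wmat w)"
    using cons.IH cons.prems by simp_all
  have b: "1 \<le> int b" using cons.prems by simp
  have "int b * m12 (wmat w) \<le> int b * m11 (wmat w)" using IH by (intro mult_left_mono) auto
  moreover have "1 * m11 (wmat w) \<le> int b * m11 (wmat w)" using IH b by (intro mult_right_mono) auto
  ultimately show ?case using IH by (auto simp: wmat_Cons times_mat2_def)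
qed

lemma mnorm_wmat:
  assumes "w \<noteq> []" "\<And>b. b \<in> set w \<Longrightarrow> 1 \<le> b"
  shows "mnorm (wmat w) \<le> int (fst (cont w))"
proof -
  have "0 \<le> m12 (wmat w) \<and> m12 (wmat w) \<le> m11 (wmat w) \<and> 0 \<le> m22 (wmat w)
    \<and> m22 (wmat w) \<le> m21 (wmat w) \<and> m21 (wmat w) \<le> m11 (wmat w)"
    by (rule wmat_entries) (use assms in auto)
  then show ?thesis unfolding cont_wmat(1) [symmetric] mnorm_le_iff by linarith
qed

declare partial_quotients.simps [simp del]

text \<open>A last digit of at least 2 keeps the numerator strictly below the denominator at every
  stage, so that Euclidean division recovers exactly the digits that were put in.\<close>

lemma partial_quotients_cont:
  assumes "w \<noteq> []" "\<And>b. b \<in> set w \<Longrightarrow> 1 \<le> b" "2 \<le> last w"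
  shows "0 < snd (cont w) \<and> snd (cont w) < fst (cont w)
    \<and> partial_quotients (snd (cont w)) (fst (cont w)) = w"
  using assms
proof (induction w rule: list_nonempty_induct)
  case (single b)
  have "partial_quotients 0 1 = []" by (simp add: partial_quotients.simps)
  then show ?case using single by (simp add: partial_quotients.simps [of "Suc 0"])
next
  case (cons b w)
  obtain q a where qa: "cont w = (q, a)" by (cases "cont w")
  have IH: "0 < a" "a < q" "partial_quotients a q = w" using cons qa by auto
  have "1 * q \<le> b * q" using cons.prems by (intro mult_right_mono) auto
  then have "q < b * q + a" using IH by linarith
  moreover have "partial_quotients q (b * q + a) = b # w"
    using IH by (subst partial_quotients.simps) simp
  ultimately show ?case using IH qa by simp
qed

lemma cont_partial_quotients:
  assumes "coprime a q" "a < q"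
  shows "cont (partial_quotients a q) = (q, a) \<and> (\<forall>b\<in>set (partial_quotients a q). 1 \<le> b \<and> b \<le> q)"
  using assms
proof (induction a q rule: partial_quotients.induct)
  case (1 a q)
  show ?case
  proof (cases "a = 0")
    case True
    then show ?thesis using 1 by (simp add: partial_quotients.simps)
  next
    case False
    have cop: "coprime (q mod a) a" using 1(2) False by (simp add: coprime_commute)
    have IH: "cont (partial_quotients (q mod a) a) = (a, q mod a)"
      "\<And>b. b \<in> set (partial_quotients (q mod a) a) \<Longrightarrow> 1 \<le> b \<and> b \<le> a"
      using 1(1) [OF False cop] False by auto
    have pq: "partial_quotients a q = (q div a) # partial_quotients (q mod a) a"
      using False by (simp add: partial_quotients.simps [of a])
    have "1 \<le> q div a" using 1(3) False by (simp add: Suc_le_eq div_greater_zero_iff)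
    moreover have "q div a \<le> q" by simp
    ultimately show ?thesis using IH 1(3) by (fastforce simp: pq)
  qed
qed

text \<open>Two further digits at least double the denominator. Hence fractions of denominator at
  most \<open>2 ^ t\<close> have only about 2 t possible lengths, which a pigeonhole argument can
  afford.\<close>

lemma two_power_le_cont:
  assumes "\<And>b. b \<in> set w \<Longrightarrow> 1 \<le> b"
  shows "2 ^ (length w div 2) \<le> fst (cont w)"
  using assms
proof (induction w rule: induct_list012)
  case (2 b)
  then show ?case by simp
next
  case (3 b c w)
  let ?q = "fst (cont w)"
  have "2 ^ (length w div 2) \<le> ?q" using 3 by simp
  moreover have "?q \<le> b * (c * ?q)"
  proof -
    have "1 * (1 * ?q) \<le> b * (c * ?q)" using 3(3) by (intro mult_le_mono) auto
    then show ?thesis by (simp only: mult_1)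
  qed
  moreover have "fst (cont (b # c # w)) = b * (c * ?q) + b * snd (cont w) + ?q"
    by (simp add: algebra_simps)
  moreover have "(2::nat) ^ (length (b # c # w) div 2) = 2 * 2 ^ (length w div 2)" by simp
  ultimately show ?case by linarith
qed simp

section \<open>Coprime pairs\<close>

lemma sum_inverse_squares_le:
  "2 \<le> Q \<Longrightarrow> (\<Sum>d\<in>{2..Q}. 1 / (real d)\<^sup>2) \<le> 3/4 - 1 / real Q"
proof (induction Q rule: dec_induct)
  case base
  then show ?case by simp
next
  case (step n)
  have n: "0 < real n" using step.hyps by simp
  have "1 / (real (Suc n))\<^sup>2 \<le> 1 / (real n * real (Suc n))"
    using n by (intro divide_left_mono) (auto simp: power2_eq_square)
  also have "\<dots> = 1 / real n - 1 / real (Suc n)" using n by (simp add: field_simps)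
  finally show ?case using step by simp
qed

lemma card_multiples: "card {x \<in> {1..Q}. d dvd x} \<le> Q div (d::nat)"
proof (cases "d = 0")
  case False
  have "{x \<in> {1..Q}. d dvd x} \<subseteq> (\<lambda>k. d * k) ` {1..Q div d}"
  proof
    fix x assume "x \<in> {x \<in> {1..Q}. d dvd x}"
    then obtain k where k: "x = d * k" "1 \<le> x" "x \<le> Q" by auto
    then have "k \<le> Q div d" using False
      by (metis div_le_mono nonzero_mult_div_cancel_left)
    moreover have "1 \<le> k" using k by (cases k) auto
    ultimately show "x \<in> (\<lambda>k. d * k) ` {1..Q div d}" using k by auto
  qed
  then have "card {x \<in> {1..Q}. d dvd x} \<le> card {1..Q div d}"
    by (intro surj_card_le) auto
  then show ?thesis by simp
qed auto

definition coprime_pairs :: "nat \<Rightarrow> (nat \<times> nat) set" where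
  "coprime_pairs Q = {(a, q). 1 \<le> a \<and> a < q \<and> q \<le> Q \<and> coprime a q}"

lemma finite_coprime_pairs: "finite (coprime_pairs Q)"
  by (rule finite_subset [of _ "{..Q} \<times> {..Q}"]) (auto simp: coprime_pairs_def)

text \<open>A union bound over all common divisors from 2 on suffices, since the sum of their
  inverse squares is at most 3/4. The remaining quarter of the square consists of the pairs, their
  mirror images and (1, 1).\<close>

lemma card_coprime_pairs:
  assumes "Q \<ge> 4"
  shows "(real Q)\<^sup>2 / 16 \<le> real (card (coprime_pairs Q))"
proof -
  let ?I = "{1..Q}"
  let ?C = "coprime_pairs Q"
  let ?D = "\<lambda>d. {x \<in> ?I. d dvd x} \<times> {x \<in> ?I. d dvd x}"
  have "?I \<times> ?I \<subseteq> (\<Union>d\<in>{2..Q}. ?D d) \<union> (?C \<union> prod.swap ` ?C \<union> {(1, 1)})" (is "_ \<subseteq> ?R")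
  proof
    fix z assume z: "z \<in> ?I \<times> ?I"
    obtain x y where xy: "z = (x, y)" by (cases z)
    show "z \<in> ?R"
    proof (cases "coprime x y")
      case True
      consider "x < y" | "y < x" | "x = y" by linarith
      then show ?thesis
      proof cases
        case 1
        then have "z \<in> ?C" using z True by (auto simp: xy coprime_pairs_def)
        then show ?thesis by blast
      next
        case 2
        then have "(y, x) \<in> ?C" using z True by (auto simp: xy coprime_pairs_def coprime_commute)
        then have "z \<in> prod.swap ` ?C" unfolding xy by (rule rev_image_eqI) simp
        then show ?thesis by blast
      next
        case 3
        then have "z = (1, 1)" using True by (auto simp: xy)
        then show ?thesis by blast
      qed
    next
      case False
      define d where "d = gcd x y"
      have "d \<noteq> 1" using False unfolding d_def coprime_iff_gcd_eq_1 .
      moreover have "d \<noteq> 0" using z by (auto simp: d_def xy)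
      moreover have "d \<le> Q"
      proof -
        have "x > 0" "x \<le> Q" using z by (auto simp: xy)
        moreover have "d \<le> x" unfolding d_def using \<open>x > 0\<close> by (intro dvd_imp_le) auto
        ultimately show ?thesis by linarith
      qed
      ultimately have "d \<in> {2..Q}" by auto
      moreover have "z \<in> ?D d" using z by (auto simp: xy d_def)
      ultimately show ?thesis by blast
    qed
  qed
  then have "card (?I \<times> ?I) \<le> card ?R"
    using finite_coprime_pairs by (intro card_mono) auto
  also have "\<dots> \<le> card (\<Union>d\<in>{2..Q}. ?D d) + card (?C \<union> prod.swap ` ?C \<union> {(1, 1)})"
    by (rule card_Un_le)
  also have "card (?C \<union> prod.swap ` ?C \<union> {(1, 1)}) \<le> card (?C \<union> prod.swap ` ?C) + card {(1::nat, 1::nat)}"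
    by (rule card_Un_le)
  also have "card (?C \<union> prod.swap ` ?C) \<le> card ?C + card (prod.swap ` ?C)"
    by (rule card_Un_le)
  also have "card (prod.swap ` ?C) = card ?C"
    by (intro card_image) auto
  also have "card (\<Union>d\<in>{2..Q}. ?D d) \<le> (\<Sum>d\<in>{2..Q}. card (?D d))"
    by (rule card_UN_le) simp
  finally have "Q * Q \<le> (\<Sum>d\<in>{2..Q}. card (?D d)) + (card ?C + card ?C + 1)"
    by (simp add: card_cartesian_product)
  then have "real (Q * Q) \<le> real ((\<Sum>d\<in>{2..Q}. card (?D d)) + (card ?C + card ?C + 1))"
    by (rule of_nat_mono)
  then have 1: "real Q * real Q \<le> (\<Sum>d\<in>{2..Q}. real (card (?D d))) + (2 * real (card ?C) + 1)"
    by simp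
  have "(\<Sum>d\<in>{2..Q}. real (card (?D d))) \<le> (\<Sum>d\<in>{2..Q}. (real Q)\<^sup>2 * (1 / (real d)\<^sup>2))"
  proof (rule sum_mono)
    fix d assume "d \<in> {2..Q}"
    have c: "real (card {x \<in> ?I. d dvd x}) \<le> real Q / real d"
      using card_multiples [of Q d] of_nat_mono [OF card_multiples [of Q d], where 'a = real]
        of_nat_div_le_of_nat [of Q d, where 'a = real] by linarith
    have "real (card (?D d)) = real (card {x \<in> ?I. d dvd x}) * real (card {x \<in> ?I. d dvd x})"
      by (simp add: card_cartesian_product)
    also have "\<dots> \<le> (real Q / real d) * (real Q / real d)" using c by (intro mult_mono) auto
    finally show "real (card (?D d)) \<le> (real Q)\<^sup>2 * (1 / (real d)\<^sup>2)"
      by (simp add: power2_eq_square)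
  qed
  also have "\<dots> = (real Q)\<^sup>2 * (\<Sum>d\<in>{2..Q}. 1 / (real d)\<^sup>2)" by (simp add: sum_distrib_left)
  also have "\<dots> \<le> (real Q)\<^sup>2 * (3/4)"
  proof (intro mult_left_mono)
    have "0 \<le> 1 / real Q" by simp
    then show "(\<Sum>d\<in>{2..Q}. 1 / (real d)\<^sup>2) \<le> 3 / 4"
      using sum_inverse_squares_le [of Q] assms by linarith
  qed simp
  finally have "(real Q)\<^sup>2 / 4 \<le> 2 * real (card ?C) + 1" using 1 by (simp add: power2_eq_square)
  moreover have "8 \<le> (real Q)\<^sup>2" using assms power_mono [of 4 "real Q" 2] by simp
  ultimately show ?thesis by simp
qed

section \<open>Many words of bounded digits\<close>

text \<open>The expansions of all fractions with denominator at most \<open>2 ^ t\<close> serve as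
  blocks: there are about 4^t of them. A common length makes concatenations decodable and costs a
  factor linear in \<open>t\<close>, outweighed by the \<open>\<eta>\<close> in the exponent once
  \<open>t\<close> is large. This \<open>t\<close> is the source of the final digit bound.\<close>

lemma exists_block:
  fixes \<eta> :: real
  assumes "0 < \<eta>"
  shows "\<exists>t l Bl. finite Bl \<and> (\<forall>w\<in>Bl. length w = l \<and> (\<forall>b\<in>set w. 1 \<le> b \<and> b \<le> 2 ^ t)
      \<and> mnorm (wmat w) \<le> 2 ^ t) \<and> (2 ^ (t + 1)) powr (2 - \<eta>) \<le> real (card Bl)"
proof -
  \<comment> \<open>128 (t + 1) = 4 * 16 * (2 t + 2): passage from 4^t to 4^(t+1), density of
    coprime pairs, number of lengths.\<close>
  have "\<forall>\<^sub>F t in sequentially. 128 * (real t + 1) \<le> 2 powr (\<eta> * (real t + 1))"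
    using assms by real_asymp
  moreover have "\<forall>\<^sub>F t in sequentially. t \<ge> (2::nat)" by (rule eventually_ge_at_top)
  ultimately have "\<forall>\<^sub>F t in sequentially. 128 * (real t + 1) \<le> 2 powr (\<eta> * (real t + 1)) \<and> t \<ge> 2"
    by (rule eventually_conj)
  then obtain t :: nat where t: "128 * (real t + 1) \<le> 2 powr (\<eta> * (real t + 1))" "t \<ge> 2"
    using eventually_happens' [OF sequentially_bot] by blast
  define Q :: nat where "Q = 2 ^ t"
  have "(2::nat) ^ 2 \<le> 2 ^ t" using t(2) by (intro power_increasing) auto
  then have Q4: "Q \<ge> 4" by (simp add: Q_def)
  let ?C = "coprime_pairs Q"
  define pq where "pq = (\<lambda>(a, q). partial_quotients a q)"
  have pq: "cont (pq z) = (snd z, fst z)" "\<And>b. b \<in> set (pq z) \<Longrightarrow> 1 \<le> b \<and> b \<le> Q" "pq z \<noteq> []"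
    "fst (cont (pq z)) \<le> Q"
    if z: "z \<in> ?C" for z
  proof -
    obtain a q where aq: "z = (a, q)" "coprime a q" "a < q" "1 \<le> a" "q \<le> Q"
      using z by (auto simp: coprime_pairs_def)
    have *: "cont (pq z) = (q, a) \<and> (\<forall>b\<in>set (pq z). 1 \<le> b \<and> b \<le> q)"
      using cont_partial_quotients [OF aq(2,3)] aq(1) by (simp add: pq_def)
    then show "cont (pq z) = (snd z, fst z)" "fst (cont (pq z)) \<le> Q" using aq by auto
    show "1 \<le> b \<and> b \<le> Q" if "b \<in> set (pq z)" for b using * aq(5) that by fastforce
    show "pq z \<noteq> []" using * aq by auto
  qed
  have len: "length (pq z) \<in> {..2 * t + 1}" if z: "z \<in> ?C" for z
  proof -
    have "2 ^ (length (pq z) div 2) \<le> fst (cont (pq z))" using pq(2) [OF z] by (intro two_power_le_cont) auto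
    also have "\<dots> \<le> 2 ^ t" using pq(4) [OF z] by (simp add: Q_def)
    finally have "length (pq z) div 2 \<le> t" by simp
    then show ?thesis by simp
  qed
  \<comment> \<open>Pigeonhole on the length of the expansion.\<close>
  have "\<exists>l\<in>{..2 * t + 1}. real (card ?C) \<le> (2 * real t + 2) * real (card {z \<in> ?C. length (pq z) = l})"
  proof (rule ccontr)
    assume "\<not> ?thesis"
    then have less: "(2 * real t + 2) * real (card {z \<in> ?C. length (pq z) = l}) < real (card ?C)"
      if "l \<in> {..2 * t + 1}" for l using that by (meson not_le)
    have "(\<lambda>z. length (pq z)) ` ?C \<subseteq> {..2 * t + 1}" using len by blast
    then have "(\<Sum>l\<in>{..2 * t + 1}. \<Sum>z\<in>{z \<in> ?C. length (pq z) = l}. 1::nat) = (\<Sum>z\<in>?C. 1)"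
      by (intro sum.group finite_coprime_pairs finite_atMost)
    then have "card ?C = (\<Sum>l\<in>{..2 * t + 1}. card {z \<in> ?C. length (pq z) = l})"
      unfolding card_eq_sum by (rule sym)
    then have "(2 * real t + 2) * real (card ?C)
        = (\<Sum>l\<in>{..2 * t + 1}. (2 * real t + 2) * real (card {z \<in> ?C. length (pq z) = l}))"
      unfolding sum_distrib_left [symmetric] of_nat_sum [symmetric] by (rule arg_cong)
    also have "\<dots> < (\<Sum>l\<in>{..2 * t + 1}. real (card ?C))"
      by (intro sum_strict_mono less) auto
    also have "\<dots> = (2 * real t + 2) * real (card ?C)" by simp
    finally show False by simp
  qed
  then obtain l where l: "real (card ?C) \<le> (2 * real t + 2) * real (card {z \<in> ?C. length (pq z) = l})"
    by blast
  define Bl where "Bl = pq ` {z \<in> ?C. length (pq z) = l}"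
  have "inj_on pq {z \<in> ?C. length (pq z) = l}"
  proof (rule inj_onI)
    fix y z assume yz: "y \<in> {z \<in> ?C. length (pq z) = l}" "z \<in> {z \<in> ?C. length (pq z) = l}" "pq y = pq z"
    have "cont (pq y) = (snd y, fst y)" "cont (pq z) = (snd z, fst z)"
      by (rule pq(1), use yz in blast)+
    then have "(snd y, fst y) = (snd z, fst z)" unfolding yz(3) by (rule trans [OF sym])
    then show "y = z" by (simp add: prod_eq_iff)
  qed
  then have cBl: "card Bl = card {z \<in> ?C. length (pq z) = l}" unfolding Bl_def by (rule card_image)
  have "(2 ^ (t + 1)) powr (2 - \<eta>) \<le> real (card Bl)"
  proof -
    have "(4::real) ^ t / 16 \<le> (2 * real t + 2) * real (card Bl)"
    proof -
      have "(real Q)\<^sup>2 = 4 ^ t" by (simp add: Q_def power2_eq_square flip: power_mult_distrib)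
      then show ?thesis using card_coprime_pairs [OF Q4] l cBl by simp
    qed
    then have c: "(4::real) ^ (t + 1) \<le> 128 * (real t + 1) * real (card Bl)" by (simp add: algebra_simps)
    also have "\<dots> \<le> 2 powr (\<eta> * (real t + 1)) * real (card Bl)"
      using t(1) by (intro mult_right_mono) auto
    finally have "(4::real) ^ (t + 1) / 2 powr (\<eta> * (real t + 1)) \<le> real (card Bl)"
      by (simp add: field_simps)
    moreover have "((2::real) ^ (t + 1)) powr (2 - \<eta>) = 4 ^ (t + 1) / 2 powr (\<eta> * (real t + 1))"
    proof -
      have "((2::real) ^ (t + 1)) powr (2 - \<eta>) = 2 powr ((real t + 1) * (2 - \<eta>))"
      proof -
        have "(2::real) ^ (t + 1) = 2 powr real (t + 1)" by (simp only: powr_realpow zero_less_numeral)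
        then show ?thesis by (simp only: powr_powr) (simp add: add.commute)
      qed
      also have "(real t + 1) * (2 - \<eta>) = 2 * real (t + 1) - \<eta> * (real t + 1)" by (simp add: algebra_simps)
      also have "2 powr \<dots> = 2 powr (2 * real (t + 1)) / 2 powr (\<eta> * (real t + 1))" by (rule powr_diff)
      also have "(2::real) powr (2 * real (t + 1)) = 4 ^ (t + 1)"
      proof -
        have "(2::real) powr (2 * real (t + 1)) = (2 powr 2) powr real (t + 1)" by (simp only: powr_powr)
        also have "(2::real) powr 2 = 4" by simp
        also have "(4::real) powr real (t + 1) = 4 ^ (t + 1)" by (simp only: powr_realpow zero_less_numeral)
        finally show ?thesis .
      qed
      finally show ?thesis .
    qed
    ultimately show ?thesis by simp
  qed
  moreover have fin: "finite Bl" using finite_coprime_pairs by (simp add: Bl_def)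
  moreover have "length w = l \<and> (\<forall>b\<in>set w. 1 \<le> b \<and> b \<le> 2 ^ t) \<and> mnorm (wmat w) \<le> 2 ^ t" if wB: "w \<in> Bl" for w
  proof -
    obtain z where z: "z \<in> ?C" "w = pq z" "length w = l" using wB unfolding Bl_def by blast
    have "mnorm (wmat w) \<le> int (fst (cont w))"
      using pq(2,3) [OF z(1)] z(2) by (intro mnorm_wmat) auto
    also have "\<dots> \<le> int Q" using pq(4) [OF z(1)] z(2) by simp
    finally show ?thesis using z pq(2) [OF z(1)] by (auto simp: Q_def)
  qed
  ultimately show ?thesis by (intro exI [of _ t] exI [of _ l] exI [of _ Bl] conjI fin) simp_all
qed

text \<open>Concatenating a fixed number of blocks of a common length is injective, and the number
  of concatenations grows like the power \<open>2 - \<eta>\<close> of the norm bound. An even number of blocks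
  makes the determinant 1.\<close>

lemma thick_words:
  fixes \<eta> :: real
  assumes "0 < \<eta>" "\<eta> < 1"
  shows "\<exists>(Z::nat) c. 0 < c \<and> (\<forall>X\<ge>1. \<exists>W. finite W \<and>
     (\<forall>w\<in>W. even (length w) \<and> (\<forall>b\<in>set w. 1 \<le> b \<and> b \<le> Z) \<and> real_of_int (mnorm (wmat w)) \<le> X) \<and>
     c * X powr (2 - \<eta>) \<le> real (card W))"
proof -
  obtain t l Bl where fin: "finite Bl"
    and Bl: "\<And>w. w \<in> Bl \<Longrightarrow> length w = l" "\<And>w b. w \<in> Bl \<Longrightarrow> b \<in> set w \<Longrightarrow> 1 \<le> b \<and> b \<le> 2 ^ t"
      "\<And>w. w \<in> Bl \<Longrightarrow> mnorm (wmat w) \<le> 2 ^ t"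
    and card: "(2 ^ (t + 1)) powr (2 - \<eta>) \<le> real (card Bl)"
    using exists_block [OF assms(1)] by blast
  \<comment> \<open>Twice the norm bound of a block, since each multiplication in the maximum norm
    costs a factor 2.\<close>
  define D :: real where "D = 2 ^ (t + 1)"
  have D2: "D \<ge> 2" unfolding D_def by simp
  \<comment> \<open>This pays for rounding \<open>X\<close> down to an even power of
    \<open>D\<close>, a loss of at most a factor \<open>D\<^sup>2\<close>.\<close>
  define c where "c = 1 / (D\<^sup>2) powr (2 - \<eta>)"
  have main: "\<exists>W. finite W \<and>
     (\<forall>w\<in>W. even (length w) \<and> (\<forall>b\<in>set w. 1 \<le> b \<and> b \<le> 2 ^ t) \<and> real_of_int (mnorm (wmat w)) \<le> X) \<and>
     c * X powr (2 - \<eta>) \<le> real (card W)" if X: "X \<ge> 1" for X :: real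
  proof -
    have D1: "1 < D\<^sup>2" using D2 power_mono [of 2 D 2] by simp
    define j where "j = nat \<lfloor>log (D\<^sup>2) X\<rfloor>"
    have lg: "0 \<le> log (D\<^sup>2) X" using X D1 by (simp add: zero_le_log_cancel_iff)
    have j: "real j \<le> log (D\<^sup>2) X" "log (D\<^sup>2) X \<le> real j + 1"
      using lg unfolding j_def by linarith+
    have "(D\<^sup>2) powr real j \<le> X" "X \<le> (D\<^sup>2) powr (real j + 1)"
      using j X D1 by (simp_all add: le_log_iff log_le_iff)
    then have Xj: "D ^ (2 * j) \<le> X" "X \<le> D ^ (2 * j) * D\<^sup>2"
      using D1 D2 powr_realpow [of "D\<^sup>2" j] unfolding powr_add power_mult by simp_all
    define W where "W = concat ` lists_of (2 * j) Bl"
    have inj: "inj_on concat (lists_of (2 * j) Bl)"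
    proof (rule inj_onI)
      fix xs ys assume h: "xs \<in> lists_of (2 * j) Bl" "ys \<in> lists_of (2 * j) Bl" "concat xs = concat ys"
      have "list_all2 (\<lambda>x y. length x = length y) xs ys"
        using h Bl(1) by (auto simp: list_all2_conv_all_nth lists_of_def subset_eq)
      then show "xs = ys" using h(3)
      proof (induction rule: list_all2_induct)
        case (Cons x xs y ys)
        then show ?case by simp
      qed simp
    qed
    have cW: "real (card W) = real (card Bl) ^ (2 * j)"
      unfolding W_def card_image [OF inj] card_lists_of [OF fin] by simp
    have "c * X powr (2 - \<eta>) \<le> c * (D ^ (2 * j) * D\<^sup>2) powr (2 - \<eta>)"
      using Xj X assms D2 by (intro mult_left_mono powr_mono2) (auto simp: c_def)
    also have "\<dots> = (D ^ (2 * j)) powr (2 - \<eta>)"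
      using D2 by (simp add: c_def powr_mult)
    also have "\<dots> = (D powr (2 - \<eta>)) ^ (2 * j)"
      using D2 by (simp add: powr_powr mult.commute flip: powr_realpow)
    also have "\<dots> \<le> real (card W)"
      unfolding cW using card by (intro power_mono) (auto simp: D_def)
    finally have "c * X powr (2 - \<eta>) \<le> real (card W)" .
    moreover have "finite W" by (simp add: W_def finite_lists_of fin)
    moreover have "even (length w) \<and> (\<forall>b\<in>set w. 1 \<le> b \<and> b \<le> 2 ^ t) \<and> real_of_int (mnorm (wmat w)) \<le> X"
      if wW: "w \<in> W" for w
    proof (intro conjI)
      obtain ws where ws: "w = concat ws" "set ws \<subseteq> Bl" "length ws = 2 * j"
        using wW unfolding W_def lists_of_def by blast
      have "map length ws = map (\<lambda>_. l) ws" using ws(2) Bl(1) by auto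
      then have "length w = 2 * j * l"
        unfolding ws(1) length_concat by (simp add: map_replicate_const sum_list_replicate ws(3))
      then show "even (length w)" by simp
      show "\<forall>b\<in>set w. 1 \<le> b \<and> b \<le> 2 ^ t" using ws Bl(2) by auto
      have r: "real_of_int (mnorm g) \<le> 2 ^ t" if "g \<in> set (map wmat ws)" for g
      proof -
        have "mnorm g \<le> 2 ^ t" using that ws(2) Bl(3) by auto
        then have "real_of_int (mnorm g) \<le> real_of_int (2 ^ t)" by (simp only: of_int_le_iff)
        then show ?thesis by simp
      qed
      have "real_of_int (mnorm (wmat w)) \<le> (2 * 2 ^ t) ^ length (map wmat ws)"
        unfolding ws(1) wmat_concat by (rule mnorm_prod_list_le) (use r in auto)
      also have "\<dots> = D ^ (2 * j)" by (simp add: D_def ws(3))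
      finally show "real_of_int (mnorm (wmat w)) \<le> X" using Xj(1) by linarith
    qed
    ultimately show ?thesis by blast
  qed
  have "0 < c" using D2 by (simp add: c_def)
  then show ?thesis using main by (intro exI [of _ "2 ^ t"] exI [of _ c]) (simp only: of_nat_power of_nat_numeral, blast)
qed

section \<open>From the operator bound to fractions with bounded partial quotients\<close>

section \<open>Existence of a solution\<close>

context prime_modulus
begin

text \<open>The lines spanned by \<open>V\<close> without the origin, counted with multiplicity. The
  count makes the total a plain double counting; it takes only the values 0 and 1 once the lines are
  known to be distinct.\<close>

definition hits :: "(int \<times> int) set \<Rightarrow> int \<times> int \<Rightarrow> real" where
  "hits V z = (if vcong z (0, 0) then 0 else real (card {x \<in> V. P dvd cross x z}))"

lemma dvd_cross_vcong: "vcong u v \<Longrightarrow> P dvd cross x u \<longleftrightarrow> P dvd cross x v"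
  unfolding vcong_def cross_def by (intro cong_dvd_iff cong_diff cong_mult cong_refl) auto

lemma vcong_zero_iff: "vcong z (0, 0) \<longleftrightarrow> P dvd fst z \<and> P dvd snd z"
  by (simp add: vcong_def cong_0_iff)

lemma vcong_zero_smul: "\<not> P dvd c \<Longrightarrow> vcong (smul c z) (0, 0) \<longleftrightarrow> vcong z (0, 0)"
  using prime_P by (simp add: vcong_zero_iff smul_def prime_dvd_mult_iff)

lemma cross_smul: "cross x (smul c z) = c * cross x z"
  by (simp add: cross_def smul_def algebra_simps)

lemma vcong_zero_cong: "vcong u v \<Longrightarrow> vcong u (0, 0) \<longleftrightarrow> vcong v (0, 0)"
  using vcong_sym vcong_trans by blast

lemma isotropic_hits: "isotropic (hits V)"
  unfolding isotropic_def
proof (intro conjI allI impI)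
  show "periodic (hits V)"
    unfolding periodic_def hits_def using vcong_zero_cong dvd_cross_vcong by auto
  show "hits V (smul c v) = hits V v" if "\<not> P dvd c" for c v
    using that prime_P unfolding hits_def vcong_zero_smul [OF that] cross_smul
    by (simp add: prime_dvd_mult_iff)
qed (simp add: hits_def)

lemma isotropic_act: "isotropic F \<Longrightarrow> isotropic (\<lambda>v. F (act g v))"
  unfolding isotropic_def
proof (intro conjI allI impI)
  assume F: "periodic F \<and> F (0, 0) = 0 \<and> (\<forall>c v. \<not> P dvd c \<longrightarrow> F (smul c v) = F v)"
  then show "periodic (\<lambda>v. F (act g v))" by (intro periodic_act) blast
  show "F (act g (0, 0)) = 0" using F by (simp add: act_def)
  show "F (act g (smul c v)) = F (act g v)" if "\<not> P dvd c" for c v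
    unfolding act_smul using F that by blast
qed

lemma isotropic_nonzero: "isotropic (\<lambda>v. if vcong v (0, 0) then 0 else 1)"
  unfolding isotropic_def
proof (intro conjI allI impI)
  show "periodic (\<lambda>v. if vcong v (0, 0) then 0 else 1)"
    unfolding periodic_def using vcong_zero_cong by presburger
  show "(if vcong (smul c v) (0, 0) then 0 else 1) = (if vcong v (0, 0) then 0 else (1::real))"
    if "\<not> P dvd c" for c v
    unfolding vcong_zero_smul [OF that] ..
qed simp

lemma isotropic_diff_scale: "isotropic F \<Longrightarrow> isotropic G \<Longrightarrow> isotropic (\<lambda>v. F v - m * G v)"
  unfolding isotropic_def
proof (intro conjI allI impI)
  assume F: "periodic F \<and> F (0, 0) = 0 \<and> (\<forall>c v. \<not> P dvd c \<longrightarrow> F (smul c v) = F v)"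
    and G: "periodic G \<and> G (0, 0) = 0 \<and> (\<forall>c v. \<not> P dvd c \<longrightarrow> G (smul c v) = G v)"
  show "periodic (\<lambda>v. F v - m * G v)"
    unfolding periodic_def
  proof (intro allI impI)
    fix u v assume uv: "vcong u v"
    have "F u = F v" "G u = G v" using F G by (blast intro: periodicD [OF _ uv])+
    then show "F u - m * G u = F v - m * G v" by simp
  qed
  show "F (0, 0) - m * G (0, 0) = 0" using F G by simp
  show "F (smul c v) - m * G (smul c v) = F v - m * G v" if "\<not> P dvd c" for c v
  proof -
    have "F (smul c v) = F v" "G (smul c v) = G v" using F G that by blast+
    then show ?thesis by simp
  qed
qed

lemma dvd_cross_trans:
  assumes "\<not> vcong z (0, 0)" "P dvd cross x z" "P dvd cross y z"
  shows "P dvd cross x y"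
proof -
  have "cross x y * fst z = fst y * cross x z - fst x * cross y z"
    "cross x y * snd z = snd y * cross x z - snd x * cross y z"
    by (simp_all add: cross_def algebra_simps)
  then have "P dvd cross x y * fst z" "P dvd cross x y * snd z"
    using assms(2,3) by (metis dvd_diff dvd_mult)+
  then show ?thesis using assms(1) prime_P by (auto simp: vcong_zero_iff prime_dvd_mult_iff)
qed

lemma hits_le_one:
  assumes "\<And>x y. x \<in> V \<Longrightarrow> y \<in> V \<Longrightarrow> P dvd cross x y \<Longrightarrow> x = y"
  shows "hits V z = 0 \<or> hits V z = 1"
proof (cases "vcong z (0, 0)")
  case False
  have eq: "x = y" if "x \<in> V" "y \<in> V" "P dvd cross x z" "P dvd cross y z" for x y
    using dvd_cross_trans [OF False that(3,4)] that(1,2) assms by blast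
  have "card {x \<in> V. P dvd cross x z} \<le> 1"
  proof (cases "{x \<in> V. P dvd cross x z} = {}")
    case False
    then obtain x where "x \<in> V" "P dvd cross x z" by blast
    then have "{x \<in> V. P dvd cross x z} = {x}" using eq by blast
    then show ?thesis by simp
  next
    case True
    then show ?thesis by (simp only: card.empty)
  qed
  then have "card {x \<in> V. P dvd cross x z} = 0 \<or> card {x \<in> V. P dvd cross x z} = 1" by linarith
  moreover have "hits V z = real (card {x \<in> V. P dvd cross x z})"
    unfolding hits_def using False by (simp only: if_False)
  ultimately obtain k :: nat where "hits V z = real k" "k = 0 \<or> k = 1" by blast
  then show ?thesis by auto
qed (simp add: hits_def)

lemma card_line:
  assumes "\<not> vcong x (0, 0)"
  shows "p - 1 \<le> card {z \<in> box. \<not> vcong z (0, 0) \<and> P dvd cross x z}"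
proof -
  have nd: "\<not> P dvd c" if "c \<in> {1..<P}" for c using that by (auto dest: zdvd_imp_le)
  have "inj_on (\<lambda>c. red (smul c x)) {1..<P}"
  proof (rule inj_onI)
    fix c d assume cd: "c \<in> {1..<P}" "d \<in> {1..<P}" "red (smul c x) = red (smul d x)"
    then have "P dvd (c - d) * fst x" "P dvd (c - d) * snd x"
      by (simp_all add: vcong_iff_red [symmetric] vcong_def smul_def cong_iff_dvd_diff left_diff_distrib)
    then have "P dvd c - d" using assms prime_P by (auto simp: vcong_zero_iff prime_dvd_mult_iff)
    then show "c = d" using cd dvd_imp_le_int [of "c - d" P] by (cases "c = d") auto
  qed
  moreover have "(\<lambda>c. red (smul c x)) ` {1..<P} \<subseteq> {z \<in> box. \<not> vcong z (0, 0) \<and> P dvd cross x z}"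
  proof
    fix z assume "z \<in> (\<lambda>c. red (smul c x)) ` {1..<P}"
    then obtain c where c: "c \<in> {1..<P}" "z = red (smul c x)" by auto
    have v: "vcong z (smul c x)" unfolding c by simp
    have "cross x x = 0" by (simp add: cross_def)
    then have "P dvd cross x z" using dvd_cross_vcong [OF v] by (simp add: cross_smul)
    moreover have "\<not> vcong z (0, 0)"
      using vcong_zero_cong [OF v] vcong_zero_smul [OF nd [OF c(1)]] assms by blast
    ultimately show "z \<in> {z \<in> box. \<not> vcong z (0, 0) \<and> P dvd cross x z}" unfolding c(2) by simp
  qed
  ultimately have "card {1..<P} \<le> card {z \<in> box. \<not> vcong z (0, 0) \<and> P dvd cross x z}"
    by (intro card_inj_on_le) auto
  then show ?thesis by simp
qed

lemma sum_hits_ge: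
  assumes fin: "finite V" and nz: "\<And>x. x \<in> V \<Longrightarrow> \<not> vcong x (0, 0)"
  shows "real (card V) * (real p - 1) \<le> (\<Sum>z\<in>box. hits V z)"
proof -
  have "real (card V) * (real p - 1) \<le> (\<Sum>x\<in>V. real (card {z \<in> box. \<not> vcong z (0, 0) \<and> P dvd cross x z}))"
  proof -
    have "(\<Sum>x\<in>V. real p - 1) \<le> (\<Sum>x\<in>V. real (card {z \<in> box. \<not> vcong z (0, 0) \<and> P dvd cross x z}))"
    proof (rule sum_mono)
      fix x assume "x \<in> V"
      then have "real (p - 1) \<le> real (card {z \<in> box. \<not> vcong z (0, 0) \<and> P dvd cross x z})"
        using card_line [OF nz] by (intro of_nat_mono)
      then show "real p - 1 \<le> real (card {z \<in> box. \<not> vcong z (0, 0) \<and> P dvd cross x z})"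
        using p3 by (simp add: of_nat_diff)
    qed
    then show ?thesis by simp
  qed
  also have "\<dots> = (\<Sum>x\<in>V. \<Sum>z\<in>box. if \<not> vcong z (0, 0) \<and> P dvd cross x z then 1 else 0)"
    by (simp add: sum.If_cases Int_def)
  also have "\<dots> = (\<Sum>z\<in>box. \<Sum>x\<in>V. if \<not> vcong z (0, 0) \<and> P dvd cross x z then 1 else 0)"
    by (rule sum.swap)
  also have "\<dots> = (\<Sum>z\<in>box. hits V z)"
    using fin by (intro sum.cong refl) (simp add: hits_def sum.If_cases Int_def)
  finally show ?thesis .
qed

lemma sum_nonzero: "(\<Sum>z\<in>box. if vcong z (0, 0) then 0 else (1::real)) = (real p)\<^sup>2 - 1"
proof -
  have "(0, 0) \<in> box" using P_pos by (simp add: box_def)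
  then have "{z \<in> box. vcong z (0, 0)} = {(0, 0)}" using vcong_box_eq by auto
  then have "(\<Sum>z\<in>box. if vcong z (0, 0) then 1 else (0::real)) = 1"
    by (simp add: sum.If_cases Int_def)
  moreover have "(\<Sum>z\<in>box. if vcong z (0, 0) then 0 else (1::real))
      = (\<Sum>z\<in>box. 1 - (if vcong z (0, 0) then 1 else 0))" by (intro sum.cong) auto
  ultimately show ?thesis by (simp add: sum_subtractf card_box)
qed

end

context averaging
begin

lemma E_nonneg: "0 \<le> E n"
  unfolding E_def using mnorm_nonneg by (intro sum_nonneg) auto

text \<open>The functions \<open>f\<close> and \<open>h\<close> below are the indicators of the lines spanned by
  vectors of \<open>V\<close> and of those orthogonal to a vector of \<open>V\<close>. Their correlation under
  the averaging operator would vanish if there were no solution. This is incompatible with the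
  bound for the operator on functions of mean zero.\<close>

lemma exists_solution:
  assumes fin: "finite V" and nz: "\<And>x. x \<in> V \<Longrightarrow> \<not> vcong x (0, 0)"
    and sep: "\<And>x y. x \<in> V \<Longrightarrow> y \<in> V \<Longrightarrow> P dvd cross x y \<Longrightarrow> x = y"
    and n: "n = 2 ^ j"
    and crit: "((real p + 1) * K) ^ (4 * n) * (2 * (real p)\<^sup>2 * E n)
      < (real (card A) * real (card V)) ^ (4 * n)"
  shows "\<exists>g\<in>A. \<exists>x\<in>V. \<exists>y\<in>V. P dvd vdot y (act (adj g) x)"
proof (rule ccontr)
  assume nosol: "\<not> ?thesis"
  \<comment> \<open>The rotation by a right angle, which turns cross products into inner
    products.\<close>
  define J where "J = Mat2 0 (-1) 1 0"
  define f where "f = hits V"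
  define h where "h = (\<lambda>v. hits V (act J v))"
  define e :: "int \<times> int \<Rightarrow> real" where "e = (\<lambda>v. if vcong v (0, 0) then 0 else 1)"
  define s where "s = (\<Sum>z\<in>box. f z)"
  \<comment> \<open>The mean of \<open>h\<close> over the nonzero vectors, so that \<open>F\<close>
    below is the part of \<open>h\<close> of mean zero.\<close>
  define m where "m = s / ((real p)\<^sup>2 - 1)"
  define F where "F = (\<lambda>v. h v - m * e v)"
  define Y where "Y = K ^ (4 * n) * E n * (2 * (real p)\<^sup>2)"
  have J: "mdet J = 1" by (simp add: J_def mdet_def)
  have dotJ: "cross y (act J v) = vdot y v" for y v
    by (simp add: J_def cross_def vdot_def act_def)
  have f: "isotropic f" unfolding f_def by (rule isotropic_hits)
  have h: "isotropic h" unfolding h_def by (intro isotropic_act isotropic_hits)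
  have e: "isotropic e" unfolding e_def by (rule isotropic_nonzero)
  have F: "isotropic F" unfolding F_def by (intro isotropic_diff_scale h e)
  have pf: "periodic f" and ph: "periodic h" and pe: "periodic e" using f h e by (auto simp: isotropic_def)
  have f01: "f z = 0 \<or> f z = 1" for z unfolding f_def using sep by (intro hits_le_one)
  have p1: "(real p)\<^sup>2 - 1 = (real p - 1) * (real p + 1)" by (simp add: power2_eq_square algebra_simps)
  have pp: "(real p)\<^sup>2 - 1 > 0" unfolding p1 using p3 by simp
  have n1: "n \<ge> 1" using n by simp
  have Y0: "0 \<le> Y" unfolding Y_def using K_nonneg E_nonneg by simp
  have V0: "card V > 0"
  proof (rule ccontr)
    assume "\<not> card V > 0"
    then have "(real (card A) * real (card V)) ^ (4 * n) = 0" using n1 by simp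
    moreover have "0 \<le> ((real p + 1) * K) ^ (4 * n) * (2 * (real p)\<^sup>2 * E n)"
      using K_nonneg E_nonneg by simp
    ultimately show False using crit by linarith
  qed
  have s_ge: "real (card V) * (real p - 1) \<le> s"
    unfolding s_def f_def using fin nz by (rule sum_hits_ge)
  have spos: "s > 0" using V0 p3 by (intro less_le_trans [OF _ s_ge]) simp
  \<comment> \<open>The plane has \<open>p + 1\<close> lines through the origin, so the density of
    the marked ones is at least \<open>card V / (p + 1)\<close>.\<close>
  have m_ge: "real (card V) \<le> (real p + 1) * m"
  proof -
    have "(real p + 1) * m = s / (real p - 1)"
    proof -
      have "a * (s / (b * a)) = s / b" if "a \<noteq> 0" for a b :: real using that by simp
      then show ?thesis unfolding m_def p1 by simp
    qed
    moreover have "real (card V) \<le> s / (real p - 1)" using s_ge p3 by (simp add: field_simps)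
    ultimately show ?thesis by simp
  qed
  have m0: "m \<ge> 0" using spos pp by (simp add: m_def)
  have ff: "ip f f = s"
  proof -
    have sq: "f z * f z = f z" for z using f01 [of z] by auto
    show ?thesis unfolding ip_def s_def sq ..
  qed
  have per1: "periodic (\<lambda>_. 1)" by (simp add: periodic_def)
  have sh: "(\<Sum>z\<in>box. h z) = s"
    using ip_act_adjoint [OF J pf per1] by (simp add: ip_def s_def h_def f_def)
  have hh: "ip h h = s"
  proof -
    have "ip h h = ip f (\<lambda>v. h (act (adj J) v))"
      using ip_act_adjoint [OF J pf ph] by (simp add: h_def f_def)
    also have "(\<lambda>v. h (act (adj J) v)) = f"
      by (simp add: h_def f_def act_mult [symmetric] mult_adj [OF J])
    finally show ?thesis using ff by simp
  qed
  have se: "(\<Sum>z\<in>box. e z) = (real p)\<^sup>2 - 1" unfolding e_def by (rule sum_nonzero)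
  have ge: "g z * e z = g z" if "isotropic g" for g z
    using that by (auto simp: isotropic_def e_def dest: periodicD)
  have mean: "(\<Sum>v\<in>box. F v) = 0"
  proof -
    have "(\<Sum>v\<in>box. F v) = s - m * ((real p)\<^sup>2 - 1)"
      unfolding F_def sum_subtractf sh sum_distrib_left [symmetric] se ..
    then show ?thesis using pp by (simp add: m_def)
  qed
  have FF: "ip F F \<le> s"
  proof -
    have "F z * F z = h z * h z - 2 * m * h z + m * m * e z" for z
    proof -
      have "F z * F z = h z * h z - 2 * m * (h z * e z) + m * m * (e z * e z)"
        by (simp add: F_def algebra_simps)
      then show ?thesis by (simp add: ge [OF h] ge [OF e])
    qed
    then have "ip F F = ip h h - 2 * m * s + m * m * ((real p)\<^sup>2 - 1)"
      by (simp add: ip_def sum.distrib sum_subtractf sum_distrib_left [symmetric] sh se)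
    also have "m * m * ((real p)\<^sup>2 - 1) = m * s" using pp by (simp add: m_def)
    finally have "ip F F = s - m * s" by (simp add: hh)
    then show ?thesis using m0 spos by simp
  qed
  have Te: "T e v = real (card A) * e v" for v
  proof -
    have "e (act (adj g) v) = e v" if g: "g \<in> A" for g
    proof -
      have "vcong (act (adj g) v) (0, 0) \<longleftrightarrow> vcong v (0, 0)"
      proof
        assume "vcong (act (adj g) v) (0, 0)"
        then have "vcong (act g (act (adj g) v)) (act g (0, 0))" by (intro vcong_act) auto
        then show "vcong v (0, 0)"
          using mdet_A [OF g] by (simp add: act_mult [symmetric] mult_adj) (simp add: act_def)
      next
        assume "vcong v (0, 0)"
        then have "vcong (act (adj g) v) (act (adj g) (0, 0))" by (intro vcong_act) auto
        then show "vcong (act (adj g) v) (0, 0)" by (simp add: act_def)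
      qed
      then show ?thesis by (simp add: e_def)
    qed
    then show ?thesis by (simp add: T_def)
  qed
  have Th: "T h v = T F v + m * (real (card A) * e v)" for v
    unfolding Te [symmetric] by (simp add: T_def F_def sum_subtractf sum_distrib_left)
  have "ip f (T h) = 0"
    unfolding ip_def
  proof (intro sum.neutral ballI)
    fix z assume "z \<in> box"
    have "f z * h (act (adj g) z) = 0" if g: "g \<in> A" for g
    proof (rule ccontr)
      assume "f z * h (act (adj g) z) \<noteq> 0"
      then have fz: "f z \<noteq> 0" and hz: "h (act (adj g) z) \<noteq> 0" by auto
      have z0: "\<not> vcong z (0, 0)" using fz by (auto simp: f_def hits_def)
      have "card {x \<in> V. P dvd cross x z} \<noteq> 0" using fz z0 by (auto simp: f_def hits_def)
      then have "{x \<in> V. P dvd cross x z} \<noteq> {}" by (metis card.empty)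
      then obtain x where x: "x \<in> V" "P dvd cross x z" by blast
      obtain c where c: "c \<in> {0..<P}" "vcong z (smul c x)"
        using smul_of_cross_zero [OF nz [OF x(1)] x(2)] .
      have cnd: "\<not> P dvd c"
      proof
        assume "P dvd c"
        then have "vcong (smul c x) (0, 0)" by (simp add: vcong_zero_iff smul_def)
        then show False using z0 c(2) vcong_trans by blast
      qed
      have "vcong (act (adj g) z) (act (adj g) (smul c x))" using c(2) by (intro vcong_act) auto
      then have "h (act (adj g) z) = h (smul c (act (adj g) x))"
        using periodicD [OF ph] by (simp add: act_smul)
      also have "\<dots> = h (act (adj g) x)" using h cnd unfolding isotropic_def by blast
      finally have "hits V (act J (act (adj g) x)) \<noteq> 0" using hz by (simp add: h_def)
      then have "card {y \<in> V. P dvd cross y (act J (act (adj g) x))} \<noteq> 0"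
        by (auto simp: hits_def split: if_splits)
      then have "{y \<in> V. P dvd cross y (act J (act (adj g) x))} \<noteq> {}" by (metis card.empty)
      then show False using nosol g x(1) by (auto simp: dotJ)
    qed
    then show "f z * T h z = 0" unfolding T_def sum_distrib_left by (rule sum.neutral [OF ballI])
  qed
  moreover have "ip f (T h) = ip f (T F) + m * (real (card A) * s)"
  proof -
    have "f v * T h v = f v * T F v + m * real (card A) * f v" for v
    proof -
      have "f v * T h v = f v * T F v + m * real (card A) * (f v * e v)"
        unfolding Th by (simp add: algebra_simps)
      then show ?thesis by (simp add: ge [OF f])
    qed
    then show ?thesis by (simp add: ip_def sum.distrib sum_distrib_left [symmetric] s_def)
  qed
  \<comment> \<open>The constant part of \<open>h\<close> is an eigenfunction with eigenvalue
    \<open>card A\<close> and gives a positive main term, so the mean zero part has to cancel all of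
    it. The norms of \<open>f\<close> and \<open>F\<close> supply a factor
    \<open>s ^ (4 * n)\<close> that drops out afterwards.\<close>
  ultimately have "ip f (T F) = - (m * (real (card A) * s))" by linarith
  then have "(m * (real (card A) * s)) ^ (4 * n) = (ip f (T F)) ^ (4 * n)"
    by (simp add: power_minus_even)
  also have "\<dots> \<le> (ip f f * ip F F) ^ (2 * n) * Y"
    unfolding Y_def by (rule ip_T_bound [OF F mean n])
  also have "\<dots> \<le> (s * s) ^ (2 * n) * Y"
    using FF spos Y0 ip_self_nonneg by (intro mult_right_mono power_mono mult_mono mult_nonneg_nonneg) (auto simp: ff)
  also have "\<dots> = s ^ (4 * n) * Y"
    by (simp add: power_mult_distrib power_add [symmetric])
  finally have "(m * real (card A)) ^ (4 * n) * s ^ (4 * n) \<le> Y * s ^ (4 * n)"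
    by (simp only: power_mult_distrib ac_simps)
  then have mA: "(m * real (card A)) ^ (4 * n) \<le> Y"
    using spos by (simp add: mult_le_cancel_right)
  have "(real (card A) * real (card V)) ^ (4 * n) \<le> (real (card A) * ((real p + 1) * m)) ^ (4 * n)"
    using m_ge by (intro power_mono mult_left_mono) auto
  also have "\<dots> = (real p + 1) ^ (4 * n) * (m * real (card A)) ^ (4 * n)"
    by (simp only: power_mult_distrib ac_simps)
  also have "\<dots> \<le> (real p + 1) ^ (4 * n) * Y" using mA by (intro mult_left_mono) auto
  also have "\<dots> = ((real p + 1) * K) ^ (4 * n) * (2 * (real p)\<^sup>2 * E n)"
    by (simp only: Y_def power_mult_distrib ac_simps)
  finally show False using crit by linarith
qed

end

section \<open>The numerical comparison\<close>

lemma eventually_polylog_less: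
  fixes C :: real
  shows "\<forall>\<^sub>F x::real in at_top. C * (3 * log 2 x + 2) powr a < x powr (1/10)"
  by real_asymp

text \<open>Here \<open>x\<close> stands for p, \<open>l\<close> for \<open>L + 1\<close>,
  \<open>x powr \<beta> / 4\<close> for \<open>\<rho>\<close>, and \<open>sqrt x / 6\<close> for the
  norm bound of the outer words. The factor \<open>2 * x\<close> dominates p + 1 and
  \<open>22000 * l\<close> dominates \<open>E n\<close>.\<close>

lemma eventually_criterion:
  fixes c :: real and n :: nat
  assumes c: "0 < c" and n: "1 \<le> n"
  defines "\<eta> \<equiv> 1 / (50 * real n)" and "\<beta> \<equiv> 11 / (20 * real n)"
  shows "\<forall>\<^sub>F x::real in at_top. \<forall>l::real. 1 \<le> l \<longrightarrow> l \<le> 3 * log 2 x + 2 \<longrightarrow>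
     (2 * x * (600 * (x powr \<beta> / 4) * l)) ^ (4 * n) * (2 * x\<^sup>2 * (22000 * l))
     < (c * (x powr \<beta> / 4) powr (2 - \<eta>) * (c * (sqrt x / 6) powr (2 - \<eta>))) ^ (4 * n)"
proof -
  define C where "C = 44000 * (1200 * 144 / c\<^sup>2) ^ (4 * n)"
  have "\<forall>\<^sub>F x::real in at_top. C * (3 * log 2 x + 2) powr real (4 * n + 1) < x powr (1/10)"
    by (rule eventually_polylog_less)
  moreover have "\<forall>\<^sub>F x::real in at_top. 1 \<le> x" by (rule eventually_ge_at_top)
  ultimately show ?thesis
  proof eventually_elim
    case (elim x)
    note x1 = elim(2)
    show ?case
    proof (intro allI impI)
      fix l :: real assume l: "1 \<le> l" "l \<le> 3 * log 2 x + 2"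
      let ?N = "4 * n"
      define \<rho> where "\<rho> = x powr \<beta> / 4"
      have \<rho>0: "\<rho> > 0" using x1 by (simp add: \<rho>_def)
      have n0: "real n \<ge> 1" using n by simp
      have \<eta>: "0 < \<eta>" "\<eta> \<le> 1/50" using n0 by (auto simp: \<eta>_def field_simps)
      have "x powr (\<beta> * (1 - \<eta>)) / 4 \<le> x powr (\<beta> * (1 - \<eta>)) / 4 powr (1 - \<eta>)"
        using powr_mono [of "1 - \<eta>" 1 4] \<eta> by (intro divide_left_mono) auto
      also have "\<dots> = \<rho> powr (1 - \<eta>)" using x1 by (simp add: \<rho>_def powr_divide powr_powr)
      finally have r1: "x powr (\<beta> * (1 - \<eta>)) / 4 \<le> \<rho> powr (1 - \<eta>)" .
      have "\<rho> powr (2 - \<eta>) = \<rho> powr (1 + (1 - \<eta>))" by simp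
      also have "\<dots> = \<rho> * \<rho> powr (1 - \<eta>)" using \<rho>0 by (simp only: powr_add) simp
      finally have r2: "\<rho> * (x powr (\<beta> * (1 - \<eta>)) / 4) \<le> \<rho> powr (2 - \<eta>)"
        using r1 \<rho>0 by simp
      have s: "x * x powr (- \<eta> / 2) / 36 \<le> (sqrt x / 6) powr (2 - \<eta>)"
      proof -
        have "x * x powr (- \<eta> / 2) = x powr (1 + (- \<eta> / 2))" using x1 by (simp only: powr_add) simp
        also have "1 + (- \<eta> / 2) = (1 / 2) * (2 - \<eta>)" by (simp add: algebra_simps)
        also have "x powr \<dots> = (sqrt x) powr (2 - \<eta>)" using x1 by (simp only: powr_powr [symmetric] powr_half_sqrt)
        finally have "x * x powr (- \<eta> / 2) / 36 = (sqrt x) powr (2 - \<eta>) / 36" by simp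
        also have "\<dots> \<le> (sqrt x) powr (2 - \<eta>) / 6 powr (2 - \<eta>)"
          using powr_mono [of "2 - \<eta>" 2 6] \<eta> by (intro divide_left_mono) auto
        also have "\<dots> = (sqrt x / 6) powr (2 - \<eta>)" using x1 by (simp add: powr_divide)
        finally show ?thesis .
      qed
      \<comment> \<open>Since 4 n \<open>\<beta>\<close> = 2.2 and 2 n \<open>\<eta>\<close> = 1/25,
        the right side is 2.2 (1 - \<open>\<eta>\<close>) - 1/25. The excess 1/10 over the exponent
        2 absorbs constants and logarithms.\<close>
      have ex: "2 + 1/10 \<le> (\<beta> * (1 - \<eta>) + (- \<eta> / 2)) * ?N"
        using n0 by (simp add: \<beta>_def \<eta>_def field_simps)
      have "(\<rho> * x) ^ ?N * ((c\<^sup>2 / 144) ^ ?N * x powr (2 + 1/10))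
          \<le> (\<rho> * x) ^ ?N * ((c\<^sup>2 / 144) ^ ?N * x powr ((\<beta> * (1 - \<eta>) + (- \<eta> / 2)) * ?N))"
        using ex x1 \<rho>0 by (intro mult_left_mono powr_mono) auto
      also have "x powr ((\<beta> * (1 - \<eta>) + (- \<eta> / 2)) * ?N) = (x powr (\<beta> * (1 - \<eta>)) * x powr (- \<eta> / 2)) ^ ?N"
      proof -
        have "x powr ((\<beta> * (1 - \<eta>) + (- \<eta> / 2)) * ?N) = (x powr (\<beta> * (1 - \<eta>) + (- \<eta> / 2))) powr real ?N"
          by (simp only: powr_powr)
        also have "\<dots> = (x powr (\<beta> * (1 - \<eta>) + (- \<eta> / 2))) ^ ?N"
          using x1 by (intro powr_realpow) simp
        finally show ?thesis by (simp only: powr_add)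
      qed
      also have "(\<rho> * x) ^ ?N * ((c\<^sup>2 / 144) ^ ?N * (x powr (\<beta> * (1 - \<eta>)) * x powr (- \<eta> / 2)) ^ ?N)
          = (c * (\<rho> * (x powr (\<beta> * (1 - \<eta>)) / 4)) * (c * (x * x powr (- \<eta> / 2) / 36))) ^ ?N"
        unfolding power_mult_distrib [symmetric] by (rule arg_cong [where f = "\<lambda>t. t ^ (4 * n)"]) (simp add: power2_eq_square)
      also have "\<dots> \<le> (c * \<rho> powr (2 - \<eta>) * (c * (sqrt x / 6) powr (2 - \<eta>))) ^ ?N"
        using r2 s c \<rho>0 x1 by (intro power_mono mult_mono) auto
      finally have R: "(\<rho> * x) ^ ?N * ((c\<^sup>2 / 144) ^ ?N * x powr (2 + 1/10))
        \<le> (c * \<rho> powr (2 - \<eta>) * (c * (sqrt x / 6) powr (2 - \<eta>))) ^ ?N" .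
      have l0: "0 < 3 * log 2 x + 2" using l by linarith
      have "C * l ^ (?N + 1) \<le> C * (3 * log 2 x + 2) ^ (?N + 1)"
        using l by (intro mult_left_mono power_mono) (auto simp: C_def)
      also have "\<dots> < x powr (1/10)" using elim(1) powr_realpow [OF l0, of "?N + 1"] by simp
      finally have "44000 * (1200 * 144 / c\<^sup>2) ^ ?N * l ^ (?N + 1) < x powr (1/10)" by (simp add: C_def)
      then have "(c\<^sup>2 / 144) ^ ?N * (44000 * (1200 * 144 / c\<^sup>2) ^ ?N * l ^ (?N + 1)) < (c\<^sup>2 / 144) ^ ?N * x powr (1/10)"
        using c by (intro mult_strict_left_mono) auto
      also have "(c\<^sup>2 / 144) ^ ?N * (44000 * (1200 * 144 / c\<^sup>2) ^ ?N * l ^ (?N + 1))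
          = 44000 * ((c\<^sup>2 / 144) * (1200 * 144 / c\<^sup>2)) ^ ?N * l ^ (?N + 1)"
        by (simp only: power_mult_distrib ac_simps)
      also have "(c\<^sup>2 / 144) * (1200 * 144 / c\<^sup>2) = 1200" using c by simp
      finally have key: "44000 * 1200 ^ ?N * l ^ (?N + 1) < (c\<^sup>2 / 144) ^ ?N * x powr (1/10)" .
      have "(2 * x * (600 * \<rho> * l)) ^ ?N * (2 * x\<^sup>2 * (22000 * l))
          = (\<rho> * x * 1200 * l) ^ ?N * (x\<^sup>2 * (44000 * l))"
        by (rule arg_cong2 [where f = "\<lambda>s t. s ^ (4 * n) * t"]) simp_all
      also have "\<dots> = (\<rho> * x) ^ ?N * (x\<^sup>2 * (44000 * 1200 ^ ?N * l ^ (?N + 1)))"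
        by (simp only: power_mult_distrib power_add power_one_right ac_simps)
      also have "\<dots> < (\<rho> * x) ^ ?N * (x\<^sup>2 * ((c\<^sup>2 / 144) ^ ?N * x powr (1/10)))"
        using key \<rho>0 x1 by (intro mult_strict_left_mono) auto
      also have "\<dots> = (\<rho> * x) ^ ?N * ((c\<^sup>2 / 144) ^ ?N * x powr (2 + 1/10))"
      proof -
        have "x powr (2 + 1/10) = x\<^sup>2 * x powr (1/10)" using x1 by (subst powr_add) simp
        then show ?thesis by (simp only: ac_simps)
      qed
      finally have "(2 * x * (600 * \<rho> * l)) ^ ?N * (2 * x\<^sup>2 * (22000 * l))
        < (\<rho> * x) ^ ?N * ((c\<^sup>2 / 144) ^ ?N * x powr (2 + 1/10))" .
      then show "(2 * x * (600 * (x powr \<beta> / 4) * l)) ^ ?N * (2 * x\<^sup>2 * (22000 * l))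
        < (c * (x powr \<beta> / 4) powr (2 - \<eta>) * (c * (sqrt x / 6) powr (2 - \<eta>))) ^ ?N"
        using R unfolding \<rho>_def by (rule less_le_trans)
    qed
  qed
qed

section \<open>Fractions with a denominator divisible by a prime\<close>

lemma coprime_cont: "coprime (fst (cont w)) (snd (cont w))"
proof (induction w)
  case (Cons b w)
  have "coprime (b * fst (cont w) + snd (cont w)) (fst (cont w))"
  proof (rule coprimeI)
    fix d assume d: "d dvd b * fst (cont w) + snd (cont w)" "d dvd fst (cont w)"
    then have "d dvd snd (cont w)" by (simp add: dvd_add_right_iff)
    then show "d dvd 1" using d(2) Cons.IH coprime_common_divisor by blast
  qed
  then show ?case by simp
qed simp

lemma fst_cont_snoc_two:
  assumes "real_of_int (mnorm (wmat w)) \<le> X"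
  shows "real (fst (cont (w @ [2]))) \<le> 3 * X"
proof -
  have "int (fst (cont (w @ [2]))) = m11 (wmat w) * 2 + m12 (wmat w)"
    by (simp add: cont_wmat(1) [symmetric] wmat_append wmat_Cons times_mat2_def one_mat2_def)
  also have "\<dots> \<le> 3 * mnorm (wmat w)" using abs_entry_le_mnorm [of "wmat w"] by linarith
  finally have "real_of_int (int (fst (cont (w @ [2])))) \<le> real_of_int (3 * mnorm (wmat w))"
    by (simp only: of_int_le_iff)
  then show ?thesis using assms by simp
qed

text \<open>The appended digit 2 makes every word a regular expansion, which the Euclidean algorithm
  recovers from the fraction; a word ending in 1 would be merged with a shorter one.\<close>

lemma inj_on_cont_snoc_two:
  assumes "\<And>w b. w \<in> W \<Longrightarrow> b \<in> set w \<Longrightarrow> 1 \<le> b"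
  shows "inj_on (\<lambda>w. cont (w @ [2])) W"
proof (rule inj_onI)
  fix v w assume vw: "v \<in> W" "w \<in> W" "cont (v @ [2]) = cont (w @ [2])"
  have pq: "partial_quotients (snd (cont (u @ [2]))) (fst (cont (u @ [2]))) = u @ [2]" if "u \<in> W" for u
  proof -
    have "0 < snd (cont (u @ [2])) \<and> snd (cont (u @ [2])) < fst (cont (u @ [2]))
      \<and> partial_quotients (snd (cont (u @ [2]))) (fst (cont (u @ [2]))) = u @ [2]"
      by (rule partial_quotients_cont) (use assms [OF that] in auto)
    then show ?thesis by blast
  qed
  have "w @ [2] = v @ [2]" using pq [OF vw(1)] unfolding vw(3) pq [OF vw(2)] .
  then show "v = w" by simp
qed

lemma inj_on_wmat:
  assumes "\<And>w b. w \<in> W \<Longrightarrow> b \<in> set w \<Longrightarrow> 1 \<le> b"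
  shows "inj_on wmat W"
proof (rule inj_onI)
  fix v w assume vw: "v \<in> W" "w \<in> W" "wmat v = wmat w"
  then have "wmat (v @ [2]) = wmat (w @ [2])" by (simp add: wmat_append)
  then have "cont (v @ [2]) = cont (w @ [2])"
    by (metis cont_wmat of_nat_eq_iff prod_eq_iff)
  moreover have "inj_on (\<lambda>w. cont (w @ [2])) W" by (rule inj_on_cont_snoc_two) (rule assms)
  ultimately show "v = w" using vw(1,2) by (blast dest: inj_onD)
qed

definition wcol :: "nat list \<Rightarrow> int \<times> int" where
  "wcol w = (m11 (wmat w), m21 (wmat w))"

text \<open>Reversal transposes, so the first column of \<open>wmat u\<close> becomes the first row
  of the left factor and the triple product is the upper left entry.\<close>

lemma vdot_wcol_act:
  "vdot (wcol u) (act (wmat w) (wcol v)) = int (fst (cont (rev u @ w @ v)))"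
  unfolding cont_wmat(1) [symmetric]
  by (simp add: wcol_def vdot_def act_def wmat_append wmat_rev times_mat2_def algebra_simps)

lemma exists_fraction_large:
  fixes n j :: nat
  assumes n: "n = 2 ^ j"
  shows "\<exists>Z p0. \<forall>p. prime p \<longrightarrow> p0 \<le> p \<longrightarrow> (\<exists>q a. 0 < a \<and> a < q \<and> coprime a q \<and>
     real q \<le> real p powr (1 + 11 / (20 * real n)) \<and> p dvd q \<and>
     (\<forall>b\<in>set (partial_quotients a q). b \<le> Z))"
proof -
  define \<eta> where "\<eta> = 1 / (50 * real n)"
  define \<beta> where "\<beta> = 11 / (20 * real n)"
  have n1: "1 \<le> n" using n by simp
  have \<eta>: "0 < \<eta>" "\<eta> < 1" using n1 by (auto simp: \<eta>_def)
  have \<beta>: "0 < \<beta>" "\<beta> \<le> 11 / 20" using n1 by (auto simp: \<beta>_def field_simps)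
  obtain Z c where c: "0 < c" and thick: "\<And>X. X \<ge> 1 \<Longrightarrow> \<exists>W. finite W \<and>
     (\<forall>w\<in>W. even (length w) \<and> (\<forall>b\<in>set w. 1 \<le> b \<and> b \<le> Z) \<and> real_of_int (mnorm (wmat w)) \<le> X) \<and>
     c * X powr (2 - \<eta>) \<le> real (card W)"
    using thick_words [OF \<eta>] by blast
  have ev: "\<forall>\<^sub>F p in sequentially. \<forall>l::real. 1 \<le> l \<longrightarrow> l \<le> 3 * log 2 (real p) + 2 \<longrightarrow>
     (2 * real p * (600 * (real p powr \<beta> / 4) * l)) ^ (4 * n) * (2 * (real p)\<^sup>2 * (22000 * l))
     < (c * (real p powr \<beta> / 4) powr (2 - \<eta>) * (c * (sqrt (real p) / 6) powr (2 - \<eta>))) ^ (4 * n)"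
    using eventually_criterion [OF c n1] unfolding \<eta>_def \<beta>_def
    by (rule eventually_compose_filterlim [OF _ filterlim_real_sequentially])
  have ev2: "\<forall>\<^sub>F p in sequentially. 4 \<le> real p powr \<beta>"
    using \<beta>(1) by real_asymp
  obtain p0 where p0: "\<And>p. p0 \<le> p \<Longrightarrow> (\<forall>l::real. 1 \<le> l \<longrightarrow> l \<le> 3 * log 2 (real p) + 2 \<longrightarrow>
     (2 * real p * (600 * (real p powr \<beta> / 4) * l)) ^ (4 * n) * (2 * (real p)\<^sup>2 * (22000 * l))
     < (c * (real p powr \<beta> / 4) powr (2 - \<eta>) * (c * (sqrt (real p) / 6) powr (2 - \<eta>))) ^ (4 * n))
     \<and> 4 \<le> real p powr \<beta>"
    using eventually_conj [OF ev ev2] unfolding eventually_sequentially by blast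
  have main: "\<exists>q a. 0 < a \<and> a < q \<and> coprime a q \<and> real q \<le> real p powr (1 + \<beta>) \<and> p dvd q \<and>
     (\<forall>b\<in>set (partial_quotients a q). b \<le> max Z 2)" if p: "prime p" "max p0 36 \<le> p" for p
  proof -
    have p36: "36 \<le> real p" using p(2) by simp
    \<comment> \<open>The divisor 4 more than covers the factor 2 in
      \<open>(2 * \<rho>) ^ (4 * n)\<close>, which has to stay below p^2.2.\<close>
    define \<rho> where "\<rho> = real p powr \<beta> / 4"
    \<comment> \<open>Appending the digit 2 at most triples the norm, so the vectors in
      \<open>V\<close> have entries at most \<open>sqrt p / 2\<close>. The bound 36 for p makes
      \<open>X\<close> at least 1.\<close>
    define X where "X = sqrt (real p) / 6"
    \<comment> \<open>Chosen to give \<open>2 ^ L\<close> at least p^3, which exceeds both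
      \<open>4 * \<rho>\<^sup>2\<close> and the radius p^2.2.\<close>
    define L where "L = nat \<lceil>3 * log 2 (real p)\<rceil>"
    have \<rho>1: "1 \<le> \<rho>" using p0 [of p] p(2) by (simp add: \<rho>_def)
    have X1: "1 \<le> X" using p36 real_le_rsqrt [of 6 "real p"] by (simp add: X_def)
    have lg0: "0 \<le> log 2 (real p)" using p36 by simp
    have Lle: "3 * log 2 (real p) \<le> real L" "real L \<le> 3 * log 2 (real p) + 1"
      using lg0 unfolding L_def by linarith+
    have pL: "real p powr 3 \<le> 2 ^ L"
    proof -
      have "real p powr 3 = (2 powr log 2 (real p)) powr 3" using p36 by simp
      also have "\<dots> = 2 powr (3 * log 2 (real p))" by (simp only: powr_powr mult.commute)
      also have "\<dots> \<le> 2 powr real L" using Lle by (intro powr_mono) auto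
      finally show ?thesis by (simp add: powr_realpow)
    qed
    have \<rho>L: "4 * \<rho>\<^sup>2 \<le> 2 ^ L"
    proof -
      have "4 * \<rho>\<^sup>2 = real p powr (2 * \<beta>) / 4"
        by (simp add: \<rho>_def power2_eq_square powr_add [symmetric])
      also have "\<dots> \<le> real p powr (2 * \<beta>)" by simp
      also have "\<dots> \<le> real p powr 3" using \<beta> p36 by (intro powr_mono) auto
      finally show ?thesis using pL by linarith
    qed
    obtain W where W: "finite W" "\<And>w. w \<in> W \<Longrightarrow> even (length w)"
      "\<And>w b. w \<in> W \<Longrightarrow> b \<in> set w \<Longrightarrow> 1 \<le> b \<and> b \<le> Z"
      "\<And>w. w \<in> W \<Longrightarrow> real_of_int (mnorm (wmat w)) \<le> \<rho>"
      "c * \<rho> powr (2 - \<eta>) \<le> real (card W)" using thick [OF \<rho>1] by blast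
    obtain U where U: "finite U" "\<And>w b. w \<in> U \<Longrightarrow> b \<in> set w \<Longrightarrow> 1 \<le> b \<and> b \<le> Z"
      "\<And>w. w \<in> U \<Longrightarrow> real_of_int (mnorm (wmat w)) \<le> X"
      "c * X powr (2 - \<eta>) \<le> real (card U)" using thick [OF X1] by blast
    \<comment> \<open>The operator applies \<open>adj g\<close>, so starting from adjugates returns
      the word matrices themselves.\<close>
    define A where "A = (\<lambda>w. adj (wmat w)) ` W"
    define V where "V = (\<lambda>w. wcol (w @ [2])) ` U"
    have cA: "card A = card W"
    proof -
      have "inj_on wmat W" using W(3) by (intro inj_on_wmat) blast
      then show ?thesis unfolding A_def by (intro card_image) (simp add: inj_on_def)
    qed
    have wcol: "wcol w = (int (fst (cont w)), int (snd (cont w)))" for w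
      by (simp add: wcol_def cont_wmat)
    have cV: "card V = card U"
    proof -
      have "inj_on (\<lambda>w. cont (w @ [2])) U" using U(2) by (intro inj_on_cont_snoc_two) blast
      then show ?thesis unfolding V_def wcol by (intro card_image) (simp add: inj_on_def prod_eq_iff)
    qed
    interpret averaging \<rho> L p A
    proof
      show "A \<subseteq> mat_ball.B \<rho>"
        using W by (auto simp: A_def mat_ball.B_def [OF mat_ball.intro [OF \<rho>1 \<rho>L]] mdet_wmat)
    qed (use \<rho>1 \<rho>L p in auto)
    have V: "0 < snd v \<and> snd v < fst v \<and> coprime (fst v) (snd v) \<and> real_of_int (fst v) \<le> sqrt (real p) / 2"
      if vV: "v \<in> V" for v
    proof -
      obtain w where w: "w \<in> U" "v = wcol (w @ [2])" using vV unfolding V_def by blast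
      have "0 < snd (cont (w @ [2])) \<and> snd (cont (w @ [2])) < fst (cont (w @ [2]))"
      proof -
        have "0 < snd (cont (w @ [2])) \<and> snd (cont (w @ [2])) < fst (cont (w @ [2]))
          \<and> partial_quotients (snd (cont (w @ [2]))) (fst (cont (w @ [2]))) = w @ [2]"
          by (rule partial_quotients_cont) (use U(2) [OF w(1)] in auto)
        then show ?thesis by blast
      qed
      moreover have "real (fst (cont (w @ [2]))) \<le> 3 * X" using U(3) [OF w(1)] by (rule fst_cont_snoc_two)
      ultimately show ?thesis using coprime_cont [of "w @ [2]"] unfolding w(2) wcol X_def by simp
    qed
    have sq: "sqrt (real p) * sqrt (real p) = real p" by simp
    have sp: "sqrt (real p) / 2 < real p"
    proof -
      have "sqrt (real p) * 1 \<le> sqrt (real p) * sqrt (real p)" using p36 by (intro mult_left_mono) auto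
      then show ?thesis using p36 sq by linarith
    qed
    have "\<exists>g\<in>A. \<exists>x\<in>V. \<exists>y\<in>V. P dvd vdot y (act (adj g) x)"
    proof (rule exists_solution [OF _ _ _ n])
      show "finite V" using U(1) by (simp add: V_def)
      show "\<not> vcong x (0, 0)" if "x \<in> V" for x
      proof
        assume "vcong x (0, 0)"
        then have "P dvd fst x" by (simp add: vcong_zero_iff)
        then have "P \<le> fst x" using V [OF that] by (intro zdvd_imp_le) auto
        then have "real p \<le> real_of_int (fst x)" by (metis of_int_le_iff of_int_of_nat_eq)
        then show False using V [OF that] sp by linarith
      qed
      \<comment> \<open>Cross products of vectors in \<open>V\<close> are smaller than p in absolute
        value, so divisibility by p makes them 0. Parallel primitive vectors with positive entries
        coincide.\<close>
      show "x = y" if xy: "x \<in> V" "y \<in> V" "P dvd cross x y" for x y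
      proof -
        have lt: "real_of_int (fst u * snd v) < real p" if "u \<in> V" "v \<in> V" for u v
        proof -
          have "real_of_int (fst u * snd v) \<le> (sqrt (real p) / 2) * (sqrt (real p) / 2)"
            unfolding of_int_mult using V [OF that(1)] V [OF that(2)] by (intro mult_mono) auto
          also have "\<dots> = real p / 4" by simp
          finally show ?thesis using p36 by linarith
        qed
        have lt': "fst u * snd v < P" if "u \<in> V" "v \<in> V" for u v
          using lt [OF that] by linarith
        have pos: "0 < fst u * snd v" if "u \<in> V" "v \<in> V" for u v
          using V [OF that(1)] V [OF that(2)] by auto
        have "\<bar>cross x y\<bar> < P"
          using lt' [OF xy(1,2)] lt' [OF xy(2,1)] pos [OF xy(1,2)] pos [OF xy(2,1)]
          by (auto simp: cross_def mult.commute)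
        then have "cross x y = 0" using xy(3) dvd_imp_le_int [of "cross x y" P] by (cases "cross x y = 0") auto
        then have "fst x * snd y = snd x * fst y" by (simp add: cross_def)
        then obtain t where t: "fst y = t * fst x" "snd y = t * snd x"
          using proportional_if_coprime V [OF xy(1)] by blast
        have "coprime (t * fst x) (t * snd x)" using V [OF xy(2)] t by simp
        then have "is_unit t" by (meson coprime_common_divisor dvd_triv_left)
        moreover have "0 < t * fst x" "0 < fst x" using V [OF xy(1)] V [OF xy(2)] t by auto
        ultimately have "t = 1" by (auto simp: zero_less_mult_iff)
        then show "x = y" using t by (simp add: prod_eq_iff)
      qed
      have E: "E n \<le> 22000 * (real L + 1)"
        unfolding E_def
      proof (rule sum_principal_ball)
        show "3 \<le> p" using p(2) by simp
        show "1 \<le> (2 * \<rho>) ^ (4 * n)" using \<rho>1 by (intro one_le_power) auto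
        have "(2 * \<rho>) ^ (4 * n) \<le> (real p powr \<beta>) ^ (4 * n)" using \<rho>1 by (intro power_mono) (auto simp: \<rho>_def)
        also have "\<dots> = real p powr (\<beta> * real (4 * n))"           unfolding powr_powr [symmetric] by (rule powr_realpow [symmetric]) (use p36 in simp)
        also have "\<beta> * real (4 * n) = 2.2" using n1 by (simp add: \<beta>_def)
        finally show le: "(2 * \<rho>) ^ (4 * n) \<le> real p powr 2.2" .
        have "real p powr 2.2 \<le> real p powr 3" using p36 by (intro powr_mono) auto
        then show "(2 * \<rho>) ^ (4 * n) \<le> 2 ^ L" using le pL by linarith
      qed
      have "((real p + 1) * K) ^ (4 * n) * (2 * (real p)\<^sup>2 * E n)
        \<le> (2 * real p * (600 * \<rho> * (real L + 1))) ^ (4 * n) * (2 * (real p)\<^sup>2 * (22000 * (real L + 1)))"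
      proof (rule mult_mono)
        show "((real p + 1) * K) ^ (4 * n) \<le> (2 * real p * (600 * \<rho> * (real L + 1))) ^ (4 * n)"
          using p36 K_nonneg unfolding K_def by (intro power_mono mult_right_mono) auto
        show "2 * (real p)\<^sup>2 * E n \<le> 2 * (real p)\<^sup>2 * (22000 * (real L + 1))"
          using E by (intro mult_left_mono) auto
        show "0 \<le> 2 * (real p)\<^sup>2 * E n" using E_nonneg by simp
        show "0 \<le> (2 * real p * (600 * \<rho> * (real L + 1))) ^ (4 * n)" using \<rho>1 by simp
      qed
      also have "\<dots> < (c * \<rho> powr (2 - \<eta>) * (c * X powr (2 - \<eta>))) ^ (4 * n)"
        unfolding \<rho>_def X_def
      proof (rule conjunct1 [OF p0, rule_format])
        show "p0 \<le> p" using p(2) by simp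
        show "1 \<le> real L + 1" "real L + 1 \<le> 3 * log 2 (real p) + 2" using Lle by simp_all
      qed
      also have "\<dots> \<le> (real (card A) * real (card V)) ^ (4 * n)"
        unfolding cA cV using W(5) U(4) c by (intro power_mono mult_mono) auto
      finally show "((real p + 1) * K) ^ (4 * n) * (2 * (real p)\<^sup>2 * E n)
        < (real (card A) * real (card V)) ^ (4 * n)" .
    qed
    then obtain g x y where gxy: "g \<in> A" "x \<in> V" "y \<in> V" "P dvd vdot y (act (adj g) x)" by blast
    obtain w where w: "w \<in> W" "adj g = wmat w" using gxy(1) unfolding A_def by auto
    obtain u where u: "u \<in> U" "x = wcol (u @ [2])" using gxy(2) unfolding V_def by blast
    obtain v where v: "v \<in> U" "y = wcol (v @ [2])" using gxy(3) unfolding V_def by blast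
    \<comment> \<open>The 2 at the very end makes the expansion regular; the other appended 2 lands
      at the front and is just another digit.\<close>
    define z where "z = rev (v @ [2]) @ w @ (u @ [2])"
    define q a where "q = fst (cont z)" and "a = snd (cont z)"
    have zq: "vdot y (act (adj g) x) = int q" unfolding w u v q_def z_def by (rule vdot_wcol_act)
    have digits: "1 \<le> b \<and> b \<le> max Z 2" if "b \<in> set z" for b
      using that W(3) [OF w(1)] U(2) [OF u(1)] U(2) [OF v(1)] by (fastforce simp: z_def)
    have pq: "0 < a \<and> a < q \<and> partial_quotients a q = z"
      unfolding a_def q_def using digits by (intro partial_quotients_cont) (auto simp: z_def)
    have "p dvd q" using gxy(4) zq by simp
    moreover have "coprime a q" using coprime_cont [of z] by (simp add: a_def q_def coprime_commute)
    moreover have "real q \<le> real p powr (1 + \<beta>)"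
    proof -
      have xb: "\<bar>real_of_int (fst x)\<bar> \<le> sqrt (real p) / 2" "\<bar>real_of_int (snd x)\<bar> \<le> sqrt (real p) / 2"
        "\<bar>real_of_int (fst y)\<bar> \<le> sqrt (real p) / 2" "\<bar>real_of_int (snd y)\<bar> \<le> sqrt (real p) / 2"
        using V [OF gxy(2)] V [OF gxy(3)] by auto
      have G: "\<bar>real_of_int (m11 (wmat w))\<bar> \<le> \<rho>" "\<bar>real_of_int (m12 (wmat w))\<bar> \<le> \<rho>"
        "\<bar>real_of_int (m21 (wmat w))\<bar> \<le> \<rho>" "\<bar>real_of_int (m22 (wmat w))\<bar> \<le> \<rho>"
        using W(4) [OF w(1)] abs_entry_le_mnorm [of "wmat w"] by linarith+
      have two: "\<bar>s * t + s' * t'\<bar> \<le> 2 * (M * N)"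
        if "\<bar>s\<bar> \<le> M" "\<bar>t\<bar> \<le> N" "\<bar>s'\<bar> \<le> M" "\<bar>t'\<bar> \<le> N" for s t s' t' M N :: real
      proof -
        have "\<bar>s * t\<bar> \<le> M * N" "\<bar>s' * t'\<bar> \<le> M * N" unfolding abs_mult using that by (auto intro!: mult_mono)
        then show ?thesis by linarith
      qed
      have "\<bar>real_of_int (fst (act (wmat w) x))\<bar> \<le> 2 * (\<rho> * (sqrt (real p) / 2))"
        "\<bar>real_of_int (snd (act (wmat w) x))\<bar> \<le> 2 * (\<rho> * (sqrt (real p) / 2))"
        unfolding act_def fst_conv snd_conv of_int_add of_int_mult by (intro two G xb)+
      then have "\<bar>real_of_int (vdot y (act (wmat w) x))\<bar> \<le> 2 * ((sqrt (real p) / 2) * (2 * (\<rho> * (sqrt (real p) / 2))))"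
        unfolding vdot_def of_int_add of_int_mult by (intro two xb)
      also have "\<dots> = \<rho> * (sqrt (real p) * sqrt (real p))" by simp
      finally have "real q \<le> \<rho> * real p" using zq w(2) sq by simp
      also have "\<dots> \<le> real p powr \<beta> * real p" unfolding \<rho>_def by (intro mult_right_mono) auto
      also have "\<dots> = real p powr (1 + \<beta>)" using p36 by (simp add: powr_add)
      finally show ?thesis .
    qed
    moreover have "\<forall>b\<in>set (partial_quotients a q). b \<le> max Z 2"
      using pq digits by (metis)
    ultimately show ?thesis using pq by blast
  qed
  show ?thesis
    unfolding \<beta>_def [symmetric]
    by (intro exI [of _ "max Z 2"] exI [of _ "max p0 36"] allI impI main)
qed

theorem theorem5:
  fixes \<epsilon> :: real
  assumes "0 < \<epsilon>" and "\<epsilon> \<le> 1"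
  shows "\<exists>(\<zeta>::real) (C::real). \<forall>p::nat. prime p \<longrightarrow>
           (\<exists>q a :: nat. 0 < a \<and> a < q \<and> coprime a q \<and>
              real q \<le> C * real p powr (1 + \<epsilon>) \<and> p dvd q \<and>
              (\<forall>b \<in> set (partial_quotients a q). real b \<le> \<zeta>))"
proof -
  \<comment> \<open>Any \<open>n\<close> above \<open>1 / \<epsilon>\<close> suffices; a power of
    two is taken for the sake of the iterated Cauchy-Schwarz inequality.\<close>
  obtain j :: nat where j: "1 / \<epsilon> < 2 ^ j" using real_arch_pow [of 2 "1 / \<epsilon>"] by auto
  define n :: nat where "n = 2 ^ j"
  have "1 / \<epsilon> < real n" using j by (simp add: n_def)
  then have "1 / real n < \<epsilon>" using assms(1) by (simp add: field_simps n_def)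
  moreover have "11 / (20 * real n) \<le> 1 / real n" by (simp add: field_simps n_def)
  ultimately have le: "11 / (20 * real n) \<le> \<epsilon>" by linarith
  obtain Z p0 where large: "\<And>p. prime p \<Longrightarrow> p0 \<le> p \<Longrightarrow> \<exists>q a. 0 < a \<and> a < q \<and> coprime a q \<and>
     real q \<le> real p powr (1 + 11 / (20 * real n)) \<and> p dvd q \<and>
     (\<forall>b\<in>set (partial_quotients a q). b \<le> Z)"
    using exists_fraction_large [OF n_def] by blast
  have "\<exists>q a :: nat. 0 < a \<and> a < q \<and> coprime a q \<and> real q \<le> 1 * real p powr (1 + \<epsilon>) \<and> p dvd q \<and>
      (\<forall>b \<in> set (partial_quotients a q). real b \<le> real (max Z p0))" if p: "prime p" for p
  proof (cases "p0 \<le> p")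
    case True
    obtain q a where qa: "0 < a" "a < q" "coprime a q" "real q \<le> real p powr (1 + 11 / (20 * real n))" "p dvd q"
      "\<forall>b\<in>set (partial_quotients a q). b \<le> Z"
      using large [OF p True] by blast
    have "real p powr (1 + 11 / (20 * real n)) \<le> real p powr (1 + \<epsilon>)"
      using le prime_gt_1_nat [OF p] by (intro powr_mono) auto
    then have q: "real q \<le> 1 * real p powr (1 + \<epsilon>)" using qa(4) by simp
    have "real b \<le> real (max Z p0)" if "b \<in> set (partial_quotients a q)" for b
      using bspec [OF qa(6) that] by simp
    then show ?thesis by (intro exI [of _ q] exI [of _ a] conjI ballI qa q)
  next
    \<comment> \<open>The finitely many small primes use the fraction 1/p, whose only partial
      quotient p is below \<open>p0\<close>. They are thus absorbed by \<open>\<zeta>\<close>, and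
      \<open>C\<close> can be 1.\<close>
    case False
    have p1: "1 < p" using p by (rule prime_gt_1_nat)
    have "partial_quotients 0 1 = []" by (subst partial_quotients.simps) simp
    moreover have "partial_quotients 1 p = (p div 1) # partial_quotients (p mod 1) 1"
      by (subst partial_quotients.simps) simp
    ultimately have "partial_quotients 1 p = [p]" by simp
    moreover have "real p powr 1 \<le> real p powr (1 + \<epsilon>)"
      using assms p1 by (intro powr_mono) auto
    ultimately show ?thesis using p1 False by (intro exI [of _ p] exI [of _ 1]) auto
  qed
  then show ?thesis by blast
qed

end
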